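(* Let $K$ be a field of prime characteristic $p>2$ with $[K:K^p]<\infty$, let $S=K[\![x_1,\dots,x_n]\!]$, and let $f=x_1^{d_1}\cdots x_n^{d_n}\in S$ be a monomial where $d_j$ is a positive integer for each $1\le j\le n$. Let $R^{\sharp}=S[\![z]\!]/(f+z^2)$, where $z$ is a new variable. Then: (1) if $d_j=1$ for each $1\le j\le n$, then $\mathbb S(R^{\sharp})=\frac{1}{2^{n-1}}$; (2) if $d=\max\{d_1,\dots,d_n\}\ge2$, then $\mathbb S(R^{\sharp})=0$.
   Context: For a commutative ring $A$ of prime characteristic $p$ and $e\ge0$, $F_*^e(A)$ is the $A$-module with elements $\{F_*^ea : a\in A\}$, addition inherited from $A$ and action $r\,F_*^ea=F_*^e(r^{p^e}a)$. If $(A,\mathfrak m_A,k)$ is an $F$-finite Noetherian local ring of prime characteristic $p$ and dimension $\delta$, with $[k:k^p]<\infty$ and $\alpha(A)=\log_p[k:k^p]$, its $F$-signature is $\mathbb S(A)=\lim_{e\to\infty}\frac{\sharp(F_*^e(A),A)}{p^{e(\delta+\alpha(A))}}$, where $\sharp(M,A)$ denotes the maximal rank of a free direct summand of $M$. *)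

theory Defs
  imports
    Complex_Main
    "HOL-Computational_Algebra.Primes"
    "HOL-Algebra.Indexed_Polynomials"
    "HOL-Library.Extended_Nat"
begin

section \<open>Formal power series over a ring, in variables indexed by a set\<close>

text \<open>
  As in \<^theory>\<open>HOL-Algebra.Indexed_Polynomials\<close>, a monomial is a multiset of variables and a series
  is its coefficient function; coefficients of monomials that involve variables outside \<open>I\<close> are
  zero. For \<open>I = {1..n}\<close> this is \<open>R[[x\<^sub>1,\<dots>,x\<^sub>n]]\<close>. The constant series and the variables are the
  library's \<^const>\<open>ring.indexed_const\<close> and \<^const>\<open>ring.indexed_var\<close>.
\<close>

definition power_series_ring ::
    "('a, 'm) ring_scheme \<Rightarrow> 'i set \<Rightarrow> ('i multiset \<Rightarrow> 'a) ring" where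
  "power_series_ring R I =
     \<lparr>carrier = {f. (\<forall>m. f m \<in> carrier R) \<and> (\<forall>m. \<not> set_mset m \<subseteq> I \<longrightarrow> f m = \<zero>\<^bsub>R\<^esub>)},
      monoid.mult = (\<lambda>f g m. \<Oplus>\<^bsub>R\<^esub>a\<in>{a. a \<subseteq># m}. f a \<otimes>\<^bsub>R\<^esub> g (m - a)),
      one = (\<lambda>m. if m = {#} then \<one>\<^bsub>R\<^esub> else \<zero>\<^bsub>R\<^esub>),
      ring.zero = (\<lambda>m. \<zero>\<^bsub>R\<^esub>),
      add = (\<lambda>f g m. f m \<oplus>\<^bsub>R\<^esub> g m)\<rparr>"


section \<open>Characteristic, Krull dimension, local rings\<close>

text \<open>The same convention as \<^const>\<open>semiring_char\<close>: the value is 0 if no positive multiple of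
  the unit vanishes.\<close>

definition ring_char :: "('a, 'm) ring_scheme \<Rightarrow> nat" where
  "ring_char R = Gcd {n::nat. [n] \<cdot>\<^bsub>R\<^esub> \<one>\<^bsub>R\<^esub> = \<zero>\<^bsub>R\<^esub>}"

definition krull_dim :: "('a, 'm) ring_scheme \<Rightarrow> enat" where
  "krull_dim R = Sup {enat l | l. \<exists>P :: nat \<Rightarrow> 'a set.
     (\<forall>i\<le>l. primeideal (P i) R) \<and> (\<forall>i<l. P i \<subset> P (Suc i))}"

text \<open>Meaningful for local rings only, where the maximal ideal is unique.\<close>

definition max_ideal :: "('a, 'm) ring_scheme \<Rightarrow> 'a set" where
  "max_ideal R = (THE M. maximalideal M R)"

definition residue_field :: "('a, 'm) ring_scheme \<Rightarrow> 'a set ring" where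
  "residue_field R = R Quot max_ideal R"

definition pth_powers :: "nat \<Rightarrow> ('a, 'm) ring_scheme \<Rightarrow> 'a set" where
  "pth_powers p R = (\<lambda>x. x [^]\<^bsub>R\<^esub> p) ` carrier R"


section \<open>Free direct summands\<close>

text \<open>\<open>F\<close> is free of rank \<open>r\<close> over \<open>A\<close>: it has a basis \<open>b\<^sub>0, \<dots>, b\<^bsub>r-1\<^esub>\<close>.\<close>

definition free_submodule_of_rank ::
    "('a, 'm) ring_scheme \<Rightarrow> ('a, 'b, 'c) module_scheme \<Rightarrow> 'b set \<Rightarrow> nat \<Rightarrow> bool" where
  "free_submodule_of_rank A M F r \<longleftrightarrow>
     submodule F A M \<and>
     (\<exists>b. b \<in> {..<r} \<rightarrow> F \<and>
          (\<forall>x\<in>F. \<exists>!c. c \<in> {..<r} \<rightarrow>\<^sub>E carrier A \<and>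
                        x = (\<Oplus>\<^bsub>M\<^esub>i\<in>{..<r}. c i \<odot>\<^bsub>M\<^esub> b i)))"

definition has_free_summand ::
    "('a, 'm) ring_scheme \<Rightarrow> ('a, 'b, 'c) module_scheme \<Rightarrow> nat \<Rightarrow> bool" where
  "has_free_summand A M r \<longleftrightarrow>
     (\<exists>F N. free_submodule_of_rank A M F r \<and> submodule N A M \<and>
            F \<inter> N = {\<zero>\<^bsub>M\<^esub>} \<and> F <+>\<^bsub>M\<^esub> N = carrier M)"

definition max_free_rank ::
    "('a, 'm) ring_scheme \<Rightarrow> ('a, 'b, 'c) module_scheme \<Rightarrow> nat" where
  "max_free_rank A M = Max {r. has_free_summand A M r}"


section \<open>Frobenius push-forward and F-signature\<close>

text \<open>The element \<open>F\<^sub>*\<^sup>e a\<close> is represented by \<open>a\<close> itself. The fields \<^const>\<open>monoid.mult\<close> and \<^const>\<open>one\<close>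
  are present only because module records extend ring records.\<close>

definition frobenius_pushforward ::
    "nat \<Rightarrow> nat \<Rightarrow> ('a, 'm) ring_scheme \<Rightarrow> ('a, 'a) module" where
  "frobenius_pushforward p e A =
     \<lparr>carrier = carrier A, monoid.mult = monoid.mult A, one = one A, ring.zero = ring.zero A, add = add A,
      smult = (\<lambda>r a. (r [^]\<^bsub>A\<^esub> (p ^ e)) \<otimes>\<^bsub>A\<^esub> a)\<rparr>"

text \<open>\<open>\<alpha>(A) = log\<^sub>p [k : k\<^sup>p]\<close> for the residue field \<open>k\<close> of \<open>A\<close>.\<close>

definition alpha :: "nat \<Rightarrow> ('a, 'm) ring_scheme \<Rightarrow> real" where
  "alpha p A = (let k = residue_field A in
     log (real p) (real (ring.dim k (pth_powers p k) (carrier k))))"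

text \<open>
  The F-signature is intended for F-finite Noetherian local rings of prime characteristic; for these
  the Krull dimension and the maximal free rank are finite and the limit exists. For other
  rings the values below carry no meaning.
\<close>

definition F_signature_seq :: "('a, 'm) ring_scheme \<Rightarrow> nat \<Rightarrow> real" where
  "F_signature_seq A e = (let p = ring_char A in
     real (max_free_rank A (frobenius_pushforward p e A)) /
     real p powr (real e * (real (the_enat (krull_dim A)) + alpha p A)))"

definition F_signature :: "('a, 'm) ring_scheme \<Rightarrow> real" where
  "F_signature A = lim (F_signature_seq A)"

end

theory Submission
  imports Defs "HOL-Library.Multiset_Order"
begin

text \<open>
  Writing \<open>z\<^sup>2 = c\<close> with \<open>c = -f\<close>, the ring is \<open>S \<oplus> S z\<close>, and for \<open>q = p\<^sup>e = 2 h + 1\<close> one has \<open>z\<^sup>q = c\<^sup>h z\<close>. Fix a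
  basis \<open>\<lambda>\<^sub>i\<close> of \<open>K\<close> over \<open>K\<^sup>q\<close>. Over \<open>S\<close>, the module \<open>F\<^sub>*\<^sup>e R\<close> is free on \<open>F\<^sub>*\<^sup>e(\<lambda>\<^sub>i x\<^sup>a)\<close> and \<open>F\<^sub>*\<^sup>e(\<lambda>\<^sub>i x\<^sup>a z)\<close> with \<open>0 \<le> a\<^sub>j < q\<close>,
  and \<open>z\<close> permutes these generators up to monomials in \<open>S\<close>. If \<open>z\<close> maps a generator into \<open>x\<^sub>j F\<^sub>*\<^sup>e R\<close>, every
  functional sends that generator into the maximal ideal; this happens unless \<open>a\<^sub>j + h d\<^sub>j < q\<close> for all \<open>j\<close>
  (first kind) or \<open>a\<^sub>j + (h + 1) d\<^sub>j < q\<close> for all \<open>j\<close> (second kind). So the free rank is at most \<open>[K : K\<^sup>q]\<close>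
  times the number of these exponents, and for \<open>d = (1, \<dots>, 1)\<close> the coordinate functionals show that the
  bound \<open>[K : K\<^sup>q] ((h + 1)\<^sup>n + h\<^sup>n)\<close> is attained.

  The Krull dimension is at most \<open>n\<close> because the number of monomials of degree below \<open>D\<close> outside the
  leading ideal of a prime of \<open>S\<close> drops by one order of growth in \<open>D\<close> along each strict inclusion of primes
  (Artin--Rees, through a standard basis), and \<open>R\<close> is integral over \<open>S\<close>.
\<close>


section \<open>Power series over a commutative ring\<close>

text \<open>The bound on the rank is linear algebra over \<open>K\<close>: modulo the maximal ideal
  a functional is determined by its values on the generators, and those outside the two ranges
  contribute nothing, so more functionals than surviving generators cannot have a dual family. For d
  = (1, ..., 1) the rank divided by \<open>[K : K\<^sup>q]\<close> is (h + 1)^n + h^n with h about q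
  / 2; divided by q^n this tends to 2 (1/2)^n, the source of 1 / 2^(n - 1). If some d_j is at least
  2, then h d_j \<ge> q - 1 leaves at most one exponent in that variable, and the rank loses a full
  factor q.

  The obstacle is the normalisation: the dimension has to be found from chains of primes. For the
  lower bound, R need not be a domain, because -f is a square when -1 is a square in
  \<open>K\<close> and all d_j are even; the bottom prime of the chain is therefore chosen by cases.
  All computations take place on pairs (g, h) standing for g + h z, and characteristic, dimension,
  residue field and ranks are carried to the quotient along an isomorphism.\<close>

lemma finite_submultisets [simp]: "finite {a. a \<subseteq># m}"
proof (induction m)
  case (add x m)
  have "{a. a \<subseteq># add_mset x m} \<subseteq> {a. a \<subseteq># m} \<union> add_mset x ` {a. a \<subseteq># m}"
  proof
    fix a assume a: "a \<in> {a. a \<subseteq># add_mset x m}"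
    show "a \<in> {a. a \<subseteq># m} \<union> add_mset x ` {a. a \<subseteq># m}"
    proof (cases "x \<in># a")
      case True
      then have "a = add_mset x (a - {#x#})" "a - {#x#} \<subseteq># m"
        using a by (auto simp: subset_eq_diff_conv)
      then show ?thesis by blast
    next
      case False
      then have "a \<subseteq># m" using a
        by (auto simp: subseteq_mset_def count_add_mset) (metis not_in_iff le0)
      then show ?thesis by blast
    qed
  qed
  then show ?case using add finite_subset by blast
qed simp

section \<open>Reindexing and interchanging finite sums\<close>

context abelian_monoid
begin

lemma finsum_bij:
  assumes "bij_betw h A B" "\<And>x. x \<in> A \<Longrightarrow> g x = f (h x)" "f \<in> B \<rightarrow> carrier G"
  shows "finsum G g A = finsum G f B"
proof -
  have B: "B = h ` A" "inj_on h A" using assms(1) by (auto simp: bij_betw_def)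
  have "finsum G f B = finsum G (\<lambda>x. f (h x)) A"
    using assms(3) finsum_reindex[of f h A] B by blast
  also have "\<dots> = finsum G g A"
    using assms B by (intro finsum_cong') auto
  finally show ?thesis by simp
qed

lemma finsum_only:
  assumes "finite A" "i \<in> A" "f i \<in> carrier G" "\<And>j. j \<in> A \<Longrightarrow> j \<noteq> i \<Longrightarrow> f j = \<zero>"
  shows "finsum G f A = f i"
proof -
  have "finsum G f A = finsum G (\<lambda>j. if i = j then f j else \<zero>) A"
    using assms by (intro finsum_cong') auto
  also have "\<dots> = f i"
    using assms by (intro finsum_singleton) (auto, metis zero_closed)
  finally show ?thesis .
qed

lemma finsum_all_zero: "(\<And>j. j \<in> A \<Longrightarrow> f j = \<zero>) \<Longrightarrow> finsum G f A = \<zero>"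
  by (rule add.finprod_one_eqI)

lemma finsum_neutral:
  assumes "finite B" "A \<subseteq> B" "\<And>i. i \<in> B - A \<Longrightarrow> f i = \<zero>" "f \<in> B \<rightarrow> carrier G"
  shows "finsum G f B = finsum G f A"
  using assms by (intro add.finprod_mono_neutral_cong_right) auto

lemma finsum_Sigma:
  assumes "finite A" "\<And>a. a \<in> A \<Longrightarrow> finite (B a)"
    "\<And>a b. a \<in> A \<Longrightarrow> b \<in> B a \<Longrightarrow> f (a, b) \<in> carrier G"
  shows "finsum G (\<lambda>a. finsum G (\<lambda>b. f (a, b)) (B a)) A = finsum G f (Sigma A B)"
  using assms
proof (induction A rule: finite_induct)
  case (insert x F)
  have eq: "Sigma (insert x F) B = Pair x ` B x \<union> Sigma F B" by auto
  have 1: "finsum G f (Pair x ` B x) = finsum G (\<lambda>b. f (x, b)) (B x)"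
    using insert.prems by (intro finsum_bij[symmetric, of "Pair x"]) (auto simp: bij_betw_def inj_on_def)
  have 2: "finsum G f (Sigma (insert x F) B) = finsum G f (Pair x ` B x) \<oplus> finsum G f (Sigma F B)"
    unfolding eq using insert by (intro finsum_Un_disjoint) auto
  have "finsum G (\<lambda>a. finsum G (\<lambda>b. f (a, b)) (B a)) (insert x F)
      = finsum G (\<lambda>b. f (x, b)) (B x) \<oplus> finsum G (\<lambda>a. finsum G (\<lambda>b. f (a, b)) (B a)) F"
    using insert by (intro finsum_insert) (auto intro!: finsum_closed)
  then show ?case using 1 2 insert by auto
qed simp

lemma finsum_swap:
  assumes "finite A" "finite B" "\<And>a b. a \<in> A \<Longrightarrow> b \<in> B \<Longrightarrow> f a b \<in> carrier G"
  shows "finsum G (\<lambda>a. finsum G (f a) B) A = finsum G (\<lambda>b. finsum G (\<lambda>a. f a b) A) B"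
proof -
  have "finsum G (\<lambda>a. finsum G (f a) B) A = finsum G (\<lambda>(a,b). f a b) (A \<times> B)"
    using finsum_Sigma[of A "\<lambda>_. B" "\<lambda>(a,b). f a b"] assms by simp
  also have "\<dots> = finsum G (\<lambda>(b,a). f a b) (B \<times> A)"
    using assms by (intro finsum_bij[of "\<lambda>(a,b). (b,a)"]) (auto simp: bij_betw_def inj_on_def)
  also have "\<dots> = finsum G (\<lambda>b. finsum G (\<lambda>a. f a b) A) B"
    using finsum_Sigma[of B "\<lambda>_. A" "\<lambda>(b,a). f a b"] assms by simp
  finally show ?thesis .
qed

end

lemma (in abelian_group) finsum_minus:
  assumes "f \<in> A \<rightarrow> carrier G"
  shows "finsum G (\<lambda>i. \<ominus> f i) A = \<ominus> finsum G f A"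
proof -
  have z: "\<ominus> \<zero> = \<zero>" by (rule minus_equality) auto
  show ?thesis using assms
  proof (induction A rule: infinite_finite_induct)
    case (insert x F)
    then show ?case by (subst (1 2) finsum_insert) (auto simp: Pi_iff minus_add)
  qed (auto simp: z)
qed

text \<open>The series with one term, \<open>c\<close> times the monomial \<open>\<mu>\<close>.
  Constants, variables and powers of f are all brought to this form, in which products add exponents
  and powers scale them.\<close>

definition pmono :: "('a, 'm) ring_scheme \<Rightarrow> 'a \<Rightarrow> 'i multiset \<Rightarrow> 'i multiset \<Rightarrow> 'a" where
  "pmono R c \<mu> = (\<lambda>m. if m = \<mu> then c else \<zero>\<^bsub>R\<^esub>)"

lemma ps_simps:
  "monoid.mult (power_series_ring R I) f g m = finsum R (\<lambda>a. f a \<otimes>\<^bsub>R\<^esub> g (m - a)) {a. a \<subseteq># m}"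
  "\<one>\<^bsub>power_series_ring R I\<^esub> m = (if m = {#} then \<one>\<^bsub>R\<^esub> else \<zero>\<^bsub>R\<^esub>)"
  "\<zero>\<^bsub>power_series_ring R I\<^esub> m = \<zero>\<^bsub>R\<^esub>"
  "(f \<oplus>\<^bsub>power_series_ring R I\<^esub> g) m = f m \<oplus>\<^bsub>R\<^esub> g m"
  by (simp_all add: power_series_ring_def)

lemma ps_carrierI:
  assumes "\<And>m. set_mset m \<subseteq> I \<Longrightarrow> f m \<in> carrier R" "\<And>m. \<not> set_mset m \<subseteq> I \<Longrightarrow> f m = \<zero>\<^bsub>R\<^esub>"
    "\<zero>\<^bsub>R\<^esub> \<in> carrier R"
  shows "f \<in> carrier (power_series_ring R I)"
  using assms by (simp add: power_series_ring_def) metis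

lemma ps_carrierD:
  assumes "f \<in> carrier (power_series_ring R I)"
  shows "f m \<in> carrier R" "\<not> set_mset m \<subseteq> I \<Longrightarrow> f m = \<zero>\<^bsub>R\<^esub>"
  using assms by (simp_all add: power_series_ring_def)

section \<open>Ring structure, monomials and order of power series\<close>

context cring
begin

abbreviation PS where "PS I \<equiv> power_series_ring R I"

lemma ps_mult_closed:
  fixes I :: "'i set"
  assumes "f \<in> carrier (PS I)" "g \<in> carrier (PS I)"
  shows "f \<otimes>\<^bsub>PS I\<^esub> g \<in> carrier (PS I)"
proof (rule ps_carrierI)
  fix m :: "'i multiset" assume m: "\<not> set_mset m \<subseteq> I"
  \<comment> \<open>A variable of \<open>m\<close> outside \<open>I\<close> must occur in
    \<open>a\<close> or in \<open>m - a\<close>, so one of the two coefficients vanishes.\<close>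
  have "f a \<otimes> g (m - a) = \<zero>" if "a \<subseteq># m" for a
  proof (cases "set_mset a \<subseteq> I")
    case True
    have "set_mset m = set_mset a \<union> set_mset (m - a)"
      using that by (metis set_mset_union subset_mset.add_diff_inverse)
    then have "\<not> set_mset (m - a) \<subseteq> I" using m True by blast
    then show ?thesis using assms by (simp add: ps_carrierD)
  next
    case False
    then show ?thesis using assms by (simp add: ps_carrierD)
  qed
  then show "(f \<otimes>\<^bsub>PS I\<^esub> g) m = \<zero>"
    unfolding ps_simps by (intro finsum_all_zero) auto
qed (use assms in \<open>auto simp: ps_simps ps_carrierD intro!: finsum_closed\<close>)

lemma ps_mult_comm:
  fixes I :: "'i set"
  assumes "f \<in> carrier (PS I)" "g \<in> carrier (PS I)"
  shows "f \<otimes>\<^bsub>PS I\<^esub> g = g \<otimes>\<^bsub>PS I\<^esub> f"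
proof
  fix m :: "'i multiset"
  have *: "bij_betw (\<lambda>a. m - a) {a. a \<subseteq># m} {a. a \<subseteq># m}"
    by (rule bij_betw_byWitness[where f' = "\<lambda>a. m - a"])
      (auto simp: subset_mset.le_imp_diff_is_add multiset_eq_iff subseteq_mset_def)
  show "(f \<otimes>\<^bsub>PS I\<^esub> g) m = (g \<otimes>\<^bsub>PS I\<^esub> f) m"
    unfolding ps_simps
  proof (rule finsum_bij[OF *])
    fix x assume x: "x \<in> {a. a \<subseteq># m}"
    then have "m - (m - x) = x" by (auto simp: multiset_eq_iff subseteq_mset_def)
    then show "f x \<otimes> g (m - x) = g (m - x) \<otimes> f (m - (m - x))"
      using assms by (simp add: ps_carrierD m_comm)
  qed (use assms in \<open>auto simp: ps_carrierD\<close>)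
qed

text \<open>Both sides sum over the ordered decompositions of \<open>m\<close> into three multisets;
  the reindexing sends (sum of the first two, first) to (first, second).\<close>

lemma ps_mult_assoc:
  fixes I :: "'i set"
  assumes "f \<in> carrier (PS I)" "g \<in> carrier (PS I)" "h \<in> carrier (PS I)"
  shows "(f \<otimes>\<^bsub>PS I\<^esub> g) \<otimes>\<^bsub>PS I\<^esub> h = f \<otimes>\<^bsub>PS I\<^esub> (g \<otimes>\<^bsub>PS I\<^esub> h)"
proof
  fix m :: "'i multiset"
  note c = assms[THEN ps_carrierD(1)]
  let ?sub = "\<lambda>m :: 'i multiset. {a. a \<subseteq># m}"
  have "((f \<otimes>\<^bsub>PS I\<^esub> g) \<otimes>\<^bsub>PS I\<^esub> h) m
      = finsum R (\<lambda>a. finsum R (\<lambda>b. (f b \<otimes> g (a - b)) \<otimes> h (m - a)) (?sub a)) (?sub m)"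
    unfolding ps_simps using c by (intro finsum_cong' finsum_ldistr) (auto intro!: finsum_closed)
  also have "\<dots> = finsum R (\<lambda>(a, b). (f b \<otimes> g (a - b)) \<otimes> h (m - a)) (Sigma (?sub m) ?sub)"
    using finsum_Sigma[of "?sub m" ?sub "\<lambda>(a,b). (f b \<otimes> g (a - b)) \<otimes> h (m - a)"] c by simp
  also have "\<dots> = finsum R (\<lambda>(b, d). f b \<otimes> (g d \<otimes> h (m - b - d))) (Sigma (?sub m) (\<lambda>b. ?sub (m - b)))"
  proof (rule finsum_bij[where h = "\<lambda>(a,b). (b, a - b)"])
    show "bij_betw (\<lambda>(a,b). (b, a - b)) (Sigma (?sub m) ?sub) (Sigma (?sub m) (\<lambda>b. ?sub (m - b)))"
    proof (rule bij_betw_byWitness[where f' = "\<lambda>(b,d). (b + d, b)"])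
      show "(\<lambda>(a, b). (b, a - b)) ` Sigma (?sub m) ?sub \<subseteq> Sigma (?sub m) (\<lambda>b. ?sub (m - b))"
      proof -
        { fix a b assume "a \<subseteq># m" "b \<subseteq># a"
          then have "b \<subseteq># m \<and> a - b \<subseteq># m - b"
            by (meson subset_mset.order_trans subseteq_mset_def diff_le_mono count_diff)
              (simp add: subseteq_mset_def diff_le_mono) }
        then show ?thesis by auto
      qed
      show "(\<lambda>(b, d). (b + d, b)) ` Sigma (?sub m) (\<lambda>b. ?sub (m - b)) \<subseteq> Sigma (?sub m) ?sub"
      proof -
        { fix b d assume "b \<subseteq># m" "d \<subseteq># m - b"
          then have "b + d \<subseteq># m" by (metis add.commute subset_mset.le_diff_conv2) }
        then show ?thesis by auto
      qed
    qed auto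
  next
    fix x assume x: "x \<in> Sigma (?sub m) ?sub"
    then obtain a b where ab: "x = (a, b)" "a \<subseteq># m" "b \<subseteq># a" by auto
    then have "m - b - (a - b) = m - a" by (auto simp: multiset_eq_iff subseteq_mset_def)
    then show "(case x of (a, b) \<Rightarrow> f b \<otimes> g (a - b) \<otimes> h (m - a)) =
         (case case x of (a, b) \<Rightarrow> (b, a - b) of (b, d) \<Rightarrow> f b \<otimes> (g d \<otimes> h (m - b - d)))"
      using c ab by (simp add: m_assoc)
  qed (use c in auto)
  also have "\<dots> = finsum R (\<lambda>b. finsum R (\<lambda>d. f b \<otimes> (g d \<otimes> h (m - b - d))) (?sub (m - b))) (?sub m)"
    using finsum_Sigma[of "?sub m" "\<lambda>b. ?sub (m - b)" "\<lambda>(b,d). f b \<otimes> (g d \<otimes> h (m - b - d))"] c by simp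
  also have "\<dots> = (f \<otimes>\<^bsub>PS I\<^esub> (g \<otimes>\<^bsub>PS I\<^esub> h)) m"
    unfolding ps_simps using c by (intro finsum_cong' finsum_rdistr[symmetric]) (auto intro!: finsum_closed)
  finally show "((f \<otimes>\<^bsub>PS I\<^esub> g) \<otimes>\<^bsub>PS I\<^esub> h) m = (f \<otimes>\<^bsub>PS I\<^esub> (g \<otimes>\<^bsub>PS I\<^esub> h)) m" .
qed

lemma pmono_mult:
  assumes "c \<in> carrier R" "g \<in> carrier (PS I)"
  shows "(pmono R c \<mu> \<otimes>\<^bsub>PS I\<^esub> g) m = (if \<mu> \<subseteq># m then c \<otimes> g (m - \<mu>) else \<zero>)"
proof (cases "\<mu> \<subseteq># m")
  case True
  have "(pmono R c \<mu> \<otimes>\<^bsub>PS I\<^esub> g) m = pmono R c \<mu> \<mu> \<otimes> g (m - \<mu>)"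
    unfolding ps_simps using True assms
    by (intro finsum_only) (auto simp: pmono_def ps_carrierD)
  then show ?thesis using True by (simp add: pmono_def)
next
  case False
  then show ?thesis unfolding ps_simps using assms
    by (simp, intro finsum_all_zero) (auto simp: pmono_def ps_carrierD)
qed

lemma pmono_closed [simp]:
  assumes "c \<in> carrier R" "set_mset \<mu> \<subseteq> I"
  shows "pmono R c \<mu> \<in> carrier (PS I)"
  using assms by (intro ps_carrierI) (auto simp: pmono_def)

lemma ps_one_eq: "\<one>\<^bsub>PS I\<^esub> = pmono R \<one> {#}"
  by (auto simp: ps_simps pmono_def fun_eq_iff)

lemma ps_cring: "cring (PS I)"
proof (rule cringI)
  have inv: "\<exists>y\<in>carrier (PS I). x \<oplus>\<^bsub>PS I\<^esub> y = \<zero>\<^bsub>PS I\<^esub>" if "x \<in> carrier (PS I)" for x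
  proof
    have z: "\<ominus> \<zero> = \<zero>" by (rule minus_equality) auto
    show "(\<lambda>m. \<ominus> x m) \<in> carrier (PS I)"
      using that by (intro ps_carrierI) (simp_all add: ps_carrierD z)
    show "x \<oplus>\<^bsub>PS I\<^esub> (\<lambda>m. \<ominus> x m) = \<zero>\<^bsub>PS I\<^esub>"
      using that by (simp add: ps_simps fun_eq_iff ps_carrierD(1) r_neg)
  qed
  have add_cl: "x \<oplus>\<^bsub>PS I\<^esub> y \<in> carrier (PS I)" if "x \<in> carrier (PS I)" "y \<in> carrier (PS I)" for x y
    using that by (intro ps_carrierI) (simp_all add: ps_simps ps_carrierD)
  have comm: "x \<oplus>\<^bsub>PS I\<^esub> y = y \<oplus>\<^bsub>PS I\<^esub> x" if "x \<in> carrier (PS I)" "y \<in> carrier (PS I)" for x y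
    using that by (auto simp: fun_eq_iff ps_simps ps_carrierD a_comm)
  show "abelian_group (PS I)"
  proof (rule abelian_groupI)
    show "\<exists>y\<in>carrier (PS I). y \<oplus>\<^bsub>PS I\<^esub> x = \<zero>\<^bsub>PS I\<^esub>" if "x \<in> carrier (PS I)" for x
      using inv[OF that] comm[OF that] by metis
  qed (use add_cl comm in \<open>auto simp: fun_eq_iff ps_simps ps_carrierD a_assoc intro!: ps_carrierI\<close>)
  show "Group.comm_monoid (PS I)"
  proof (rule Group.comm_monoidI)
    show "\<one>\<^bsub>PS I\<^esub> \<otimes>\<^bsub>PS I\<^esub> x = x" if "x \<in> carrier (PS I)" for x
      using that unfolding ps_one_eq by (auto simp: fun_eq_iff pmono_mult ps_carrierD)
    show "\<one>\<^bsub>PS I\<^esub> \<in> carrier (PS I)" unfolding ps_one_eq by simp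
  qed (use ps_mult_comm ps_mult_assoc ps_mult_closed in auto)
  show "(x \<oplus>\<^bsub>PS I\<^esub> y) \<otimes>\<^bsub>PS I\<^esub> z = x \<otimes>\<^bsub>PS I\<^esub> z \<oplus>\<^bsub>PS I\<^esub> y \<otimes>\<^bsub>PS I\<^esub> z"
    if "x \<in> carrier (PS I)" "y \<in> carrier (PS I)" "z \<in> carrier (PS I)" for x y z
  proof
    fix m
    show "((x \<oplus>\<^bsub>PS I\<^esub> y) \<otimes>\<^bsub>PS I\<^esub> z) m = (x \<otimes>\<^bsub>PS I\<^esub> z \<oplus>\<^bsub>PS I\<^esub> y \<otimes>\<^bsub>PS I\<^esub> z) m"
      unfolding ps_simps using that
      by (subst finsum_addf[symmetric]) (auto simp: ps_carrierD l_distr intro!: finsum_cong')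
  qed
qed

lemma ps_minus:
  assumes "f \<in> carrier (PS I)"
  shows "(\<ominus>\<^bsub>PS I\<^esub> f) m = \<ominus> f m"
proof -
  interpret P: cring "PS I" by (rule ps_cring)
  have "(\<ominus>\<^bsub>PS I\<^esub> f \<oplus>\<^bsub>PS I\<^esub> f) m = \<zero>" using assms by (simp add: P.l_neg ps_simps)
  then show ?thesis using assms P.a_inv_closed[OF assms]
    by (metis ps_simps(4) ps_carrierD(1) minus_equality)
qed

lemma ps_finsum:
  assumes "F \<in> A \<rightarrow> carrier (PS I)"
  shows "finsum (PS I) F A m = finsum R (\<lambda>i. F i m) A"
proof -
  interpret P: cring "PS I" by (rule ps_cring)
  show ?thesis using assms
  proof (induction A rule: infinite_finite_induct)
    case (insert x F')
    then show ?case by (subst P.finsum_insert, auto simp: ps_simps, subst finsum_insert)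
      (auto simp: ps_carrierD Pi_iff)
  qed (auto simp: ps_simps)
qed

lemma pmono_mult_pmono:
  assumes "c \<in> carrier R" "c' \<in> carrier R" "set_mset \<mu>' \<subseteq> I"
  shows "pmono R c \<mu> \<otimes>\<^bsub>PS I\<^esub> pmono R c' \<mu>' = pmono R (c \<otimes> c') (\<mu> + \<mu>')"
proof
  fix m
  show "(pmono R c \<mu> \<otimes>\<^bsub>PS I\<^esub> pmono R c' \<mu>') m = pmono R (c \<otimes> c') (\<mu> + \<mu>') m"
  proof (subst pmono_mult)
    show "(if \<mu> \<subseteq># m then c \<otimes> pmono R c' \<mu>' (m - \<mu>) else \<zero>) = pmono R (c \<otimes> c') (\<mu> + \<mu>') m"
      using assms by (auto simp: pmono_def)
  qed (use assms pmono_closed in auto)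
qed

lemma pmono_pow:
  assumes "c \<in> carrier R" "set_mset \<mu> \<subseteq> I"
  shows "pmono R c \<mu> [^]\<^bsub>PS I\<^esub> (k::nat) = pmono R (c [^] k) (repeat_mset k \<mu>)"
proof (induction k)
  case (Suc k)
  then show ?case using assms by (simp add: pmono_mult_pmono add.commute)
qed (simp add: ps_one_eq)

lemma indexed_const_pmono: "indexed_const c = pmono R c {#}"
  by (auto simp: indexed_const_def pmono_def)

lemma indexed_var_pmono: "indexed_var i = pmono R \<one> {#i#}"
proof -
  have "i \<in># m \<and> m - {#i#} = {#} \<longleftrightarrow> m = {#i#}" for m :: "'c multiset"
    by (metis diff_single_trivial diff_union_single_conv insert_DiffM2 add_cancel_left_left multi_member_last)
  then show ?thesis
    by (auto simp: indexed_var_def indexed_pmult_def indexed_const_def pmono_def fun_eq_iff)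
qed

text \<open>For a field and finitely many variables its intersection with the ring is the D-th power
  of the maximal ideal. It is a condition on coefficients alone, so membership in the ring is always
  stated separately.\<close>

definition ord_ge :: "nat \<Rightarrow> ('i multiset \<Rightarrow> 'a) set" where
  "ord_ge D = {f. \<forall>m. size m < D \<longrightarrow> f m = \<zero>}"

lemma ord_geD: "f \<in> ord_ge D \<Longrightarrow> size m < D \<Longrightarrow> f m = \<zero>"
  by (simp add: ord_ge_def)

lemma ord_ge_minus: "f \<in> carrier (PS I) \<Longrightarrow> f \<in> ord_ge D \<Longrightarrow> \<ominus>\<^bsub>PS I\<^esub> f \<in> ord_ge D"
  by (simp add: ord_ge_def ps_minus)

text \<open>If \<open>m\<close> has degree below \<open>D + E\<close>, every splitting of
  \<open>m\<close> has a first part of degree below \<open>D\<close> or a second part of degree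
  below \<open>E\<close>.\<close>

lemma ord_ge_mult:
  fixes I :: "'i set"
  assumes "f \<in> carrier (PS I)" "g \<in> carrier (PS I)" "f \<in> ord_ge D" "g \<in> ord_ge E"
  shows "f \<otimes>\<^bsub>PS I\<^esub> g \<in> ord_ge (D + E)"
  unfolding ord_ge_def
proof safe
  fix m :: "'i multiset" assume m: "size m < D + E"
  have "f a \<otimes> g (m - a) = \<zero>" if "a \<subseteq># m" for a
  proof (cases "size a < D")
    case False
    then have "size (m - a) < E" using m that size_mset_mono[OF that] by (simp add: size_Diff_submset)
    then show ?thesis using assms by (simp add: ord_geD ps_carrierD)
  qed (use assms in \<open>simp add: ord_geD ps_carrierD\<close>)
  then show "(f \<otimes>\<^bsub>PS I\<^esub> g) m = \<zero>" unfolding ps_simps by (intro finsum_all_zero) auto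
qed

lemma ord_ge_0 [simp]: "f \<in> ord_ge 0" by (simp add: ord_ge_def)

lemma ord_ge_mult_l:
  assumes "f \<in> carrier (PS I)" "g \<in> carrier (PS I)" "g \<in> ord_ge D"
  shows "f \<otimes>\<^bsub>PS I\<^esub> g \<in> ord_ge D"
  using ord_ge_mult[OF assms(1,2) ord_ge_0 assms(3)] by simp

lemma ord_ge_pow:
  assumes "f \<in> carrier (PS I)" "f \<in> ord_ge 1"
  shows "f [^]\<^bsub>PS I\<^esub> k \<in> ord_ge k"
proof (induction k)
  case (Suc k)
  interpret P: cring "PS I" by (rule ps_cring)
  show ?case using ord_ge_mult[OF P.nat_pow_closed[OF assms(1)] assms(1) Suc assms(2)] by simp
qed simp

end


section \<open>Leading monomials\<close>

lemma wf_rec_exists: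
  assumes "wf r" "\<And>g h m. (\<And>k. (k, m) \<in> r \<Longrightarrow> g k = h k) \<Longrightarrow> F g m = F h m"
  shows "\<exists>g. \<forall>m. g m = F g m"
proof -
  have "adm_wf r F" unfolding adm_wf_def using assms(2) by blast
  then have "wfrec r F = F (wfrec r F)" by (rule wfrec_fixpoint[OF assms(1)])
  then show ?thesis by metis
qed

text \<open>Comparing degrees first makes leading monomials compatible with truncation at a degree.\<close>

definition mless :: "'i::wellorder multiset \<Rightarrow> 'i multiset \<Rightarrow> bool" where
  "mless m m' \<longleftrightarrow> size m < size m' \<or> size m = size m' \<and> m < m'"

lemma mless_linear: "mless m m' \<or> m = m' \<or> mless m' m"
  unfolding mless_def by (metis linorder_neqE)

lemma mless_irrefl [simp]: "\<not> mless m m"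
  by (simp add: mless_def)

lemma mless_trans: "mless a b \<Longrightarrow> mless b c \<Longrightarrow> mless a c"
  unfolding mless_def by auto

lemma mless_add: "mless (a + k) (b + k) \<longleftrightarrow> mless a b"
  by (simp add: mless_def)

lemma mless_size: "mless a b \<Longrightarrow> size a \<le> size b"
  by (auto simp: mless_def)

lemma wf_mless: "wf {(a, b). mless a b}"
proof -
  have "{(a, b). mless a b} = inv_image (less_than <*lex*> {(x, y). x < y}) (\<lambda>m :: 'a multiset. (size m, m))"
    by (auto simp: mless_def)
  then show ?thesis by (simp add: wf_inv_image wf_lex_prod wf)
qed

lemma mless_min:
  assumes "\<exists>m. P m" obtains m where "P m" "\<And>k. mless k m \<Longrightarrow> \<not> P k"
proof -
  obtain m0 where "P m0" using assms by auto
  then obtain z where "z \<in> Collect P" "\<And>y. (y, z) \<in> {(a, b). mless a b} \<Longrightarrow> y \<notin> Collect P"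
    using wfE_min[OF wf_mless, of m0 "Collect P"] by blast
  then show thesis using that by auto
qed

text \<open>The variables are treated one at a time: every subsequence of a monotone sequence of
  exponents is again monotone, so refining for a new variable keeps what was achieved
  before.\<close>

lemma mono_subseq_counts:
  fixes s :: "nat \<Rightarrow> 'i multiset"
  assumes "finite I"
  shows "\<exists>f :: nat \<Rightarrow> nat. strict_mono f \<and> (\<forall>i\<in>I. mono (\<lambda>n. count (s (f n)) i))"
  using assms
proof (induction I rule: finite_induct)
  case empty
  then show ?case by (auto intro!: exI[of _ id] simp: strict_mono_def)
next
  case (insert x F)
  then obtain f :: "nat \<Rightarrow> nat" where f: "strict_mono f" "\<forall>i\<in>F. mono (\<lambda>n. count (s (f n)) i)" by blast
  define u where "u = (\<lambda>n. count (s (f n)) x)"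
  obtain g :: "nat \<Rightarrow> nat" where g: "strict_mono g" "monoseq (\<lambda>n. u (g n))"
    using seq_monosub by blast
  have "\<exists>h :: nat \<Rightarrow> nat. strict_mono h \<and> mono (\<lambda>n. u (h n))"
  proof (cases "\<forall>m n. m \<le> n \<longrightarrow> u (g m) \<le> u (g n)")
    case True
    then show ?thesis using g(1) by (auto simp: mono_def)
  next
    case False
    then have dec: "u (g n) \<le> u (g m)" if "m \<le> n" for m n using g(2) that unfolding monoseq_def by blast
    \<comment> \<open>A decreasing sequence of naturals is constant once it attains its minimum;
      starting there makes it increasing as well.\<close>
    obtain N where N: "\<And>n. u (g N) \<le> u (g n)"
      using ex_has_least_nat[of "\<lambda>_. True" 0 "\<lambda>n. u (g n)"] by auto
    have "u (g (N + n)) = u (g N)" for n using N[of "N + n"] dec[of N "N + n"] by simp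
    then have "mono (\<lambda>n. u (g (N + n)))" by (simp add: mono_def)
    moreover have "strict_mono (\<lambda>n. g (N + n))" using g(1) by (simp add: strict_mono_def)
    ultimately show ?thesis by (intro exI[of _ "\<lambda>n. g (N + n)"]) simp
  qed
  then obtain h :: "nat \<Rightarrow> nat" where h: "strict_mono h" "mono (\<lambda>n. u (h n))" by blast
  have "strict_mono (\<lambda>n. f (h n))" using f(1) h(1) by (simp add: strict_mono_def)
  moreover have "mono (\<lambda>n. count (s (f (h n))) i)" if "i \<in> insert x F" for i
  proof (cases "i = x")
    case True then show ?thesis using h(2) by (simp add: u_def)
  next
    case False
    then have "mono (\<lambda>n. count (s (f n)) i)" using f(2) that by auto
    then show ?thesis using h(1) unfolding mono_def by (auto dest: strict_mono_leD)
  qed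
  ultimately show ?case by blast
qed

text \<open>The minimal elements of \<open>L\<close> under inclusion serve as \<open>B\<close>. They
  are pairwise incomparable, and an infinite supply of them would contain two comparable ones by the
  monotone subsequence.\<close>

lemma dickson:
  fixes L :: "'i multiset set"
  assumes "finite I" "\<And>m. m \<in> L \<Longrightarrow> set_mset m \<subseteq> I"
  obtains B where "finite B" "B \<subseteq> L" "\<And>m. m \<in> L \<Longrightarrow> \<exists>b\<in>B. b \<subseteq># m"
proof -
  define B where "B = {m \<in> L. \<forall>k\<in>L. k \<subseteq># m \<longrightarrow> k = m}"
  have "\<exists>b\<in>B. b \<subseteq># m" if "m \<in> L" for m
    using that
  proof (induction "size m" arbitrary: m rule: less_induct)
    case less
    show ?case
    proof (cases "m \<in> B")
      case False
      then obtain k where k: "k \<in> L" "k \<subseteq># m" "k \<noteq> m" using less.prems by (auto simp: B_def)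
      then have "size k < size m" by (intro mset_subset_size) auto
      then show ?thesis using less.hyps[of k] k by (meson subset_mset.order_trans)
    qed auto
  qed
  moreover have "finite B"
  proof (rule ccontr)
    assume "infinite B"
    then obtain s :: "nat \<Rightarrow> 'i multiset" where s: "inj s" "range s \<subseteq> B"
      using infinite_countable_subset by blast
    obtain f :: "nat \<Rightarrow> nat" where f: "strict_mono f" "\<forall>i\<in>I. mono (\<lambda>n. count (s (f n)) i)"
      using mono_subseq_counts[OF assms(1), of s] by blast
    have inB: "s k \<in> B" for k using s(2) by auto
    have "count (s (f 0)) i \<le> count (s (f 1)) i" for i
    proof (cases "i \<in> I")
      case True then show ?thesis using f(2) by (auto simp: mono_def)
    next
      case False
      then have "i \<notin># s (f 0)" using inB assms(2) unfolding B_def by blast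
      then show ?thesis by (simp add: not_in_iff)
    qed
    then have "s (f 0) \<subseteq># s (f 1)" by (simp add: subseteq_mset_def)
    then have "s (f 0) = s (f 1)" using inB[of "f 0"] inB[of "f 1"] by (auto simp: B_def)
    then have "f 0 = f 1" using s(1) by (simp add: inj_def)
    then show False using f(1) by (metis strict_mono_eq zero_neq_one)
  qed
  moreover have "B \<subseteq> L" by (auto simp: B_def)
  ultimately show thesis using that by blast
qed

text \<open>Gaussian elimination, one equation at a time, with unknowns in \<open>V\<close> and
  equations in \<open>J\<close>. It is applied twice: to compare the leading monomials of two nested
  ideals, and to bound the number of functionals with a dual family.\<close>

lemma (in field) homogeneous_system:
  fixes V :: "'x set" and J :: "'j set" and a :: "'x \<Rightarrow> 'j \<Rightarrow> 'a"
  assumes "finite J" "finite V" "card J < card V" "\<And>x j. x \<in> V \<Longrightarrow> j \<in> J \<Longrightarrow> a x j \<in> carrier R"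
  shows "\<exists>v. v \<in> V \<rightarrow> carrier R \<and> (\<exists>x\<in>V. v x \<noteq> \<zero>) \<and>
    (\<forall>j\<in>J. finsum R (\<lambda>x. v x \<otimes> a x j) V = \<zero>)"
  using assms
proof (induction J arbitrary: V a rule: finite_induct)
  case empty
  then obtain x where "x \<in> V" by fastforce
  then show ?case by (intro exI[of _ "\<lambda>_. \<one>"]) auto
next
  case (insert j J)
  show ?case
  proof (cases "\<forall>x\<in>V. a x j = \<zero>")
    case True
    have "card J < card V" using insert by simp
    then obtain v where v: "v \<in> V \<rightarrow> carrier R" "\<exists>x\<in>V. v x \<noteq> \<zero>"
      "\<forall>j\<in>J. finsum R (\<lambda>x. v x \<otimes> a x j) V = \<zero>"
      using insert.IH[of V a] insert.prems by blast
    moreover have "finsum R (\<lambda>x. v x \<otimes> a x j) V = \<zero>"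
      using True v(1) by (intro finsum_all_zero) (simp add: Pi_iff)
    ultimately show ?thesis by blast
  next
    case False
    then obtain x0 where x0: "x0 \<in> V" "a x0 j \<noteq> \<zero>" by blast
    define V' where "V' = V - {x0}"
    have V: "V = insert x0 V'" "x0 \<notin> V'" "finite V'" using x0 insert.prems by (auto simp: V'_def)
    define u where "u = inv (a x0 j)"
    have ac: "a x i \<in> carrier R" if "x \<in> V" "i \<in> insert j J" for x i using insert.prems that by auto
    have u: "u \<in> carrier R" "a x0 j \<otimes> u = \<one>"
      using ac[of x0 j] x0 field_Units unfolding u_def by auto
    \<comment> \<open>Eliminates the unknown at \<open>x0\<close> by means of equation
      \<open>j\<close>: the coefficients at \<open>x0\<close> are subtracted with the factor that
      makes the entry in column \<open>j\<close> zero.\<close>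
    define a' where "a' = (\<lambda>x i. a x i \<ominus> (a x j \<otimes> u) \<otimes> a x0 i)"
    have "card J < card V'" using insert.prems insert.hyps V by simp
    then obtain v where v: "v \<in> V' \<rightarrow> carrier R" "\<exists>x\<in>V'. v x \<noteq> \<zero>"
      "\<forall>j\<in>J. finsum R (\<lambda>x. v x \<otimes> a' x j) V' = \<zero>"
      using insert.IH[of V' a'] V u ac by (auto simp: a'_def)
    define w where "w = finsum R (\<lambda>x. v x \<otimes> (a x j \<otimes> u)) V'"
    have wc: "w \<in> carrier R" unfolding w_def using v u ac V by (auto intro!: finsum_closed)
    \<comment> \<open>The value at \<open>x0\<close> is the one that equation \<open>j\<close>
      forces.\<close>
    define v' where "v' = v(x0 := \<ominus> w)"
    have sum': "finsum R (\<lambda>x. v' x \<otimes> a x i) V = \<ominus> w \<otimes> a x0 i \<oplus> finsum R (\<lambda>x. v x \<otimes> a x i) V'"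
      if "i \<in> insert j J" for i
    proof -
      have "finsum R (\<lambda>x. v' x \<otimes> a x i) V = v' x0 \<otimes> a x0 i \<oplus> finsum R (\<lambda>x. v' x \<otimes> a x i) V'"
        unfolding V(1)
      proof (rule finsum_insert)
        show "(\<lambda>x. v' x \<otimes> a x i) \<in> V' \<rightarrow> carrier R"
        proof
          fix x assume "x \<in> V'"
          then show "v' x \<otimes> a x i \<in> carrier R" using V v(1) ac[of x i] that by (auto simp: v'_def)
        qed
        show "v' x0 \<otimes> a x0 i \<in> carrier R" using wc ac[OF x0(1) that] by (simp add: v'_def)
      qed (use V in auto)
      also have "finsum R (\<lambda>x. v' x \<otimes> a x i) V' = finsum R (\<lambda>x. v x \<otimes> a x i) V'"
      proof (intro finsum_cong')
        show "(\<lambda>x. v x \<otimes> a x i) \<in> V' \<rightarrow> carrier R"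
        proof
          fix x assume "x \<in> V'"
          then show "v x \<otimes> a x i \<in> carrier R" using V v(1) ac[of x i] that by auto
        qed
      qed (use V in \<open>auto simp: v'_def\<close>)
      finally show ?thesis by (simp add: v'_def)
    qed
    have w_mult: "w \<otimes> a x0 i = finsum R (\<lambda>x. v x \<otimes> (a x j \<otimes> u) \<otimes> a x0 i) V'" if "i \<in> insert j J" for i
      unfolding w_def using V v u ac that by (intro finsum_ldistr) auto
    have j0: "finsum R (\<lambda>x. v' x \<otimes> a x j) V = \<zero>"
    proof -
      have "finsum R (\<lambda>x. v x \<otimes> (a x j \<otimes> u) \<otimes> a x0 j) V' = finsum R (\<lambda>x. v x \<otimes> a x j) V'"
      proof (intro finsum_cong')
        fix x assume x: "x \<in> V'"
        have c: "v x \<in> carrier R" "a x j \<in> carrier R" "a x0 j \<in> carrier R" using x v ac V by auto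
        have "v x \<otimes> (a x j \<otimes> u) \<otimes> a x0 j = v x \<otimes> a x j \<otimes> (a x0 j \<otimes> u)"
          using c u(1) by (simp add: m_ac)
        then show "v x \<otimes> (a x j \<otimes> u) \<otimes> a x0 j = v x \<otimes> a x j" using c u by simp
      qed (use v ac V in auto)
      then have "w \<otimes> a x0 j = finsum R (\<lambda>x. v x \<otimes> a x j) V'" using w_mult[of j] by simp
      then show ?thesis using sum'[of j] wc ac[of x0 j] x0 l_neg[OF m_closed[OF wc ac[of x0 j]]]
        by (simp add: l_minus)
    qed
    have i0: "finsum R (\<lambda>x. v' x \<otimes> a x i) V = \<zero>" if i: "i \<in> J" for i
    proof -
      have vc: "v x \<in> carrier R" "a x j \<in> carrier R" "a x i \<in> carrier R" if "x \<in> V'" for x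
        using v(1) ac[of x] V that i by auto
      have 1: "(\<lambda>x. v x \<otimes> a x i) \<in> V' \<rightarrow> carrier R" using vc by auto
      have 2: "(\<lambda>x. v x \<otimes> (a x j \<otimes> u) \<otimes> a x0 i) \<in> V' \<rightarrow> carrier R" using vc ac[OF x0(1), of i] i u by auto
      have "\<zero> = finsum R (\<lambda>x. v x \<otimes> a' x i) V'" using v(3) i by simp
      also have "\<dots> = finsum R (\<lambda>x. v x \<otimes> a x i \<oplus> \<ominus> (v x \<otimes> (a x j \<otimes> u) \<otimes> a x0 i)) V'"
      proof (intro finsum_cong')
        fix x assume x: "x \<in> V'"
        have c: "v x \<in> carrier R" "a x j \<in> carrier R" "a x i \<in> carrier R" "a x0 i \<in> carrier R" using x v ac V i by auto
        show "v x \<otimes> a' x i = v x \<otimes> a x i \<oplus> \<ominus> (v x \<otimes> (a x j \<otimes> u) \<otimes> a x0 i)"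
          using c u(1) unfolding a'_def by (simp add: a_minus_def r_distr r_minus m_assoc)
      qed (use 1 2 in auto)
      also have "\<dots> = finsum R (\<lambda>x. v x \<otimes> a x i) V' \<oplus> \<ominus> finsum R (\<lambda>x. v x \<otimes> (a x j \<otimes> u) \<otimes> a x0 i) V'"
        using 1 2 by (subst finsum_addf) (auto simp: finsum_minus Pi_iff)
      also have "\<dots> = finsum R (\<lambda>x. v x \<otimes> a x i) V' \<oplus> \<ominus> (w \<otimes> a x0 i)"
        using w_mult i by simp
      also have "\<dots> = finsum R (\<lambda>x. v' x \<otimes> a x i) V"
        using sum'[of i] i wc ac[of x0 i] x0 finsum_closed[OF 1] by (simp add: l_minus a_comm)
      finally show ?thesis by simp
    qed
    have "v' \<in> V \<rightarrow> carrier R" using v wc V by (auto simp: v'_def)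
    moreover have "\<exists>x\<in>V. v' x \<noteq> \<zero>" using v(2) V by (auto simp: v'_def)
    ultimately show ?thesis using i0 j0 by blast
  qed
qed

lemma (in ideal) finsum_in_ideal:
  "f \<in> A \<rightarrow> I \<Longrightarrow> finsum R f A \<in> I"
proof (induction A rule: infinite_finite_induct)
  case (insert x F)
  then have "f \<in> insert x F \<rightarrow> carrier R" using a_subset by auto
  then show ?case using insert by (subst finsum_insert) (auto simp: a_closed)
qed (auto simp: additive_subgroup.zero_closed additive_subgroup_axioms)

section \<open>Leading terms, units and standard bases over a field\<close>

locale kseries = field R for R :: "('a, 'm) ring_scheme" (structure) +
  fixes I :: "'i::wellorder set"
  assumes finI: "finite I"
begin

abbreviation S where "S \<equiv> power_series_ring R I"

sublocale S: cring S by (rule ps_cring)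

text \<open>As usual for power series, the leading monomial is the smallest one that occurs.\<close>

definition is_lead :: "('i multiset \<Rightarrow> 'a) \<Rightarrow> 'i multiset \<Rightarrow> bool" where
  "is_lead f \<mu> \<longleftrightarrow> f \<mu> \<noteq> \<zero> \<and> (\<forall>m. mless m \<mu> \<longrightarrow> f m = \<zero>)"

lemma lead_exists:
  assumes "f \<noteq> \<zero>\<^bsub>S\<^esub>"
  obtains \<mu> where "is_lead f \<mu>"
proof -
  have *: "\<exists>m. f m \<noteq> \<zero>" using assms by (auto simp: fun_eq_iff ps_simps)
  obtain \<mu> where "f \<mu> \<noteq> \<zero>" "\<And>k. mless k \<mu> \<Longrightarrow> \<not> f k \<noteq> \<zero>"
    by (rule mless_min[OF *]) blast
  then show thesis using that by (auto simp: is_lead_def)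
qed

text \<open>In any other splitting of \<open>\<mu> + \<nu>\<close> one part is smaller than the
  leading monomial of its factor, so that term is zero.\<close>

lemma lead_mult:
  assumes "f \<in> carrier S" "g \<in> carrier S" "is_lead f \<mu>" "is_lead g \<nu>"
  shows "(f \<otimes>\<^bsub>S\<^esub> g) (\<mu> + \<nu>) = f \<mu> \<otimes> g \<nu>"
proof -
  have "(f \<otimes>\<^bsub>S\<^esub> g) (\<mu> + \<nu>) = f \<mu> \<otimes> g (\<mu> + \<nu> - \<mu>)"
    unfolding ps_simps
  proof (intro finsum_only)
    fix a assume a: "a \<in> {a. a \<subseteq># \<mu> + \<nu>}" "a \<noteq> \<mu>"
    then consider "mless a \<mu>" | "mless \<mu> a" using mless_linear by blast
    then show "f a \<otimes> g (\<mu> + \<nu> - a) = \<zero>"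
    proof cases
      case 1 then show ?thesis using assms by (simp add: is_lead_def ps_carrierD)
    next
      case 2
      have "\<mu> + \<nu> = (\<mu> + \<nu> - a) + a" using a by simp
      then have "mless (\<mu> + \<nu> - a) \<nu>"
        using 2 mless_add[of "\<mu> + \<nu> - a" a \<nu>] mless_add[of \<mu> \<nu> a] by (simp add: add.commute)
      then show ?thesis using assms by (simp add: is_lead_def ps_carrierD)
    qed
  qed (use assms in \<open>auto simp: ps_carrierD\<close>)
  then show ?thesis by simp
qed

lemma S_domain: "domain S"
proof (rule domain.intro)
  show "cring S" by (rule S.cring_axioms)
  show "domain_axioms S"
  proof
    have "\<one>\<^bsub>S\<^esub> {#} \<noteq> \<zero>\<^bsub>S\<^esub> {#}" by (simp add: ps_simps)
    then show "\<one>\<^bsub>S\<^esub> \<noteq> \<zero>\<^bsub>S\<^esub>" by metis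
    fix a b assume ab: "a \<otimes>\<^bsub>S\<^esub> b = \<zero>\<^bsub>S\<^esub>" "a \<in> carrier S" "b \<in> carrier S"
    show "a = \<zero>\<^bsub>S\<^esub> \<or> b = \<zero>\<^bsub>S\<^esub>"
    proof (rule ccontr)
      assume "\<not> ?thesis"
      then obtain \<mu> \<nu> where l: "is_lead a \<mu>" "is_lead b \<nu>" using lead_exists by metis
      then have "a \<mu> \<otimes> b \<nu> = \<zero>" using lead_mult[OF ab(2,3) l] ab(1) by (simp add: ps_simps)
      then show False using l ab by (auto simp: is_lead_def ps_carrierD integral_iff)
    qed
  qed
qed

text \<open>The equation f g = 1 is solved for the coefficients of g by recursion on the degree; the
  only element to be inverted is the constant coefficient of f.\<close>

lemma S_unit:
  assumes "f \<in> carrier S" "f {#} \<noteq> \<zero>"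
  shows "f \<in> Units S"
proof -
  define u where "u = inv (f {#})"
  have u: "u \<in> carrier R" "f {#} \<otimes> u = \<one>"
    using assms field_Units unfolding u_def by (auto simp: ps_carrierD)
  let ?A = "\<lambda>m :: 'i multiset. {a. a \<subseteq># m} - {{#}}"
  \<comment> \<open>The test \<open>a \<in> ?A m\<close> is built into the summand so that the step
    visibly depends on \<open>g\<close> in smaller degrees only.\<close>
  define F where "F = (\<lambda>g m. u \<otimes> (\<one>\<^bsub>S\<^esub> m \<ominus> finsum R (\<lambda>a. if a \<in> ?A m then f a \<otimes> g (m - a) else \<zero>) (?A m)))"
  have "\<exists>g. \<forall>m. g m = F g m"
  proof (rule wf_rec_exists[where r = "measure size"])
    fix g h :: "'i multiset \<Rightarrow> 'a" and m :: "'i multiset"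
    assume gh: "\<And>k. (k, m) \<in> measure size \<Longrightarrow> g k = h k"
    have "g (m - a) = h (m - a)" if "a \<in> ?A m" for a
    proof (rule gh)
      have "size a > 0" "size a \<le> size m" using that by (auto simp: size_mset_mono nonempty_has_size)
      then show "(m - a, m) \<in> measure size" using that by (simp add: size_Diff_submset)
    qed
    then have "(\<lambda>a. if a \<in> ?A m then f a \<otimes> g (m - a) else \<zero>) = (\<lambda>a. if a \<in> ?A m then f a \<otimes> h (m - a) else \<zero>)"
      by (intro ext) simp
    then show "F g m = F h m" by (simp add: F_def)
  qed simp
  then obtain g where g: "\<And>m. g m = F g m" by blast
  have F: "F g m = u \<otimes> (\<one>\<^bsub>S\<^esub> m \<ominus> finsum R (\<lambda>a. f a \<otimes> g (m - a)) (?A m))"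
    if "\<And>a. a \<in> ?A m \<Longrightarrow> g (m - a) \<in> carrier R" for m
  proof -
    have "finsum R (\<lambda>a. if a \<in> ?A m then f a \<otimes> g (m - a) else \<zero>) (?A m)
        = finsum R (\<lambda>a. f a \<otimes> g (m - a)) (?A m)"
      using that assms by (intro finsum_cong') (auto simp: ps_carrierD)
    then show ?thesis by (simp only: F_def)
  qed
  have gc: "g m \<in> carrier R" for m
  proof (induction "size m" arbitrary: m rule: less_induct)
    case less
    have ga: "g (m - a) \<in> carrier R" if "a \<in> ?A m" for a
    proof (rule less)
      have "size a > 0" "size a \<le> size m" using that by (auto simp: size_mset_mono nonempty_has_size)
      then show "size (m - a) < size m" using that by (simp add: size_Diff_submset)
    qed
    then have "finsum R (\<lambda>a. f a \<otimes> g (m - a)) (?A m) \<in> carrier R"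
      using assms by (intro finsum_closed) (auto simp: ps_carrierD)
    then show ?case using u by (subst g, subst F) (use ga in \<open>auto simp: ps_simps\<close>)
  qed
  have fg: "finsum R (\<lambda>a. f a \<otimes> g (m - a)) {a. a \<subseteq># m} = \<one>\<^bsub>S\<^esub> m" for m
  proof -
    let ?s = "finsum R (\<lambda>a. f a \<otimes> g (m - a)) (?A m)"
    have sc: "?s \<in> carrier R" using assms gc by (intro finsum_closed) (auto simp: ps_carrierD)
    have eq: "{a. a \<subseteq># m} = insert {#} (?A m)" by auto
    have "finsum R (\<lambda>a. f a \<otimes> g (m - a)) (insert {#} (?A m)) = f {#} \<otimes> g (m - {#}) \<oplus> ?s"
      using assms gc by (intro finsum_insert) (auto simp: ps_carrierD)
    then have "finsum R (\<lambda>a. f a \<otimes> g (m - a)) {a. a \<subseteq># m} = f {#} \<otimes> g m \<oplus> ?s"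
      unfolding eq[symmetric] by simp
    also have "f {#} \<otimes> g m = (f {#} \<otimes> u) \<otimes> (\<one>\<^bsub>S\<^esub> m \<ominus> ?s)"
    proof -
      have c: "\<one>\<^bsub>S\<^esub> m \<ominus> ?s \<in> carrier R" using sc by (simp add: ps_simps)
      have "g m = u \<otimes> (\<one>\<^bsub>S\<^esub> m \<ominus> ?s)" by (subst g, subst F) (use gc in auto)
      then show ?thesis using c u ps_carrierD(1)[OF assms(1)] by (simp add: m_assoc[symmetric])
    qed
    also have "\<dots> \<oplus> ?s = \<one>\<^bsub>S\<^esub> m"
      using u sc by (simp add: ps_simps a_minus_def a_assoc l_neg)
    finally show ?thesis .
  qed
  \<comment> \<open>The recursion runs over all multisets. Cutting off outside \<open>I\<close> puts
    the result into the ring and changes no coefficient of the product at monomials over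
    \<open>I\<close>.\<close>
  define g' where "g' = (\<lambda>m. if set_mset m \<subseteq> I then g m else \<zero>)"
  have g'c: "g' \<in> carrier S" using gc by (intro ps_carrierI) (auto simp: g'_def)
  have "f \<otimes>\<^bsub>S\<^esub> g' = \<one>\<^bsub>S\<^esub>"
  proof
    fix m
    show "(f \<otimes>\<^bsub>S\<^esub> g') m = \<one>\<^bsub>S\<^esub> m"
    proof (cases "set_mset m \<subseteq> I")
      case True
      have "(f \<otimes>\<^bsub>S\<^esub> g') m = finsum R (\<lambda>a. f a \<otimes> g (m - a)) {a. a \<subseteq># m}"
        unfolding ps_simps using True assms gc
        by (intro finsum_cong') (auto simp: g'_def ps_carrierD dest!: in_diffD)
      then show ?thesis using fg by simp
    next
      case False
      then show ?thesis using ps_carrierD(2)[OF S.m_closed[OF assms(1) g'c]] ps_carrierD(2)[OF S.one_closed]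
        by metis
    qed
  qed
  then show ?thesis using assms(1) g'c S.m_comm[of f g'] unfolding Units_def by auto
qed

definition LM :: "('i multiset \<Rightarrow> 'a) set \<Rightarrow> 'i multiset set" where
  "LM J = {\<mu>. \<exists>f\<in>J. is_lead f \<mu>}"

lemma LM_support: "J \<subseteq> carrier S \<Longrightarrow> \<mu> \<in> LM J \<Longrightarrow> set_mset \<mu> \<subseteq> I"
  unfolding LM_def is_lead_def using ps_carrierD(2) by blast

lemma LM_monic:
  assumes "ideal J S" "\<mu> \<in> LM J"
  obtains f where "f \<in> J" "is_lead f \<mu>" "f \<mu> = \<one>"
proof -
  interpret ideal J S by fact
  obtain f where f: "f \<in> J" "is_lead f \<mu>" using assms by (auto simp: LM_def)
  have fc: "f \<in> carrier S" using f a_subset by auto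
  define u where "u = inv (f \<mu>)"
  have u: "u \<in> carrier R" "u \<otimes> f \<mu> = \<one>"
    using ps_carrierD(1)[OF fc, of \<mu>] f field_Units unfolding u_def by (auto simp: is_lead_def)
  have e: "(pmono R u {#} \<otimes>\<^bsub>S\<^esub> f) m = u \<otimes> f m" for m
    using pmono_mult[OF u(1) fc, of "{#}" m] by simp
  have "pmono R u {#} \<otimes>\<^bsub>S\<^esub> f \<in> J" using f u by (intro I_l_closed) auto
  then show thesis using that[of "pmono R u {#} \<otimes>\<^bsub>S\<^esub> f"] e u f by (auto simp: is_lead_def)
qed

text \<open>A nonzero element of \<open>J\<close> has a nonzero coefficient at its own leading
  monomial. Hence equality of two elements of \<open>J\<close> can be tested on the monomials of
  \<open>LM J\<close> alone.\<close>

lemma no_LM_zero: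
  assumes "ideal J S" "w \<in> J" "\<And>\<mu>. \<mu> \<in> LM J \<Longrightarrow> w \<mu> = \<zero>"
  shows "w = \<zero>\<^bsub>S\<^esub>"
proof (rule ccontr)
  assume "w \<noteq> \<zero>\<^bsub>S\<^esub>"
  then obtain \<mu> where "is_lead w \<mu>" by (rule lead_exists)
  then show False using assms unfolding LM_def is_lead_def by blast
qed

text \<open>Division by elements of \<open>J\<close> whose leading monomials generate all of
  \<open>LM J\<close>. Each monomial of \<open>LM J\<close> is assigned to one generator, and the
  coefficients of \<open>w\<close> there are matched by recursion along \<open>mless\<close>. The
  leading monomials of the generators have degree at most \<open>c\<close>, so the cofactors lose at
  most \<open>c\<close> in order; this loss, uniform in \<open>w\<close>, is what the Artin-Rees
  step needs.\<close>

lemma standard_basis: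
  assumes "ideal J S"
  obtains B :: "'i multiset set" and h c where "finite B" "h \<in> B \<rightarrow> J"
    "\<And>D w. w \<in> J \<Longrightarrow> w \<in> ord_ge D \<Longrightarrow>
       \<exists>a. a \<in> B \<rightarrow> carrier S \<inter> ord_ge (D - c) \<and> w = finsum S (\<lambda>b. a b \<otimes>\<^bsub>S\<^esub> h b) B"
proof -
  interpret J: ideal J S by fact
  have Jc: "J \<subseteq> carrier S" using J.a_subset .
  obtain B where B: "finite B" "B \<subseteq> LM J" "\<And>m. m \<in> LM J \<Longrightarrow> \<exists>b\<in>B. b \<subseteq># m"
    using dickson[OF finI, of "LM J"] LM_support[OF Jc] by metis
  have "\<forall>b\<in>B. \<exists>f. f \<in> J \<and> is_lead f b \<and> f b = \<one>"
    using B(2) LM_monic[OF assms] by (metis subsetD)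
  then obtain h where h: "\<And>b. b \<in> B \<Longrightarrow> h b \<in> J" "\<And>b. b \<in> B \<Longrightarrow> is_lead (h b) b" "\<And>b. b \<in> B \<Longrightarrow> h b b = \<one>"
    by metis
  obtain idx where idx: "\<And>m. m \<in> LM J \<Longrightarrow> idx m \<in> B" "\<And>m. m \<in> LM J \<Longrightarrow> idx m \<subseteq># m"
    using B(3) by metis
  have hc: "h b \<in> carrier S" if "b \<in> B" for b using h Jc that by auto
  have hcm: "h b m \<in> carrier R" if "b \<in> B" for b m using ps_carrierD(1)[OF hc[OF that]] .
  define c where "c = Max (size ` insert {#} B)"
  have c: "size b \<le> c" if "b \<in> B" for b unfolding c_def using B(1) that by (intro Max_ge) auto
  \<comment> \<open>The products of an already determined cofactor coefficient with a term of
    \<open>h b\<close> that can reach the monomial \<open>\<mu>\<close>.\<close>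
  define P where "P = (\<lambda>\<mu>. {(b, \<alpha>). b \<in> B \<and> \<alpha> \<subseteq># \<mu> \<and> \<alpha> + b \<in> LM J \<and> idx (\<alpha> + b) = b \<and> mless (\<alpha> + b) \<mu>})"
  have Psub: "P \<mu> \<subseteq> B \<times> {a. a \<subseteq># \<mu>}" for \<mu> by (auto simp: P_def)
  have Pfin: "finite (P \<mu>)" for \<mu> by (rule finite_subset[OF Psub]) (simp add: B(1))
  have main: "\<exists>a. a \<in> B \<rightarrow> carrier S \<inter> ord_ge (D - c) \<and> w = finsum S (\<lambda>b. a b \<otimes>\<^bsub>S\<^esub> h b) B"
    if w: "w \<in> J" "w \<in> ord_ge D" for D w
  proof -
    have wc: "w \<in> carrier S" using w Jc by auto
    \<comment> \<open>One function \<open>t\<close> holds all cofactors: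
      \<open>t (\<alpha> + b)\<close> is the coefficient at \<open>\<alpha>\<close> of the cofactor
      of \<open>b\<close>, where \<open>b\<close> is the generator assigned to
      \<open>\<alpha> + b\<close>. Its value is what \<open>w\<close> still lacks at that monomial
      after the smaller terms are accounted for.\<close>
    define F where "F = (\<lambda>t \<mu>. if \<mu> \<in> LM J then w \<mu> \<ominus> finsum R (\<lambda>(b, \<alpha>). if (b, \<alpha>) \<in> P \<mu> then t (\<alpha> + b) \<otimes> h b (\<mu> - \<alpha>) else \<zero>) (P \<mu>) else \<zero>)"
    have "\<exists>t. \<forall>\<mu>. t \<mu> = F t \<mu>"
    proof (rule wf_rec_exists[OF wf_mless])
      fix g k :: "'i multiset \<Rightarrow> 'a" and m
      assume gk: "\<And>x. (x, m) \<in> {(a, b). mless a b} \<Longrightarrow> g x = k x"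
      have "(\<lambda>(b, \<alpha>). if (b, \<alpha>) \<in> P m then g (\<alpha> + b) \<otimes> h b (m - \<alpha>) else \<zero>)
          = (\<lambda>(b, \<alpha>). if (b, \<alpha>) \<in> P m then k (\<alpha> + b) \<otimes> h b (m - \<alpha>) else \<zero>)"
        using gk by (intro ext) (auto simp: P_def)
      then show "F g m = F k m" by (simp add: F_def)
    qed
    then obtain t where t: "\<And>\<mu>. t \<mu> = F t \<mu>" by blast
    have F: "F t \<mu> = (if \<mu> \<in> LM J then w \<mu> \<ominus> finsum R (\<lambda>(b, \<alpha>). t (\<alpha> + b) \<otimes> h b (\<mu> - \<alpha>)) (P \<mu>) else \<zero>)"
      if "\<And>k. mless k \<mu> \<Longrightarrow> t k \<in> carrier R" for \<mu>
    proof -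
      have "finsum R (\<lambda>(b, \<alpha>). if (b, \<alpha>) \<in> P \<mu> then t (\<alpha> + b) \<otimes> h b (\<mu> - \<alpha>) else \<zero>) (P \<mu>)
          = finsum R (\<lambda>(b, \<alpha>). t (\<alpha> + b) \<otimes> h b (\<mu> - \<alpha>)) (P \<mu>)"
        using that hcm by (intro finsum_cong') (auto simp: P_def)
      then show ?thesis by (simp only: F_def)
    qed
    have tc: "t \<mu> \<in> carrier R" for \<mu>
    proof (induction \<mu> rule: wf_induct_rule[OF wf_mless])
      case (1 \<mu>)
      have "finsum R (\<lambda>(b, \<alpha>). t (\<alpha> + b) \<otimes> h b (\<mu> - \<alpha>)) (P \<mu>) \<in> carrier R"
        using 1 hcm by (intro finsum_closed) (auto simp: P_def)
      then show ?case using wc by (subst t, subst F) (use 1 in \<open>auto simp: ps_carrierD\<close>)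
    qed
    have t0: "t \<mu> = \<zero>" if "size \<mu> < D" for \<mu>
      using that
    proof (induction \<mu> rule: wf_induct_rule[OF wf_mless])
      case (1 \<mu>)
      have "finsum R (\<lambda>(b, \<alpha>). t (\<alpha> + b) \<otimes> h b (\<mu> - \<alpha>)) (P \<mu>) = \<zero>"
      proof (intro finsum_all_zero)
        fix x assume "x \<in> P \<mu>"
        then obtain b \<alpha> where x: "x = (b, \<alpha>)" "b \<in> B" "mless (\<alpha> + b) \<mu>" by (auto simp: P_def)
        then have "t (\<alpha> + b) = \<zero>" using 1 mless_size[OF x(3)] by auto
        then show "(case x of (b, \<alpha>) \<Rightarrow> t (\<alpha> + b) \<otimes> h b (\<mu> - \<alpha>)) = \<zero>"
          using x hcm by simp
      qed
      then show ?case using w(2) 1(2) by (subst t, subst F) (use tc in \<open>auto simp: ord_geD a_minus_def minus_equality\<close>)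
    qed
    define a where "a = (\<lambda>b \<nu>. if \<nu> + b \<in> LM J \<and> idx (\<nu> + b) = b then t (\<nu> + b) else \<zero>)"
    have ac: "a b \<in> carrier S" if "b \<in> B" for b
    proof (rule ps_carrierI)
      fix m assume m: "\<not> set_mset m \<subseteq> I"
      then have "m + b \<notin> LM J" using LM_support[OF Jc] by fastforce
      then show "a b m = \<zero>" by (simp add: a_def)
    qed (use tc in \<open>auto simp: a_def\<close>)
    have acm: "a b m \<in> carrier R" if "b \<in> B" for b m using ps_carrierD(1)[OF ac[OF that]] .
    have ao: "a b \<in> ord_ge (D - c)" if "b \<in> B" for b
      unfolding ord_ge_def using c[OF that] t0 by (auto simp: a_def)
    let ?W = "finsum S (\<lambda>b. a b \<otimes>\<^bsub>S\<^esub> h b) B"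
    have WJ: "?W \<in> J" using h ac by (intro J.finsum_in_ideal) (auto simp: J.I_l_closed)
    then have Wc: "?W \<in> carrier S" using Jc by auto
    have W: "?W \<mu> = w \<mu>" if \<mu>: "\<mu> \<in> LM J" for \<mu>
    proof -
      let ?f = "\<lambda>(b, \<alpha>). a b \<alpha> \<otimes> h b (\<mu> - \<alpha>)"
      let ?x = "(idx \<mu>, \<mu> - idx \<mu>)"
      have fc: "?f \<in> B \<times> {a. a \<subseteq># \<mu>} \<rightarrow> carrier R" using acm hcm by auto
      have x_in: "?x \<in> B \<times> {a. a \<subseteq># \<mu>}" using idx \<mu> by auto
      have "?W \<mu> = finsum R (\<lambda>b. (a b \<otimes>\<^bsub>S\<^esub> h b) \<mu>) B"
        using ac hc by (intro ps_finsum) auto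
      also have "\<dots> = finsum R (\<lambda>b. finsum R (\<lambda>\<alpha>. ?f (b, \<alpha>)) {a. a \<subseteq># \<mu>}) B"
        by (simp add: ps_simps)
      also have "\<dots> = finsum R ?f (B \<times> {a. a \<subseteq># \<mu>})"
        using B(1) acm hcm by (intro finsum_Sigma) auto
      \<comment> \<open>For all other pairs either the cofactor coefficient is zero by the
        assignment, or \<open>h b\<close> is evaluated below its leading monomial.\<close>
      also have "\<dots> = finsum R ?f (insert ?x (P \<mu>))"
      proof (rule finsum_neutral)
        fix y assume y: "y \<in> B \<times> {a. a \<subseteq># \<mu>} - insert ?x (P \<mu>)"
        then obtain b \<alpha> where y': "y = (b, \<alpha>)" "b \<in> B" "\<alpha> \<subseteq># \<mu>" by auto
        consider "mless (\<alpha> + b) \<mu>" | "\<alpha> + b = \<mu>" | "mless \<mu> (\<alpha> + b)" using mless_linear by blast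
        then show "?f y = \<zero>"
        proof cases
          case 1
          then have "a b \<alpha> = \<zero>" using y y' by (auto simp: a_def P_def)
          then show ?thesis using y' hcm by simp
        next
          case 2
          then have "idx (\<alpha> + b) \<noteq> b" using y y' by auto
          then have "a b \<alpha> = \<zero>" by (auto simp: a_def)
          then show ?thesis using y' hcm by simp
        next
          case 3
          have "\<mu> = (\<mu> - \<alpha>) + \<alpha>" using y' by simp
          then have "mless (\<mu> - \<alpha>) b" using 3 mless_add[of "\<mu> - \<alpha>" \<alpha> b] by (simp add: add.commute)
          then have "h b (\<mu> - \<alpha>) = \<zero>" using h(2)[OF y'(2)] by (simp add: is_lead_def)
          then show ?thesis using y' acm by simp
        qed
      qed (use B(1) Psub x_in fc in auto)
      also have "\<dots> = ?f ?x \<oplus> finsum R ?f (P \<mu>)"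
      proof (rule finsum_insert[OF Pfin])
        show "?x \<notin> P \<mu>" using idx(2)[OF \<mu>] by (auto simp: P_def)
        show "?f \<in> P \<mu> \<rightarrow> carrier R" using fc Psub by (meson Pi_anti_mono subsetD)
        show "?f ?x \<in> carrier R" using fc x_in by (rule Pi_mem)
      qed
      also have "?f ?x = t \<mu>"
      proof -
        have "\<mu> - (\<mu> - idx \<mu>) = idx \<mu>" using idx(2)[OF \<mu>] by (auto simp: multiset_eq_iff subseteq_mset_def)
        then show ?thesis using idx \<mu> h(3) tc by (simp add: a_def)
      qed
      also have "finsum R ?f (P \<mu>) = finsum R (\<lambda>(b, \<alpha>). t (\<alpha> + b) \<otimes> h b (\<mu> - \<alpha>)) (P \<mu>)"
        using tc hcm by (intro finsum_cong') (auto simp: P_def a_def)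
      also have "t \<mu> = w \<mu> \<ominus> finsum R (\<lambda>(b, \<alpha>). t (\<alpha> + b) \<otimes> h b (\<mu> - \<alpha>)) (P \<mu>)"
        using \<mu> by (subst t, subst F) (use tc in auto)
      also have "\<dots> \<oplus> finsum R (\<lambda>(b, \<alpha>). t (\<alpha> + b) \<otimes> h b (\<mu> - \<alpha>)) (P \<mu>) = w \<mu>"
      proof -
        have "finsum R (\<lambda>(b, \<alpha>). t (\<alpha> + b) \<otimes> h b (\<mu> - \<alpha>)) (P \<mu>) \<in> carrier R"
          using tc hcm by (intro finsum_closed) (auto simp: P_def)
        then show ?thesis using wc by (simp add: a_minus_def a_assoc l_neg ps_carrierD)
      qed
      finally show ?thesis .
    qed
    have "w \<ominus>\<^bsub>S\<^esub> ?W = \<zero>\<^bsub>S\<^esub>"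
    proof (rule no_LM_zero[OF assms])
      show "w \<ominus>\<^bsub>S\<^esub> ?W \<in> J" using w WJ by (simp add: a_minus_def J.a_closed J.a_inv_closed)
      show "(w \<ominus>\<^bsub>S\<^esub> ?W) \<mu> = \<zero>" if "\<mu> \<in> LM J" for \<mu>
        using W[OF that] Wc wc by (simp add: a_minus_def ps_simps ps_minus r_neg ps_carrierD)
    qed
    then have "w = ?W" using wc Wc by simp
    then show ?thesis using ac ao by blast
  qed
  show thesis by (rule that[of B h c]) (use B h main in auto)
qed

end


section \<open>Chains of primes in a power series ring\<close>

text \<open>A monomial is an exponent vector with entries below \<open>D\<close>. The crude bound
  already has the right order of growth, the number of variables.\<close>

lemma finite_monomials: "finite I \<Longrightarrow> finite {\<mu> :: 'i multiset. set_mset \<mu> \<subseteq> I \<and> size \<mu> < D}"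
  and card_monomials_le: "finite I \<Longrightarrow> card {\<mu> :: 'i multiset. set_mset \<mu> \<subseteq> I \<and> size \<mu> < D} \<le> D ^ card I"
proof -
  assume I: "finite I"
  let ?A = "{\<mu> :: 'i multiset. set_mset \<mu> \<subseteq> I \<and> size \<mu> < D}"
  let ?B = "I \<rightarrow>\<^sub>E {..<D}"
  let ?f = "\<lambda>\<mu>. restrict (count \<mu>) I"
  have inj: "inj_on ?f ?A"
  proof (rule inj_onI)
    fix x y assume xy: "x \<in> ?A" "y \<in> ?A" "?f x = ?f y"
    show "x = y"
    proof (rule multiset_eqI)
      fix i
      show "count x i = count y i"
      proof (cases "i \<in> I")
        case True then show ?thesis using fun_cong[OF xy(3), of i] by simp
      next
        case False
        then have "i \<notin># x" "i \<notin># y" using xy by auto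
        then show ?thesis by (simp add: not_in_iff)
      qed
    qed
  qed
  have sub: "?f ` ?A \<subseteq> ?B"
  proof
    fix u assume "u \<in> ?f ` ?A"
    then obtain \<mu> where \<mu>: "u = ?f \<mu>" "size \<mu> < D" by auto
    have "count \<mu> i < D" for i using count_le_size[of \<mu> i] \<mu>(2) by linarith
    then show "u \<in> ?B" using \<mu>(1) by (simp add: PiE_def)
  qed
  have fB: "finite ?B" using I by (intro finite_PiE) auto
  show "finite ?A" using finite_subset[OF sub fB] inj by (rule finite_imageD)
  have "card ?A \<le> card ?B" using card_mono[OF fB sub] card_image[OF inj] by simp
  then show "card ?A \<le> D ^ card I" using I by (simp add: card_PiE)
qed

text \<open>Shifting by one drops the top value and repeats \<open>h 0\<close>, because subtraction
  is truncated; so \<open>c\<close> shifts cost at most \<open>c\<close> values, each bounded by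
  \<open>h M\<close>.\<close>

lemma sum_shift_le:
  fixes h :: "nat \<Rightarrow> nat"
  assumes mono: "\<And>D E. D \<le> E \<Longrightarrow> h D \<le> h E"
  shows "(\<Sum>D<M. h D) \<le> (\<Sum>D<M. h (D - c)) + c * h M"
proof (induction c)
  case (Suc c)
  have "(\<Sum>D<M. h (D - c)) \<le> (\<Sum>D<M. h (D - Suc c)) + h M"
  proof (cases M)
    case (Suc M')
    have "(\<Sum>D<M. h (D - Suc c)) = h 0 + (\<Sum>D<M'. h (D - c))"
      unfolding Suc by (subst sum.lessThan_Suc_shift) simp
    moreover have "(\<Sum>D<M. h (D - c)) = (\<Sum>D<M'. h (D - c)) + h (M' - c)" by (simp add: Suc)
    moreover have "h (M' - c) \<le> h M" using Suc by (intro mono) simp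
    ultimately show ?thesis by simp
  qed simp
  then show ?case using Suc by simp
qed simp

text \<open>Summed over D < 2N, the recurrence leaves at most \<open>c\<close> terms of
  \<open>h\<close>, so the sum of \<open>h'\<close> is at most c h(2N); by monotonicity its upper
  half is at least N h'(N). Thus \<open>h'\<close> grows one order more slowly. The bounds are
  multiplied out because the exponent n - i would be a truncated difference as soon as i exceeds
  n.\<close>

lemma growth_drop:
  fixes h h' :: "nat \<Rightarrow> nat"
  assumes rec: "\<And>D. h' D + h (D - c) \<le> h D"
    and mono: "\<And>D E. D \<le> E \<Longrightarrow> h D \<le> h E" and mono': "\<And>D E. D \<le> E \<Longrightarrow> h' D \<le> h' E"
    and bound: "\<And>D. h D * D ^ i \<le> C * D ^ n"
  shows "\<exists>C'. \<forall>D. h' D * D ^ Suc i \<le> C' * D ^ n"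
proof (intro exI allI)
  fix N
  have "(\<Sum>D<2*N. h' D) + (\<Sum>D<2*N. h (D - c)) \<le> (\<Sum>D<2*N. h D)"
    using rec by (simp add: sum.distrib[symmetric] sum_mono)
  then have 1: "(\<Sum>D<2*N. h' D) \<le> c * h (2*N)" using sum_shift_le[of h "2*N" c, OF mono] by simp
  have "N * h' N = (\<Sum>D\<in>{N..<2*N}. h' N)" by simp
  also have "\<dots> \<le> (\<Sum>D\<in>{N..<2*N}. h' D)" by (intro sum_mono mono') simp
  also have "\<dots> \<le> (\<Sum>D<2*N. h' D)" by (intro sum_mono2) auto
  finally have 2: "N * h' N \<le> c * h (2*N)" using 1 by simp
  have "h' N * N ^ Suc i = (N * h' N) * N ^ i" by simp
  also have "\<dots> \<le> (c * h (2*N)) * N ^ i" using 2 by (intro mult_right_mono) auto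
  also have "\<dots> \<le> (c * h (2*N)) * (2*N) ^ i" by (intro mult_left_mono power_mono) auto
  also have "\<dots> = c * (h (2*N) * (2*N) ^ i)" by simp
  also have "\<dots> \<le> c * (C * (2*N) ^ n)" by (intro mult_left_mono bound) simp
  also have "\<dots> = (c * 2 ^ n * C) * N ^ n" by (simp add: power_mult_distrib)
  finally show "h' N * N ^ Suc i \<le> (c * 2 ^ n * C) * N ^ n" .
qed

section \<open>Artin-Rees for primes and the length of prime chains\<close>

context kseries
begin

lemma finsum_ord_ge:
  assumes "f \<in> A \<rightarrow> carrier S \<inter> ord_ge D"
  shows "finsum S f A \<in> ord_ge D"
  unfolding ord_ge_def
proof safe
  fix m :: "'i multiset" assume m: "size m < D"
  have "finsum S f A m = finsum R (\<lambda>i. f i m) A" using assms by (intro ps_finsum) auto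
  also have "\<dots> = \<zero>" using assms m by (intro finsum_all_zero) (auto simp: ord_ge_def)
  finally show "finsum S f A m = \<zero>" .
qed

text \<open>The remainder \<open>w\<close> lies in P + (g). Division by a standard basis of this
  ideal writes it as p1 + y1 g with y1 of order at least D - c. Then g (y - y1) lies in P, and
  primality puts y - y1 in P.\<close>

lemma artin_rees_prime:
  assumes "primeideal P S" "g \<in> carrier S" "g \<notin> P"
  obtains c where "\<And>D y p w. y \<in> carrier S \<Longrightarrow> p \<in> P \<Longrightarrow> w \<in> carrier S \<Longrightarrow> w \<in> ord_ge D \<Longrightarrow>
      g \<otimes>\<^bsub>S\<^esub> y = p \<oplus>\<^bsub>S\<^esub> w \<Longrightarrow> \<exists>p'\<in>P. \<exists>w'\<in>carrier S \<inter> ord_ge (D - c). y = p' \<oplus>\<^bsub>S\<^esub> w'"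
proof -
  interpret P: primeideal P S by fact
  have Pc: "P \<subseteq> carrier S" using P.a_subset .
  define J where "J = P <+>\<^bsub>S\<^esub> PIdl\<^bsub>S\<^esub> g"
  have J: "ideal J S" unfolding J_def
    by (intro S.add_ideals S.cgenideal_ideal P.is_ideal assms)
  have Jmem: "x \<in> J \<longleftrightarrow> (\<exists>p\<in>P. \<exists>y\<in>carrier S. x = p \<oplus>\<^bsub>S\<^esub> y \<otimes>\<^bsub>S\<^esub> g)" for x
    unfolding J_def set_add_def set_mult_def cgenideal_def by auto
  obtain B :: "'i multiset set" and h c where B: "finite B" "h \<in> B \<rightarrow> J" and
    sb: "\<And>D w. w \<in> J \<Longrightarrow> w \<in> ord_ge D \<Longrightarrow>
       \<exists>a. a \<in> B \<rightarrow> carrier S \<inter> ord_ge (D - c) \<and> w = finsum S (\<lambda>b. a b \<otimes>\<^bsub>S\<^esub> h b) B"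
    by (rule standard_basis[OF J]) (rule that)
  have "\<forall>b\<in>B. \<exists>p y. p \<in> P \<and> y \<in> carrier S \<and> h b = p \<oplus>\<^bsub>S\<^esub> y \<otimes>\<^bsub>S\<^esub> g"
    using B(2) Jmem by blast
  then obtain pp yy where h: "\<And>b. b \<in> B \<Longrightarrow> pp b \<in> P" "\<And>b. b \<in> B \<Longrightarrow> yy b \<in> carrier S"
    "\<And>b. b \<in> B \<Longrightarrow> h b = pp b \<oplus>\<^bsub>S\<^esub> yy b \<otimes>\<^bsub>S\<^esub> g" by metis
  show thesis
  proof (rule that[of c])
    fix D y p w
    assume y: "y \<in> carrier S" and p: "p \<in> P" and w: "w \<in> carrier S" "w \<in> ord_ge D"
      and eq: "g \<otimes>\<^bsub>S\<^esub> y = p \<oplus>\<^bsub>S\<^esub> w"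
    have pc: "p \<in> carrier S" using p Pc by auto
    have "w = \<ominus>\<^bsub>S\<^esub> p \<oplus>\<^bsub>S\<^esub> (p \<oplus>\<^bsub>S\<^esub> w)" using pc w by (simp add: S.r_neg2 S.r_neg1)
    then have "w = \<ominus>\<^bsub>S\<^esub> p \<oplus>\<^bsub>S\<^esub> y \<otimes>\<^bsub>S\<^esub> g" using eq y assms(2) by (metis S.m_comm)
    then have "w \<in> J" using p y Jmem P.a_inv_closed by blast
    then obtain a where a: "a \<in> B \<rightarrow> carrier S \<inter> ord_ge (D - c)"
      and wa: "w = finsum S (\<lambda>b. a b \<otimes>\<^bsub>S\<^esub> h b) B" using sb w(2) by blast
    have ac: "a b \<in> carrier S" "a b \<in> ord_ge (D - c)" if "b \<in> B" for b using a that by auto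
    have ppc: "pp b \<in> carrier S" if "b \<in> B" for b using h(1) Pc that by auto
    define p1 where "p1 = finsum S (\<lambda>b. a b \<otimes>\<^bsub>S\<^esub> pp b) B"
    define y1 where "y1 = finsum S (\<lambda>b. a b \<otimes>\<^bsub>S\<^esub> yy b) B"
    have p1: "p1 \<in> P" unfolding p1_def using h ac by (intro P.finsum_in_ideal) (auto simp: P.I_l_closed)
    have p1c: "p1 \<in> carrier S" using p1 Pc by auto
    have y1c: "y1 \<in> carrier S" unfolding y1_def using h(2) ac by (intro S.finsum_closed) auto
    have y1o: "y1 \<in> ord_ge (D - c)" unfolding y1_def
    proof (intro finsum_ord_ge Pi_I IntI)
      fix b assume b: "b \<in> B"
      then show "a b \<otimes>\<^bsub>S\<^esub> yy b \<in> carrier S" using h(2) ac by auto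
      have "yy b \<otimes>\<^bsub>S\<^esub> a b \<in> ord_ge (D - c)" using b h(2) ac by (intro ord_ge_mult_l) auto
      then show "a b \<otimes>\<^bsub>S\<^esub> yy b \<in> ord_ge (D - c)" using b h(2) ac by (simp add: S.m_comm)
    qed
    have "w = finsum S (\<lambda>b. a b \<otimes>\<^bsub>S\<^esub> pp b \<oplus>\<^bsub>S\<^esub> a b \<otimes>\<^bsub>S\<^esub> yy b \<otimes>\<^bsub>S\<^esub> g) B"
      unfolding wa using ac h(2) ppc assms(2)
      by (intro S.finsum_cong') (auto simp: h(3) S.r_distr S.m_assoc)
    also have "\<dots> = p1 \<oplus>\<^bsub>S\<^esub> finsum S (\<lambda>b. a b \<otimes>\<^bsub>S\<^esub> yy b \<otimes>\<^bsub>S\<^esub> g) B"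
      unfolding p1_def using ac h(2) ppc assms(2) by (intro S.finsum_addf) auto
    also have "finsum S (\<lambda>b. a b \<otimes>\<^bsub>S\<^esub> yy b \<otimes>\<^bsub>S\<^esub> g) B = y1 \<otimes>\<^bsub>S\<^esub> g"
      unfolding y1_def using B(1) ac h(2) assms(2) by (intro S.finsum_ldistr[symmetric]) auto
    finally have w': "w = p1 \<oplus>\<^bsub>S\<^esub> y1 \<otimes>\<^bsub>S\<^esub> g" .
    have "g \<otimes>\<^bsub>S\<^esub> (y \<ominus>\<^bsub>S\<^esub> y1) = g \<otimes>\<^bsub>S\<^esub> y \<ominus>\<^bsub>S\<^esub> y1 \<otimes>\<^bsub>S\<^esub> g"
      using y y1c assms(2) by (simp add: a_minus_def S.r_distr S.r_minus S.m_comm)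
    also have "\<dots> = p \<oplus>\<^bsub>S\<^esub> p1"
      unfolding eq w' using p1c pc y1c assms(2) by (simp add: a_minus_def S.a_assoc S.r_neg)
    finally have "g \<otimes>\<^bsub>S\<^esub> (y \<ominus>\<^bsub>S\<^esub> y1) \<in> P" using p p1 by (simp add: P.a_closed)
    then have "y \<ominus>\<^bsub>S\<^esub> y1 \<in> P" using P.I_prime[of g "y \<ominus>\<^bsub>S\<^esub> y1"] assms y y1c by auto
    moreover have "y = (y \<ominus>\<^bsub>S\<^esub> y1) \<oplus>\<^bsub>S\<^esub> y1" using y y1c by (simp add: a_minus_def S.a_assoc S.l_neg)
    ultimately show "\<exists>p'\<in>P. \<exists>w'\<in>carrier S \<inter> ord_ge (D - c). y = p' \<oplus>\<^bsub>S\<^esub> w'" using y1c y1o by blast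
  qed
qed

text \<open>\<open>hfun J D\<close> is the length of \<open>S / (J + \<mm>\<^sup>D)\<close>.\<close>

definition hfun :: "('i multiset \<Rightarrow> 'a) set \<Rightarrow> nat \<Rightarrow> nat" where
  "hfun J D = card {\<mu>. set_mset \<mu> \<subseteq> I \<and> size \<mu> < D \<and> \<mu> \<notin> LM J}"

lemma hfun_mono: "D \<le> E \<Longrightarrow> hfun J D \<le> hfun J E"
  unfolding hfun_def by (intro card_mono finite_subset[OF _ finite_monomials[OF finI, of E]]) auto

lemma hfun_le: "hfun J D \<le> D ^ card I"
proof -
  have "hfun J D \<le> card {\<mu>. set_mset \<mu> \<subseteq> I \<and> size \<mu> < D}"
    unfolding hfun_def by (intro card_mono finite_monomials[OF finI]) auto
  then show ?thesis using card_monomials_le[OF finI, of D] by linarith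
qed

lemma not_ord_ge_lead:
  assumes "w \<notin> ord_ge D"
  obtains \<mu> where "is_lead w \<mu>" "size \<mu> < D"
proof -
  obtain m where m: "size m < D" "w m \<noteq> \<zero>" using assms by (auto simp: ord_ge_def)
  then have "w \<noteq> \<zero>\<^bsub>S\<^esub>" by (auto simp: ps_simps)
  then obtain \<mu> where \<mu>: "is_lead w \<mu>" by (rule lead_exists)
  then have "\<not> mless m \<mu>" using m by (auto simp: is_lead_def)
  then have "size \<mu> \<le> size m" using mless_linear[of m \<mu>] mless_size by auto
  then show thesis using that \<mu> m by auto
qed

text \<open>Take g in Q outside P. The products of g with the monomials outside \<open>LM P\<close>
  of degree below D - c, together with one element of P for each leading monomial of degree below D,
  lie in Q and are independent modulo order D. So there are at most as many of them as monomials of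
  \<open>LM Q\<close> below degree D; passing to complements gives the inequality.\<close>

lemma hfun_drop:
  assumes "primeideal P S" "ideal Q S" "P \<subset> Q"
  obtains c where "\<And>D. hfun Q D + hfun P (D - c) \<le> hfun P D"
proof -
  interpret P: primeideal P S by fact
  interpret Q: ideal Q S by fact
  have Pc: "P \<subseteq> carrier S" and Qc: "Q \<subseteq> carrier S" using P.a_subset Q.a_subset .
  obtain g where g: "g \<in> Q" "g \<notin> P" using assms(3) by auto
  have gc: "g \<in> carrier S" using g Qc by auto
  obtain c where c: "\<And>D y p w. y \<in> carrier S \<Longrightarrow> p \<in> P \<Longrightarrow> w \<in> carrier S \<Longrightarrow> w \<in> ord_ge D \<Longrightarrow>
      g \<otimes>\<^bsub>S\<^esub> y = p \<oplus>\<^bsub>S\<^esub> w \<Longrightarrow> \<exists>p'\<in>P. \<exists>w'\<in>carrier S \<inter> ord_ge (D - c). y = p' \<oplus>\<^bsub>S\<^esub> w'"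
    by (rule artin_rees_prime[OF assms(1) gc g(2)]) (rule that)
  have "\<forall>\<mu>\<in>LM P. \<exists>f. f \<in> P \<and> is_lead f \<mu> \<and> f \<mu> = \<one>"
    using LM_monic[OF P.is_ideal] by metis
  then obtain pl where pl: "\<And>\<mu>. \<mu> \<in> LM P \<Longrightarrow> pl \<mu> \<in> P" "\<And>\<mu>. \<mu> \<in> LM P \<Longrightarrow> is_lead (pl \<mu>) \<mu>"
    "\<And>\<mu>. \<mu> \<in> LM P \<Longrightarrow> pl \<mu> \<mu> = \<one>" by metis
  have LMsub: "LM P \<subseteq> LM Q" using assms(3) by (auto simp: LM_def)
  show thesis
  proof (rule that[of c], rule ccontr)
    fix D
    assume contra: "\<not> hfun Q D + hfun P (D - c) \<le> hfun P D"
    define M where "M = (\<lambda>D. {\<mu>. set_mset \<mu> \<subseteq> I \<and> size \<mu> < D})"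
    have Mfin: "finite (M D)" for D unfolding M_def by (rule finite_monomials[OF finI])
    define B where "B = M (D - c) - LM P"
    define NP where "NP = M D \<inter> LM P"
    define NQ where "NQ = M D \<inter> LM Q"
    have fin: "finite B" "finite NP" "finite NQ" using Mfin by (auto simp: B_def NP_def NQ_def)
    have disj: "B \<inter> NP = {}" by (auto simp: B_def NP_def)
    have hP: "hfun P D = card (M D) - card NP"
    proof -
      have "{\<mu>. set_mset \<mu> \<subseteq> I \<and> size \<mu> < D \<and> \<mu> \<notin> LM P} = M D - NP" by (auto simp: M_def NP_def)
      then show ?thesis unfolding hfun_def using fin by (simp add: card_Diff_subset NP_def)
    qed
    have hQ: "hfun Q D = card (M D) - card NQ"
    proof -
      have "{\<mu>. set_mset \<mu> \<subseteq> I \<and> size \<mu> < D \<and> \<mu> \<notin> LM Q} = M D - NQ" by (auto simp: M_def NQ_def)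
      then show ?thesis unfolding hfun_def using fin by (simp add: card_Diff_subset NQ_def)
    qed
    have hB: "hfun P (D - c) = card B"
      unfolding hfun_def B_def M_def by (rule arg_cong[where f = card]) auto
    have "card NP \<le> card (M D)" "card NQ \<le> card (M D)"
      using Mfin by (auto intro!: card_mono simp: NP_def NQ_def)
    then have "card NQ < card B + card NP" using contra hP hQ hB by linarith
    \<comment> \<open>In terms of complements, failure of the inequality says that the family is
      larger than the set of leading monomials of Q below degree D.\<close>
    then have lt: "card NQ < card (B \<union> NP)" using fin disj by (simp add: card_Un_disjoint)
    have Bsup: "set_mset \<beta> \<subseteq> I" if "\<beta> \<in> B" for \<beta> using that by (auto simp: B_def M_def)
    define e where "e = (\<lambda>x. if x \<in> B then g \<otimes>\<^bsub>S\<^esub> pmono R \<one> x else pl x)"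
    have plc: "pl x \<in> carrier S" if "x \<in> NP" for x using pl(1) Pc that by (auto simp: NP_def)
    have eQ: "e x \<in> Q" if "x \<in> B \<union> NP" for x
    proof (cases "x \<in> B")
      case True then show ?thesis using g Bsup by (auto simp: e_def intro!: Q.I_r_closed)
    next
      case False then show ?thesis using that pl(1) assms(3) by (auto simp: e_def NP_def)
    qed
    have ec: "e x \<in> carrier S" if "x \<in> B \<union> NP" for x using eQ[OF that] Qc by auto
    have ecm: "e x m \<in> carrier R" if "x \<in> B \<union> NP" for x m using ps_carrierD(1)[OF ec[OF that]] .
    \<comment> \<open>A nontrivial combination of the family has zero coefficients on
      \<open>NQ\<close>. It lies in Q, so its leading monomial, if it has one, must have degree at
      least D.\<close>
    obtain v where v: "v \<in> B \<union> NP \<rightarrow> carrier R" "\<exists>x\<in>B \<union> NP. v x \<noteq> \<zero>"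
      "\<forall>j\<in>NQ. finsum R (\<lambda>x. v x \<otimes> e x j) (B \<union> NP) = \<zero>"
      using homogeneous_system[of NQ "B \<union> NP" e] fin lt ecm by auto
    have vc: "v x \<in> carrier R" if "x \<in> B \<union> NP" for x using v(1) that by blast
    have vSc: "pmono R (v x) {#} \<in> carrier S" if "x \<in> B \<union> NP" for x using vc[OF that] by simp
    define w where "w = finsum S (\<lambda>x. pmono R (v x) {#} \<otimes>\<^bsub>S\<^esub> e x) (B \<union> NP)"
    have wQ: "w \<in> Q" unfolding w_def
      using eQ vSc by (intro Q.finsum_in_ideal) (auto intro!: Q.I_l_closed)
    have wc: "w \<in> carrier S" using wQ Qc by auto
    have wcoef: "w \<mu> = finsum R (\<lambda>x. v x \<otimes> e x \<mu>) (B \<union> NP)" for \<mu>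
    proof -
      have "w \<mu> = finsum R (\<lambda>x. (pmono R (v x) {#} \<otimes>\<^bsub>S\<^esub> e x) \<mu>) (B \<union> NP)"
        unfolding w_def using ec vSc by (intro ps_finsum) auto
      also have "\<dots> = finsum R (\<lambda>x. v x \<otimes> e x \<mu>) (B \<union> NP)"
      proof (intro finsum_cong')
        fix x assume x: "x \<in> B \<union> NP"
        show "(pmono R (v x) {#} \<otimes>\<^bsub>S\<^esub> e x) \<mu> = v x \<otimes> e x \<mu>"
          using pmono_mult[OF vc[OF x] ec[OF x], of "{#}" \<mu>] by simp
      qed (use vc ecm in auto)
      finally show ?thesis .
    qed
    have wo: "w \<in> ord_ge D"
    proof (rule ccontr)
      assume "w \<notin> ord_ge D"
      then obtain \<mu> where \<mu>: "is_lead w \<mu>" "size \<mu> < D" by (rule not_ord_ge_lead)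
      then have "\<mu> \<in> LM Q" using wQ by (auto simp: LM_def)
      then have "\<mu> \<in> NQ" using \<mu>(2) LM_support[OF Qc] by (auto simp: NQ_def M_def)
      then have "w \<mu> = \<zero>" using wcoef v(3) by simp
      then show False using \<mu> by (simp add: is_lead_def)
    qed
    define y where "y = finsum S (\<lambda>x. pmono R (v x) x) B"
    define q where "q = finsum S (\<lambda>x. pmono R (v x) {#} \<otimes>\<^bsub>S\<^esub> pl x) NP"
    have ymc: "pmono R (v x) x \<in> carrier S" if "x \<in> B" for x using vc[of x] Bsup that by auto
    have yc: "y \<in> carrier S" unfolding y_def using ymc by (intro S.finsum_closed) auto
    have ycoef: "y \<mu> = (if \<mu> \<in> B then v \<mu> else \<zero>)" for \<mu>
    proof -
      have "y \<mu> = finsum R (\<lambda>x. pmono R (v x) x \<mu>) B"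
        unfolding y_def using ymc by (intro ps_finsum) auto
      also have "\<dots> = (if \<mu> \<in> B then v \<mu> else \<zero>)"
      proof (cases "\<mu> \<in> B")
        case True
        have "finsum R (\<lambda>x. pmono R (v x) x \<mu>) B = pmono R (v \<mu>) \<mu> \<mu>"
          using True fin vc by (intro finsum_only) (auto simp: pmono_def)
        then show ?thesis using True by (simp add: pmono_def)
      next
        case False
        then show ?thesis by (simp, intro finsum_all_zero) (auto simp: pmono_def)
      qed
      finally show ?thesis .
    qed
    have qP: "q \<in> P" unfolding q_def
      using pl(1) vSc by (intro P.finsum_in_ideal) (auto intro!: P.I_l_closed simp: NP_def)
    have qc: "q \<in> carrier S" using qP Pc by auto
    have weq: "w = g \<otimes>\<^bsub>S\<^esub> y \<oplus>\<^bsub>S\<^esub> q"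
    proof -
      have "w = finsum S (\<lambda>x. pmono R (v x) {#} \<otimes>\<^bsub>S\<^esub> e x) B \<oplus>\<^bsub>S\<^esub> finsum S (\<lambda>x. pmono R (v x) {#} \<otimes>\<^bsub>S\<^esub> e x) NP"
        unfolding w_def using fin disj ec vSc by (intro S.finsum_Un_disjoint) auto
      also have "finsum S (\<lambda>x. pmono R (v x) {#} \<otimes>\<^bsub>S\<^esub> e x) NP = q"
        unfolding q_def using vSc plc disj by (intro S.finsum_cong') (auto simp: e_def)
      also have "finsum S (\<lambda>x. pmono R (v x) {#} \<otimes>\<^bsub>S\<^esub> e x) B = finsum S (\<lambda>x. g \<otimes>\<^bsub>S\<^esub> pmono R (v x) x) B"
      proof (intro S.finsum_cong')
        fix x assume x: "x \<in> B"
        then have c1: "pmono R \<one> x \<in> carrier S" "pmono R (v x) {#} \<in> carrier S" using Bsup vSc by auto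
        have "pmono R (v x) {#} \<otimes>\<^bsub>S\<^esub> (g \<otimes>\<^bsub>S\<^esub> pmono R \<one> x) = g \<otimes>\<^bsub>S\<^esub> (pmono R (v x) {#} \<otimes>\<^bsub>S\<^esub> pmono R \<one> x)"
          using c1 gc by (simp add: S.m_lcomm)
        also have "pmono R (v x) {#} \<otimes>\<^bsub>S\<^esub> pmono R \<one> x = pmono R (v x) x"
          using vc[of x] Bsup[OF x] x by (subst pmono_mult_pmono) auto
        finally show "pmono R (v x) {#} \<otimes>\<^bsub>S\<^esub> e x = g \<otimes>\<^bsub>S\<^esub> pmono R (v x) x" using x by (simp add: e_def)
      qed (use ymc gc in auto)
      also have "\<dots> = g \<otimes>\<^bsub>S\<^esub> y"
        unfolding y_def using fin gc ymc by (intro S.finsum_rdistr[symmetric]) auto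
      finally show ?thesis .
    qed
    \<comment> \<open>Now g y lies in P up to order D, so y lies in P up to order D - c.\<close>
    have "g \<otimes>\<^bsub>S\<^esub> y = \<ominus>\<^bsub>S\<^esub> q \<oplus>\<^bsub>S\<^esub> w"
      unfolding weq using gc yc qc by (simp add: S.a_comm[of "g \<otimes>\<^bsub>S\<^esub> y" q] S.r_neg1)
    then obtain p' w' where pw: "p' \<in> P" "w' \<in> carrier S" "w' \<in> ord_ge (D - c)" "y = p' \<oplus>\<^bsub>S\<^esub> w'"
      using c[OF yc _ wc wo, of "\<ominus>\<^bsub>S\<^esub> q"] qP P.a_inv_closed by blast
    have p'c: "p' \<in> carrier S" using pw Pc by auto
    \<comment> \<open>All monomials of y lie outside \<open>LM P\<close> and have degree below D -
      c, so the leading monomial of y would also be that of an element of P.\<close>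
    have y0: "y = \<zero>\<^bsub>S\<^esub>"
    proof (rule ccontr)
      assume "y \<noteq> \<zero>\<^bsub>S\<^esub>"
      then obtain \<mu> where \<mu>: "is_lead y \<mu>" by (rule lead_exists)
      then have \<mu>B: "\<mu> \<in> B" using ycoef by (auto simp: is_lead_def split: if_splits)
      then have sz: "size \<mu> < D - c" by (auto simp: B_def M_def)
      have "p' m = y m" if "size m < D - c" for m
        using pw(4) ord_geD[OF pw(3) that] ps_carrierD(1)[OF p'c, of m] by (simp add: ps_simps)
      then have "is_lead p' \<mu>" using \<mu> sz mless_size unfolding is_lead_def by (metis le_less_trans)
      then show False using pw(1) \<mu>B by (auto simp: LM_def B_def)
    qed
    then have vB: "v x = \<zero>" if "x \<in> B" for x using ycoef[of x] that by (simp add: ps_simps)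
    have wq: "w = q" using weq y0 gc qc by simp
    \<comment> \<open>What is left combines elements of P with distinct leading monomials; the
      smallest one with nonzero coefficient cannot be cancelled.\<close>
    obtain x0 where x0: "x0 \<in> NP" "v x0 \<noteq> \<zero>" "\<And>k. mless k x0 \<Longrightarrow> \<not> (k \<in> NP \<and> v k \<noteq> \<zero>)"
    proof -
      have ex: "\<exists>x. x \<in> NP \<and> v x \<noteq> \<zero>" using v(2) vB by auto
      show thesis by (rule mless_min[OF ex]) (use that in blast)
    qed
    have "w x0 = finsum R (\<lambda>x. v x \<otimes> e x x0) (B \<union> NP)" by (rule wcoef)
    also have "\<dots> = v x0 \<otimes> e x0 x0"
    proof (rule finsum_only)
      fix j assume j: "j \<in> B \<union> NP" "j \<noteq> x0"
      show "v j \<otimes> e j x0 = \<zero>"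
      proof (cases "v j = \<zero>")
        case True then show ?thesis using ecm[OF j(1)] by simp
      next
        case False
        then have jN: "j \<in> NP" "j \<notin> B" using j vB by auto
        then have "\<not> mless j x0" using x0(3) False by blast
        then have "mless x0 j" using mless_linear j(2) by blast
        then have "pl j x0 = \<zero>" using pl(2) jN by (auto simp: NP_def is_lead_def)
        then show ?thesis using jN vc[OF j(1)] by (simp add: e_def)
      qed
    qed (use fin x0 vc ecm in auto)
    also have "e x0 x0 = \<one>" using x0(1) disj pl(3) by (auto simp: e_def NP_def)
    finally have "w x0 = v x0" using vc x0 by simp
    moreover have "w x0 = \<zero>" using wo x0(1) by (auto simp: NP_def M_def ord_ge_def)
    ultimately show False using x0 by simp
  qed
qed

text \<open>The empty monomial is not in \<open>LM P\<close>: an element with nonzero constant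
  coefficient would be a unit in a proper ideal.\<close>

lemma hfun_pos:
  assumes "ideal P S" "P \<noteq> carrier S" "D > 0"
  shows "hfun P D \<ge> 1"
proof -
  interpret P: ideal P S by fact
  have "{#} \<notin> LM P"
  proof
    assume "{#} \<in> LM P"
    then obtain f where f: "f \<in> P" "f {#} \<noteq> \<zero>" by (auto simp: LM_def is_lead_def)
    then have "f \<in> Units S" using S_unit P.a_subset by blast
    then have "\<one>\<^bsub>S\<^esub> \<in> P" using f P.I_l_closed[of f "inv\<^bsub>S\<^esub> f"] by simp
    then show False using assms(2) P.one_imp_carrier by blast
  qed
  then have "{{#}} \<subseteq> {\<mu>. set_mset \<mu> \<subseteq> I \<and> size \<mu> < D \<and> \<mu> \<notin> LM P}" using assms(3) by auto
  then have "card {{#} :: 'i multiset} \<le> hfun P D" unfolding hfun_def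
    by (intro card_mono finite_subset[OF _ finite_monomials[OF finI, of D]]) auto
  then show ?thesis by simp
qed

text \<open>The growth exponent is at most \<open>card I\<close> at the bottom of the chain and
  falls by one at each inclusion, while the top prime is proper and so keeps \<open>hfun\<close> at
  least 1.\<close>

lemma S_prime_chain_le:
  assumes prime: "\<And>i. i \<le> l \<Longrightarrow> primeideal (P i) S" and strict: "\<And>i. i < l \<Longrightarrow> P i \<subset> P (Suc i)"
  shows "l \<le> card I"
proof (rule ccontr)
  assume contra: "\<not> l \<le> card I"
  have "\<exists>C. \<forall>D. hfun (P i) D * D ^ i \<le> C * D ^ card I" if "i \<le> l" for i
    using that
  proof (induction i)
    case 0
    show ?case using hfun_le[of "P 0"] by (intro exI[of _ 1]) simp
  next
    case (Suc i)
    then obtain C where C: "\<And>D. hfun (P i) D * D ^ i \<le> C * D ^ card I" by auto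
    obtain c where c: "\<And>D. hfun (P (Suc i)) D + hfun (P i) (D - c) \<le> hfun (P i) D"
      using hfun_drop[of "P i" "P (Suc i)"] prime[of i] prime[of "Suc i"] strict[of i] Suc.prems
        primeideal.axioms(1) by (metis Suc_le_lessD less_imp_le)
    show ?case using growth_drop[of "hfun (P (Suc i))" "hfun (P i)" c i C "card I"] c C hfun_mono by blast
  qed
  then obtain C where C: "\<And>D. hfun (P l) D * D ^ l \<le> C * D ^ card I" by blast
  interpret Pl: primeideal "P l" S using prime by simp
  have "P l \<noteq> carrier S" using Pl.I_notcarr by simp
  \<comment> \<open>At D = C + 1 the growth bound for the top prime becomes (C + 1)^l \<le> C (C +
    1)^card I, which fails when l exceeds card I.\<close>
  then have "1 \<le> hfun (P l) (Suc C)" using hfun_pos[OF Pl.is_ideal] by simp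
  then have "Suc C ^ l \<le> hfun (P l) (Suc C) * Suc C ^ l" by simp
  also have "\<dots> \<le> C * Suc C ^ card I" by (rule C)
  also have "\<dots> < Suc C ^ Suc (card I)" by simp
  also have "\<dots> \<le> Suc C ^ l" using contra by (intro power_increasing) auto
  finally show False by simp
qed

end


section \<open>Frobenius and F-signature data under isomorphism\<close>

context cring
begin

lemma binomial_theorem:
  assumes "x \<in> carrier R" "y \<in> carrier R"
  shows "(x \<oplus> y) [^] n = finsum R (\<lambda>k. [(n choose k)] \<cdot> (x [^] k \<otimes> y [^] (n - k))) {..n}"
proof (induction n)
  case (Suc n)
  let ?t = "\<lambda>k. [(n choose k)] \<cdot> (x [^] k \<otimes> y [^] (n - k))"
  let ?u = "\<lambda>k. [(n choose Suc k)] \<cdot> (x [^] Suc k \<otimes> y [^] (n - k))"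
  let ?s = "\<lambda>k. [(n choose k)] \<cdot> (x [^] k \<otimes> y [^] (Suc n - k))"
  let ?T = "\<lambda>k. [(Suc n choose k)] \<cdot> (x [^] k \<otimes> y [^] (Suc n - k))"
  have tc: "?t \<in> {..n} \<rightarrow> carrier R" "?u \<in> {..n} \<rightarrow> carrier R" "?s \<in> {..Suc n} \<rightarrow> carrier R" "?T \<in> {..Suc n} \<rightarrow> carrier R"
    "?s \<in> {..n} \<rightarrow> carrier R"
    using assms by auto
  have xt: "x \<otimes> ?t k = [(n choose k)] \<cdot> (x [^] Suc k \<otimes> y [^] (n - k))" for k
  proof -
    have "x \<otimes> ?t k = [(n choose k)] \<cdot> (x \<otimes> (x [^] k \<otimes> y [^] (n - k)))"
      using assms by (intro add_pow_rdistr) auto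
    also have "x \<otimes> (x [^] k \<otimes> y [^] (n - k)) = x [^] Suc k \<otimes> y [^] (n - k)"
      using assms by (simp add: m_ac)
    finally show ?thesis .
  qed
  have yt: "y \<otimes> ?t k = ?s k" if "k \<le> n" for k
  proof -
    have "y \<otimes> ?t k = [(n choose k)] \<cdot> (y \<otimes> (x [^] k \<otimes> y [^] (n - k)))"
      using assms by (intro add_pow_rdistr) auto
    also have "y \<otimes> (x [^] k \<otimes> y [^] (n - k)) = x [^] k \<otimes> y [^] (Suc n - k)"
      using assms that by (simp add: m_ac Suc_diff_le)
    finally show ?thesis .
  qed
  have "finsum R ?T {..Suc n} = finsum R (\<lambda>k. ?T (Suc k)) {..n} \<oplus> ?T 0"
    using tc by (intro finsum_Suc2) auto
  also have "finsum R (\<lambda>k. ?T (Suc k)) {..n} = finsum R (\<lambda>k. x \<otimes> ?t k \<oplus> ?u k) {..n}"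
    using assms unfolding xt by (intro finsum_cong') (auto simp: add.nat_pow_mult)
  also have "\<dots> = finsum R (\<lambda>k. x \<otimes> ?t k) {..n} \<oplus> finsum R ?u {..n}"
    using tc assms by (intro finsum_addf) auto
  also have "\<dots> \<oplus> ?T 0 = finsum R (\<lambda>k. x \<otimes> ?t k) {..n} \<oplus> (finsum R ?u {..n} \<oplus> ?s 0)"
    using tc assms by (simp add: a_assoc finsum_closed)
  also have "finsum R ?u {..n} \<oplus> ?s 0 = finsum R ?s {..Suc n}"
    using tc finsum_Suc2[of ?s n] by simp
  also have "\<dots> = finsum R ?s {..n}"
  proof -
    have "?s (Suc n) = \<zero>" using assms by (simp add: binomial_eq_0)
    then show ?thesis using tc by (subst finsum_Suc) (auto simp: finsum_closed)
  qed
  also have "\<dots> = finsum R (\<lambda>k. y \<otimes> ?t k) {..n}"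
    using tc yt by (intro finsum_cong') auto
  also have "finsum R (\<lambda>k. x \<otimes> ?t k) {..n} \<oplus> finsum R (\<lambda>k. y \<otimes> ?t k) {..n}
      = (x \<oplus> y) \<otimes> finsum R ?t {..n}"
    using tc assms by (simp add: finsum_rdistr[symmetric] l_distr finsum_closed)
  also have "\<dots> = (x \<oplus> y) [^] Suc n"
    using assms Suc by (simp add: m_comm)
  finally show ?case by simp
qed (use assms in simp)

lemma char_add_pow:
  assumes "[p] \<cdot> \<one> = \<zero>" "x \<in> carrier R" "p dvd k"
  shows "[(k::nat)] \<cdot> x = \<zero>"
proof -
  obtain m where m: "k = p * m" using assms(3) by auto
  have "[p] \<cdot> x = ([p] \<cdot> \<one>) \<otimes> x" using assms(2) by (simp add: add_pow_ldistr)
  then have "[p] \<cdot> x = \<zero>" using assms by simp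
  then show ?thesis unfolding m using assms(2) by (simp add: add.nat_pow_pow[symmetric])
qed

lemma freshman:
  assumes "Factorial_Ring.prime (p::nat)" "[p] \<cdot> \<one> = \<zero>" "x \<in> carrier R" "y \<in> carrier R"
  shows "(x \<oplus> y) [^] p = x [^] p \<oplus> y [^] p"
proof -
  let ?t = "\<lambda>k. [(p choose k)] \<cdot> (x [^] k \<otimes> y [^] (p - k))"
  have p: "p > 1" using assms(1) prime_gt_1_nat by auto
  have "(x \<oplus> y) [^] p = finsum R ?t {..p}" by (rule binomial_theorem) (use assms in auto)
  also have "\<dots> = finsum R ?t {0, p}"
  proof (rule finsum_neutral)
    fix i assume "i \<in> {..p} - {0, p}"
    then have "p dvd (p choose i)" using assms(1) by (intro dvd_choose_prime) auto
    then show "?t i = \<zero>" by (rule char_add_pow[OF assms(2), rotated]) (simp add: assms(3,4))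
  qed (use assms in auto)
  also have "\<dots> = y [^] p \<oplus> x [^] p"
    using assms p by (subst finsum_insert) auto
  finally show ?thesis using assms by (simp add: a_comm)
qed

lemma frobenius_add:
  assumes "Factorial_Ring.prime (p::nat)" "[p] \<cdot> \<one> = \<zero>" "x \<in> carrier R" "y \<in> carrier R"
  shows "(x \<oplus> y) [^] (p ^ e) = x [^] (p ^ e) \<oplus> y [^] (p ^ e)"
proof (induction e)
  case (Suc e)
  have "(x \<oplus> y) [^] (p ^ Suc e) = ((x \<oplus> y) [^] (p ^ e)) [^] p"
    using assms by (simp add: nat_pow_pow mult.commute)
  also have "\<dots> = (x [^] (p ^ e)) [^] p \<oplus> (y [^] (p ^ e)) [^] p"
    unfolding Suc using assms by (intro freshman) auto
  finally show ?case using assms by (simp add: nat_pow_pow mult.commute)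
qed (use assms in simp)

end

section \<open>Invariance of characteristic, dimension and residue degree\<close>

lemma (in ring_hom_ring) hom_add_pow_one: "h ([(k::nat)] \<cdot> \<one>) = [k] \<cdot>\<^bsub>S\<^esub> \<one>\<^bsub>S\<^esub>"
  by (induction k) auto

lemma ring_char_inj_hom:
  assumes "ring A" "ring B" "h \<in> ring_hom A B" "inj_on h (carrier A)"
  shows "ring_char A = ring_char B"
proof -
  interpret ring_hom_ring A B h
    using assms by (simp add: ring_hom_ring_def ring_hom_ring_axioms_def)
  have "[k] \<cdot>\<^bsub>A\<^esub> \<one>\<^bsub>A\<^esub> = \<zero>\<^bsub>A\<^esub> \<longleftrightarrow> [k] \<cdot>\<^bsub>B\<^esub> \<one>\<^bsub>B\<^esub> = \<zero>\<^bsub>B\<^esub>" for k :: nat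
  proof -
    have "[k] \<cdot>\<^bsub>A\<^esub> \<one>\<^bsub>A\<^esub> \<in> carrier A" by simp
    then have "[k] \<cdot>\<^bsub>A\<^esub> \<one>\<^bsub>A\<^esub> = \<zero>\<^bsub>A\<^esub> \<longleftrightarrow> h ([k] \<cdot>\<^bsub>A\<^esub> \<one>\<^bsub>A\<^esub>) = h \<zero>\<^bsub>A\<^esub>"
      using assms(4) by (auto simp: inj_on_def)
    then show ?thesis by (simp add: hom_add_pow_one)
  qed
  then show ?thesis by (simp add: ring_char_def)
qed

text \<open>The multiples that annihilate the unit are closed under gcd by Bezout, so their gcd is
  one of them.\<close>

lemma (in ring) ring_char_kills:
  "[(ring_char R)] \<cdot> \<one> = \<zero>"
proof -
  let ?A = "{n::nat. [n] \<cdot> \<one> = \<zero>}"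
  have one: "[(a + b)] \<cdot> \<one> = [a] \<cdot> \<one> \<oplus> [b] \<cdot> \<one>" for a b :: nat
    by (simp add: add.nat_pow_mult)
  have mult: "[(a * b)] \<cdot> \<one> = \<zero>" if "[a] \<cdot> \<one> = \<zero>" for a b :: nat
    using that add.nat_pow_pow[of \<one> b a] by simp
  have "Gcd ?A \<in> ?A"
  proof (rule Gcd_in)
    fix a b assume ab: "a \<in> ?A" "b \<in> ?A"
    show "gcd a b \<in> ?A"
    proof (cases "a = 0")
      case False
      then obtain u v where "a * u = b * v + gcd a b" using bezout_nat by blast
      moreover have "[(a * u)] \<cdot> \<one> = \<zero>" "[(b * v)] \<cdot> \<one> = \<zero>" using ab mult by auto
      ultimately have "\<zero> = \<zero> \<oplus> [(gcd a b)] \<cdot> \<one>" using one[of "b * v" "gcd a b"] by simp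
      then show ?thesis by simp
    qed (use ab in simp)
  qed (auto intro: exI[of _ 0])
  then show ?thesis by (simp add: ring_char_def)
qed

lemma krull_dim_le_iso:
  fixes A :: "('a, 'm) ring_scheme" and B :: "('b, 'n) ring_scheme"
  assumes "h \<in> ring_iso A B" "cring A" "cring B"
  shows "krull_dim B \<le> krull_dim A"
proof -
  interpret A: cring A by fact
  interpret B: cring B by fact
  interpret ring_hom_ring A B h
    using assms by (simp add: ring_hom_ring_def ring_hom_ring_axioms_def ring_iso_def A.ring_axioms B.ring_axioms)
  have surj: "h ` carrier A = carrier B" using assms(1) by (auto simp: ring_iso_def bij_betw_def)
  have "{enat l | l. \<exists>P :: nat \<Rightarrow> 'b set. (\<forall>i\<le>l. primeideal (P i) B) \<and> (\<forall>i<l. P i \<subset> P (Suc i))}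
      \<subseteq> {enat l | l. \<exists>P :: nat \<Rightarrow> 'a set. (\<forall>i\<le>l. primeideal (P i) A) \<and> (\<forall>i<l. P i \<subset> P (Suc i))}"
  proof safe
    fix l and P :: "nat \<Rightarrow> 'b set"
    assume P: "\<forall>i\<le>l. primeideal (P i) B" "\<forall>i<l. P i \<subset> P (Suc i)"
    define Q where "Q = (\<lambda>i. {r \<in> carrier A. h r \<in> P i})"
    have "primeideal (Q i) A" if "i \<le> l" for i
      unfolding Q_def using P that by (intro primeideal_vimage A.cring_axioms) auto
    moreover have "Q i \<subset> Q (Suc i)" if i: "i < l" for i
    proof -
      have "primeideal (P (Suc i)) B" using P i by auto
      then have sub: "P (Suc i) \<subseteq> carrier B"
        using additive_subgroup.a_subset ideal.axioms(1) primeideal.axioms(1) by blast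
      obtain y where y: "y \<in> P (Suc i)" "y \<notin> P i" using P(2) i by blast
      then obtain x where "x \<in> carrier A" "h x = y" using sub surj by (metis imageE subsetD)
      then have "x \<in> Q (Suc i)" "x \<notin> Q i" using y by (auto simp: Q_def)
      moreover have "Q i \<subseteq> Q (Suc i)" using P(2) i by (auto simp: Q_def)
      ultimately show ?thesis by blast
    qed
    ultimately show "\<exists>l'. enat l = enat l' \<and> (\<exists>P :: nat \<Rightarrow> 'a set. (\<forall>i\<le>l'. primeideal (P i) A) \<and> (\<forall>i<l'. P i \<subset> P (Suc i)))"
      by blast
  qed
  then show ?thesis unfolding krull_dim_def by (rule Sup_subset_mono)
qed

lemma krull_dim_iso:
  assumes "h \<in> ring_iso A B" "cring A" "cring B"
  shows "krull_dim A = krull_dim B"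
proof (rule antisym)
  have "ring A" using assms(2) by (simp add: cring_def)
  then have g: "inv_into (carrier A) h \<in> ring_iso B A" by (rule ring_iso_set_sym[OF _ assms(1)])
  show "krull_dim A \<le> krull_dim B" by (rule krull_dim_le_iso[OF g assms(3,2)])
qed (rule krull_dim_le_iso[OF assms])

text \<open>If everything outside the kernel of a surjection onto a field is a unit, the kernel is
  the only maximal ideal and the residue field is a copy of that field; the degree over the p-th
  powers is transported along the isomorphism. This avoids computing in the quotient by
  \<open>max_ideal\<close>.\<close>

lemma alpha_local:
  fixes A :: "('a, 'm) ring_scheme" and K :: "('k, 'n) ring_scheme"
  assumes "cring A" "field K" "h \<in> ring_hom A K" "h ` carrier A = carrier K"
    and units: "\<And>a. a \<in> carrier A \<Longrightarrow> h a \<noteq> \<zero>\<^bsub>K\<^esub> \<Longrightarrow> a \<in> Units A"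
    and dim: "ring.dimension K s (pth_powers p K) (carrier K)" and sub: "subfield (pth_powers p K) K"
  shows "alpha p A = log (real p) (real s)"
proof -
  interpret A: cring A by fact
  interpret K: field K by fact
  interpret h: ring_hom_ring A K h
    using assms(3) by (simp add: ring_hom_ring_def ring_hom_ring_axioms_def A.ring_axioms K.ring_axioms)
  define M where "M = a_kernel A K h"
  have Mid: "ideal M A" unfolding M_def by (rule h.kernel_is_ideal)
  have Mmem: "x \<in> M \<longleftrightarrow> x \<in> carrier A \<and> h x = \<zero>\<^bsub>K\<^esub>" for x unfolding M_def a_kernel_def' by simp
  have ideal_sub: "J \<subseteq> M \<or> J = carrier A" if "ideal J A" for J
  proof (rule ccontr)
    interpret J: ideal J A by fact
    assume n: "\<not> ?thesis"
    then obtain x where x: "x \<in> J" "x \<notin> M" by auto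
    then have "x \<in> Units A" using units Mmem J.a_subset by auto
    then have "\<one>\<^bsub>A\<^esub> \<in> J" using x J.I_l_closed[of x "inv\<^bsub>A\<^esub> x"] by simp
    then show False using n J.one_imp_carrier by auto
  qed
  have ne: "carrier A \<noteq> M" using Mmem[of "\<one>\<^bsub>A\<^esub>"] K.one_not_zero by auto
  have Mmax: "maximalideal M A"
    using Mid ne ideal_sub by (intro maximalidealI) auto
  \<comment> \<open>\<open>max_ideal\<close> is a definite description, so uniqueness of the maximal
    ideal has to be shown as well.\<close>
  have "max_ideal A = M" unfolding max_ideal_def
  proof (rule the_equality)
    show "maximalideal M A" by (rule Mmax)
    fix N assume "maximalideal N A"
    then interpret N: maximalideal N A .
    have "N \<subseteq> M" using ideal_sub[OF N.is_ideal] N.I_notcarr by auto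
    then show "N = M" using N.I_maximal[OF Mid] ne ideal.axioms(1)[OF Mid] additive_subgroup.a_subset by blast
  qed
  then have rf: "residue_field A = A Quot M" by (simp add: residue_field_def)
  have "(\<lambda>Y. the_elem (h ` Y)) \<in> ring_iso (A Quot M) K"
    unfolding M_def by (rule h.FactRing_iso_set[OF assms(4)])
  then obtain g where g: "g \<in> ring_iso K (A Quot M)"
    using ring_iso_set_sym ideal.quotient_is_ring[OF Mid] by blast
  have kf: "field (A Quot M)" by (rule maximalideal.quotient_is_field[OF Mmax A.cring_axioms])
  interpret k: field "A Quot M" by (rule kf)
  interpret g: ring_hom_ring K "A Quot M" g
    using g by (simp add: ring_hom_ring_def ring_hom_ring_axioms_def ring_iso_def k.ring_axioms K.ring_axioms)
  have gb: "g ` carrier K = carrier (A Quot M)" "inj_on g (carrier K)" using g by (auto simp: ring_iso_def bij_betw_def)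
  have gp: "g ` pth_powers p K = pth_powers p (A Quot M)"
  proof -
    have "g (x [^]\<^bsub>K\<^esub> p) = g x [^]\<^bsub>(A Quot M)\<^esub> p" if "x \<in> carrier K" for x
      using that by (rule g.hom_nat_pow)
    then show ?thesis unfolding pth_powers_def gb(1)[symmetric] by (auto simp: image_image)
  qed
  have dim_k: "ring.dimension (A Quot M) s (pth_powers p (A Quot M)) (carrier (A Quot M))"
    using g.inj_hom_dimension[OF sub k.one_not_zero gb(2) dim] gp gb by simp
  have 2: "subfield (pth_powers p (A Quot M)) (A Quot M)"
    using g.img_is_subfield(2)[OF sub k.one_not_zero] gp by simp
  have "ring.dim (A Quot M) (pth_powers p (A Quot M)) (carrier (A Quot M)) = s"
    using k.dimI[OF 2 dim_k] by (simp add: over_def)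
  then show ?thesis by (simp add: alpha_def rf)
qed

text \<open>A splitting of \<open>F\<^sub>*\<^sup>e A\<close> by a free module, as a dual system of elements and \<open>A\<close>-linear functionals.\<close>

definition frob_dual :: "nat \<Rightarrow> ('a, 'm) ring_scheme \<Rightarrow> nat \<Rightarrow> bool" where
  "frob_dual q A r \<longleftrightarrow> (\<exists>y \<phi>. (\<forall>i<r. y i \<in> carrier A) \<and>
     (\<forall>i<r. \<forall>x\<in>carrier A. \<phi> i x \<in> carrier A) \<and>
     (\<forall>i<r. \<forall>x\<in>carrier A. \<forall>x'\<in>carrier A. \<phi> i (x \<oplus>\<^bsub>A\<^esub> x') = \<phi> i x \<oplus>\<^bsub>A\<^esub> \<phi> i x') \<and>
     (\<forall>i<r. \<forall>a\<in>carrier A. \<forall>x\<in>carrier A. \<phi> i (a [^]\<^bsub>A\<^esub> q \<otimes>\<^bsub>A\<^esub> x) = a \<otimes>\<^bsub>A\<^esub> \<phi> i x) \<and>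
     (\<forall>i<r. \<forall>j<r. \<phi> i (y j) = (if i = j then \<one>\<^bsub>A\<^esub> else \<zero>\<^bsub>A\<^esub>)))"

lemma frob_dualI:
  assumes "\<And>i. i < r \<Longrightarrow> y i \<in> carrier A"
    "\<And>i x. i < r \<Longrightarrow> x \<in> carrier A \<Longrightarrow> \<phi> i x \<in> carrier A"
    "\<And>i x x'. i < r \<Longrightarrow> x \<in> carrier A \<Longrightarrow> x' \<in> carrier A \<Longrightarrow> \<phi> i (x \<oplus>\<^bsub>A\<^esub> x') = \<phi> i x \<oplus>\<^bsub>A\<^esub> \<phi> i x'"
    "\<And>i a x. i < r \<Longrightarrow> a \<in> carrier A \<Longrightarrow> x \<in> carrier A \<Longrightarrow> \<phi> i (a [^]\<^bsub>A\<^esub> q \<otimes>\<^bsub>A\<^esub> x) = a \<otimes>\<^bsub>A\<^esub> \<phi> i x"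
    "\<And>i j. i < r \<Longrightarrow> j < r \<Longrightarrow> \<phi> i (y j) = (if i = j then \<one>\<^bsub>A\<^esub> else \<zero>\<^bsub>A\<^esub>)"
  shows "frob_dual q A r"
  unfolding frob_dual_def using assms by (intro exI[of _ y] exI[of _ \<phi>]) simp

lemma frob_dualE:
  assumes "frob_dual q A r"
  obtains y \<phi> where "\<And>i. i < r \<Longrightarrow> y i \<in> carrier A"
    "\<And>i x. i < r \<Longrightarrow> x \<in> carrier A \<Longrightarrow> \<phi> i x \<in> carrier A"
    "\<And>i x x'. i < r \<Longrightarrow> x \<in> carrier A \<Longrightarrow> x' \<in> carrier A \<Longrightarrow> \<phi> i (x \<oplus>\<^bsub>A\<^esub> x') = \<phi> i x \<oplus>\<^bsub>A\<^esub> \<phi> i x'"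
    "\<And>i a x. i < r \<Longrightarrow> a \<in> carrier A \<Longrightarrow> x \<in> carrier A \<Longrightarrow> \<phi> i (a [^]\<^bsub>A\<^esub> q \<otimes>\<^bsub>A\<^esub> x) = a \<otimes>\<^bsub>A\<^esub> \<phi> i x"
    "\<And>i j. i < r \<Longrightarrow> j < r \<Longrightarrow> \<phi> i (y j) = (if i = j then \<one>\<^bsub>A\<^esub> else \<zero>\<^bsub>A\<^esub>)"
proof -
  obtain y \<phi> where *: "\<forall>i<r. y i \<in> carrier A"
     "\<forall>i<r. \<forall>x\<in>carrier A. \<phi> i x \<in> carrier A"
     "\<forall>i<r. \<forall>x\<in>carrier A. \<forall>x'\<in>carrier A. \<phi> i (x \<oplus>\<^bsub>A\<^esub> x') = \<phi> i x \<oplus>\<^bsub>A\<^esub> \<phi> i x'"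
     "\<forall>i<r. \<forall>a\<in>carrier A. \<forall>x\<in>carrier A. \<phi> i (a [^]\<^bsub>A\<^esub> q \<otimes>\<^bsub>A\<^esub> x) = a \<otimes>\<^bsub>A\<^esub> \<phi> i x"
     "\<forall>i<r. \<forall>j<r. \<phi> i (y j) = (if i = j then \<one>\<^bsub>A\<^esub> else \<zero>\<^bsub>A\<^esub>)"
    using assms unfolding frob_dual_def by (elim exE conjE) (rule that)
  show thesis by (rule that[of y \<phi>]) (use * in simp_all)
qed

lemma frob_dual_iso:
  assumes "h \<in> ring_iso A B" "ring A" "ring B" "frob_dual q A r"
  shows "frob_dual q B r"
proof -
  interpret h: ring_hom_ring A B h
    using assms by (simp add: ring_hom_ring_def ring_hom_ring_axioms_def ring_iso_def)
  define g where "g = inv_into (carrier A) h"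
  have g: "g \<in> ring_iso B A" unfolding g_def by (rule ring_iso_set_sym[OF assms(2,1)])
  interpret g: ring_hom_ring B A g
    using g assms by (simp add: ring_hom_ring_def ring_hom_ring_axioms_def ring_iso_def)
  have bij: "bij_betw h (carrier A) (carrier B)" using assms(1) by (simp add: ring_iso_def)
  have hg: "h (g b) = b" if "b \<in> carrier B" for b
    using bij that by (simp add: g_def bij_betw_inv_into_right)
  have gh: "g (h a) = a" if "a \<in> carrier A" for a
    using bij that by (simp add: g_def bij_betw_inv_into_left)
  obtain y \<phi> where y: "\<And>i. i < r \<Longrightarrow> y i \<in> carrier A"
    and \<phi>: "\<And>i x. i < r \<Longrightarrow> x \<in> carrier A \<Longrightarrow> \<phi> i x \<in> carrier A"
    "\<And>i x x'. i < r \<Longrightarrow> x \<in> carrier A \<Longrightarrow> x' \<in> carrier A \<Longrightarrow> \<phi> i (x \<oplus>\<^bsub>A\<^esub> x') = \<phi> i x \<oplus>\<^bsub>A\<^esub> \<phi> i x'"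
    "\<And>i a x. i < r \<Longrightarrow> a \<in> carrier A \<Longrightarrow> x \<in> carrier A \<Longrightarrow> \<phi> i (a [^]\<^bsub>A\<^esub> q \<otimes>\<^bsub>A\<^esub> x) = a \<otimes>\<^bsub>A\<^esub> \<phi> i x"
    "\<And>i j. i < r \<Longrightarrow> j < r \<Longrightarrow> \<phi> i (y j) = (if i = j then \<one>\<^bsub>A\<^esub> else \<zero>\<^bsub>A\<^esub>)"
    using assms(4) by (rule frob_dualE) (rule that)
  show ?thesis
    by (rule frob_dualI[where y = "\<lambda>i. h (y i)" and \<phi> = "\<lambda>i b. h (\<phi> i (g b))"])
      (use y \<phi> hg gh in \<open>simp_all add: g.hom_nat_pow\<close>)
qed

section \<open>Free summands of the push-forward as dual systems\<close>

lemma finsum_pushforward [simp]: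
  "finsum (frobenius_pushforward p e A) = finsum A"
  by (simp add: finsum_def finprod_def frobenius_pushforward_def fun_eq_iff)

lemma submodule_pushforward_iff:
  "submodule H A (frobenius_pushforward p e A) \<longleftrightarrow> additive_subgroup H A \<and>
     (\<forall>a\<in>carrier A. \<forall>x\<in>H. a [^]\<^bsub>A\<^esub> (p ^ e) \<otimes>\<^bsub>A\<^esub> x \<in> H)"
  by (simp add: submodule_def submodule_axioms_def frobenius_pushforward_def additive_subgroup_def
      subgroup_def m_inv_def Ball_def)

lemma ex1_implies_unique: "\<exists>!x. P x \<Longrightarrow> P a \<Longrightarrow> P b \<Longrightarrow> a = b"
  by auto

text \<open>From a decomposition into F and N one reads off the coordinates of the F-part; from a
  dual system one takes the span of the elements and the common kernel of the functionals.
  Additivity of the q-th power makes \<open>lin\<close> additive in its coefficients. Both rank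
  bounds use the form on the right.\<close>

lemma has_free_summand_pushforward:
  assumes "cring A" and frob: "\<And>a b. a \<in> carrier A \<Longrightarrow> b \<in> carrier A \<Longrightarrow>
      (a \<oplus>\<^bsub>A\<^esub> b) [^]\<^bsub>A\<^esub> (p ^ e) = a [^]\<^bsub>A\<^esub> (p ^ e) \<oplus>\<^bsub>A\<^esub> b [^]\<^bsub>A\<^esub> (p ^ e)" and q0: "p > 0"
  shows "has_free_summand A (frobenius_pushforward p e A) r \<longleftrightarrow> frob_dual (p ^ e) A r"
proof
  interpret cring A by fact
  let ?M = "frobenius_pushforward p e A"
  let ?q = "p ^ e"
  have M: "carrier ?M = carrier A" "\<zero>\<^bsub>?M\<^esub> = \<zero>\<^bsub>A\<^esub>" "\<And>c x. c \<odot>\<^bsub>?M\<^esub> x = c [^]\<^bsub>A\<^esub> ?q \<otimes>\<^bsub>A\<^esub> x"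
    "\<And>F N. F <+>\<^bsub>?M\<^esub> N = F <+>\<^bsub>A\<^esub> N"
    by (simp_all add: frobenius_pushforward_def set_add_def set_mult_def)
  have q0': "\<zero>\<^bsub>A\<^esub> [^]\<^bsub>A\<^esub> ?q = \<zero>\<^bsub>A\<^esub>" using q0 by (simp add: nat_pow_zero)
  {
    assume "has_free_summand A ?M r"
    then obtain F N where FN': "free_submodule_of_rank A ?M F r" "submodule N A ?M"
      and FN: "F \<inter> N = {\<zero>\<^bsub>A\<^esub>}" "F <+>\<^bsub>A\<^esub> N = carrier A"
      unfolding has_free_summand_def M by blast
    obtain b where F': "submodule F A ?M" and b: "b \<in> {..<r} \<rightarrow> F"
      and uniq': "\<forall>x\<in>F. \<exists>!c. c \<in> {..<r} \<rightarrow>\<^sub>E carrier A \<and> x = finsum A (\<lambda>i. c i [^]\<^bsub>A\<^esub> ?q \<otimes>\<^bsub>A\<^esub> b i) {..<r}"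
      using FN'(1) unfolding free_submodule_of_rank_def M finsum_pushforward by (elim conjE exE) (rule that)
    note uniq = bspec[OF uniq']
    have F: "additive_subgroup F A" "\<And>a x. a \<in> carrier A \<Longrightarrow> x \<in> F \<Longrightarrow> a [^]\<^bsub>A\<^esub> ?q \<otimes>\<^bsub>A\<^esub> x \<in> F"
      using F' unfolding submodule_pushforward_iff by auto
    have N: "additive_subgroup N A" "\<And>a x. a \<in> carrier A \<Longrightarrow> x \<in> N \<Longrightarrow> a [^]\<^bsub>A\<^esub> ?q \<otimes>\<^bsub>A\<^esub> x \<in> N"
      using FN'(2) unfolding submodule_pushforward_iff by auto
    interpret F: additive_subgroup F A by (rule F)
    interpret N: additive_subgroup N A by (rule N)
    have Fc: "x \<in> carrier A" if "x \<in> F" for x using that F.a_subset by auto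
    have Nc: "x \<in> carrier A" if "x \<in> N" for x using that N.a_subset by auto
    have bF: "b i \<in> F" if "i < r" for i using b that by auto
    have bc: "b i \<in> carrier A" if "i < r" for i using bF Fc that by auto
    define lin where "lin = (\<lambda>c. finsum A (\<lambda>i. c i [^]\<^bsub>A\<^esub> ?q \<otimes>\<^bsub>A\<^esub> b i) {..<r})"
    have lin_eq: "finsum A (\<lambda>i. c i [^]\<^bsub>A\<^esub> ?q \<otimes>\<^bsub>A\<^esub> b i) {..<r} = lin c" for c
      by (simp add: lin_def)
    have linc: "lin c \<in> carrier A" if "c \<in> {..<r} \<rightarrow> carrier A" for c
      unfolding lin_def using that bc by (intro finsum_closed) auto
    have decomp: "\<exists>c n. c \<in> {..<r} \<rightarrow>\<^sub>E carrier A \<and> n \<in> N \<and> x = lin c \<oplus>\<^bsub>A\<^esub> n" if x: "x \<in> carrier A" for x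
    proof -
      obtain f n where fn: "f \<in> F" "n \<in> N" "x = f \<oplus>\<^bsub>A\<^esub> n"
      proof -
        have "x \<in> F <+>\<^bsub>A\<^esub> N" using x FN(2) by simp
        then show thesis using that unfolding set_add_defs by auto
      qed
      then show ?thesis using uniq[OF fn(1), unfolded lin_eq] by blast
    qed
    have linF: "lin c \<in> F" if "c \<in> {..<r} \<rightarrow> carrier A" for c
    proof -
      have "finsum A (\<lambda>i. c i [^]\<^bsub>A\<^esub> ?q \<otimes>\<^bsub>A\<^esub> b i) X' \<in> F" if "X' \<subseteq> {..<r}" for X'
      proof -
        have "finite X'" using that finite_subset by blast
        then show ?thesis using that
        proof (induction X' rule: finite_induct)
          case (insert i X')
          have ci: "c i [^]\<^bsub>A\<^esub> ?q \<otimes>\<^bsub>A\<^esub> b i \<in> F"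
            using insert.prems \<open>c \<in> _\<close> F(2) bF by (auto simp: Pi_iff subset_iff)
          have cc: "(\<lambda>i. c i [^]\<^bsub>A\<^esub> ?q \<otimes>\<^bsub>A\<^esub> b i) \<in> X' \<rightarrow> carrier A"
            using insert.prems \<open>c \<in> _\<close> bc by (auto simp: Pi_iff subset_iff)
          show ?case using insert ci cc Fc[OF ci] by (subst finsum_insert) (auto intro: F.a_closed)
        qed (simp add: F.zero_closed)
      qed
      then show ?thesis unfolding lin_def by blast
    qed
    \<comment> \<open>F and N meet in zero, so equal sums have equal F-parts, and the basis property
      identifies the coefficients.\<close>
    have lin_inj: "c i = c' i" if "c \<in> {..<r} \<rightarrow> carrier A" "c' \<in> {..<r} \<rightarrow> carrier A" "n \<in> N" "n' \<in> N"
      "lin c \<oplus>\<^bsub>A\<^esub> n = lin c' \<oplus>\<^bsub>A\<^esub> n'" "i < r" for c c' n n' i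
    proof -
      have cl: "lin c \<in> carrier A" "lin c' \<in> carrier A" "n \<in> carrier A" "n' \<in> carrier A"
        using that linc Nc by auto
      have "lin c \<ominus>\<^bsub>A\<^esub> lin c' = n' \<ominus>\<^bsub>A\<^esub> n"
      proof -
        have "lin c \<ominus>\<^bsub>A\<^esub> lin c' = (lin c \<oplus>\<^bsub>A\<^esub> n) \<ominus>\<^bsub>A\<^esub> n \<ominus>\<^bsub>A\<^esub> lin c'"
          using cl by (simp add: a_minus_def a_assoc r_neg)
        also have "\<dots> = (lin c' \<oplus>\<^bsub>A\<^esub> n') \<ominus>\<^bsub>A\<^esub> n \<ominus>\<^bsub>A\<^esub> lin c'" using that(5) by simp
        also have "\<dots> = n' \<ominus>\<^bsub>A\<^esub> n" using cl a_lcomm[of "lin c'" "\<ominus>\<^bsub>A\<^esub> n" "\<ominus>\<^bsub>A\<^esub> lin c'"]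
          by (simp add: a_minus_def a_ac r_neg r_neg1 r_neg2)
        finally show ?thesis .
      qed
      moreover have "lin c \<ominus>\<^bsub>A\<^esub> lin c' \<in> F" using linF that by (simp add: a_minus_def F.a_closed F.a_inv_closed)
      moreover have "n' \<ominus>\<^bsub>A\<^esub> n \<in> N" using that by (simp add: a_minus_def N.a_closed N.a_inv_closed)
      ultimately have "lin c \<ominus>\<^bsub>A\<^esub> lin c' = \<zero>\<^bsub>A\<^esub>" using FN(1) by auto
      then have eq: "lin c = lin c'" using cl by simp
      \<comment> \<open>Uniqueness of coefficients holds among functions that are
        \<open>undefined\<close> outside \<open>{..<r}\<close>, so both candidates are restricted
        first.\<close>
      have res: "lin (restrict k {..<r}) = lin k" if "k \<in> {..<r} \<rightarrow> carrier A" for k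
        unfolding lin_def using that bc by (intro finsum_cong') auto
      have "restrict c {..<r} = restrict c' {..<r}"
      proof -
        have 1: "restrict c {..<r} \<in> {..<r} \<rightarrow>\<^sub>E carrier A \<and> lin c = lin (restrict c {..<r})"
          using res[OF that(1)] that(1) by auto
        have 2: "restrict c' {..<r} \<in> {..<r} \<rightarrow>\<^sub>E carrier A \<and> lin c = lin (restrict c' {..<r})"
          using res[OF that(2)] that(2) eq by auto
        show ?thesis by (rule ex1_implies_unique[where P = "\<lambda>k. k \<in> {..<r} \<rightarrow>\<^sub>E carrier A \<and> lin c = lin k"])
            (fact uniq[OF linF[OF that(1)], unfolded lin_eq] 1 2)+
      qed
      then show ?thesis using \<open>i < r\<close> by (metis lessThan_iff restrict_apply')
    qed
    \<comment> \<open>\<open>cf x i\<close> is the i-th coordinate of the F-part of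
      \<open>x\<close>; these coordinates are the functionals sought.\<close>
    obtain cf nf where cf: "\<And>x. x \<in> carrier A \<Longrightarrow> cf x \<in> {..<r} \<rightarrow>\<^sub>E carrier A"
      and nf: "\<And>x. x \<in> carrier A \<Longrightarrow> nf x \<in> N" and xeq: "\<And>x. x \<in> carrier A \<Longrightarrow> x = lin (cf x) \<oplus>\<^bsub>A\<^esub> nf x"
      using decomp by metis
    have cfc: "cf x \<in> {..<r} \<rightarrow> carrier A" if "x \<in> carrier A" for x using cf[OF that] by auto
    have cfcc: "cf x i \<in> carrier A" if "x \<in> carrier A" "i < r" for x i using cfc[OF that(1)] that(2) by auto
    show "frob_dual ?q A r"
    proof (rule frob_dualI[where y = b and \<phi> = "\<lambda>i x. cf x i"])
      fix i x x' assume i: "i < r" and x: "x \<in> carrier A" "x' \<in> carrier A"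
      have "lin (\<lambda>i. cf x i \<oplus>\<^bsub>A\<^esub> cf x' i) = finsum A (\<lambda>i. cf x i [^]\<^bsub>A\<^esub> ?q \<otimes>\<^bsub>A\<^esub> b i \<oplus>\<^bsub>A\<^esub> cf x' i [^]\<^bsub>A\<^esub> ?q \<otimes>\<^bsub>A\<^esub> b i) {..<r}"
        unfolding lin_def using x cfcc bc by (intro finsum_cong') (auto simp: frob l_distr)
      also have "\<dots> = lin (cf x) \<oplus>\<^bsub>A\<^esub> lin (cf x')"
        unfolding lin_def using x cfcc bc by (intro finsum_addf) auto
      finally have l: "lin (\<lambda>i. cf x i \<oplus>\<^bsub>A\<^esub> cf x' i) = lin (cf x) \<oplus>\<^bsub>A\<^esub> lin (cf x')" .
      have "lin (cf (x \<oplus>\<^bsub>A\<^esub> x')) \<oplus>\<^bsub>A\<^esub> nf (x \<oplus>\<^bsub>A\<^esub> x') = x \<oplus>\<^bsub>A\<^esub> x'" using xeq x by simp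
      also have "\<dots> = (lin (cf x) \<oplus>\<^bsub>A\<^esub> nf x) \<oplus>\<^bsub>A\<^esub> (lin (cf x') \<oplus>\<^bsub>A\<^esub> nf x')" using xeq x by simp
      also have "\<dots> = lin (\<lambda>i. cf x i \<oplus>\<^bsub>A\<^esub> cf x' i) \<oplus>\<^bsub>A\<^esub> (nf x \<oplus>\<^bsub>A\<^esub> nf x')"
        unfolding l using linc[OF cfc] nf Nc x by (simp add: a_ac)
      finally show "cf (x \<oplus>\<^bsub>A\<^esub> x') i = cf x i \<oplus>\<^bsub>A\<^esub> cf x' i"
        using x i cfc cfcc nf by (intro lin_inj[of _ "\<lambda>i. cf x i \<oplus>\<^bsub>A\<^esub> cf x' i"]) (auto intro: N.a_closed)
    next
      fix i a x assume i: "i < r" and x: "a \<in> carrier A" "x \<in> carrier A"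
      let ?a = "a [^]\<^bsub>A\<^esub> ?q"
      have "lin (\<lambda>i. a \<otimes>\<^bsub>A\<^esub> cf x i) = finsum A (\<lambda>i. ?a \<otimes>\<^bsub>A\<^esub> (cf x i [^]\<^bsub>A\<^esub> ?q \<otimes>\<^bsub>A\<^esub> b i)) {..<r}"
        unfolding lin_def using x cfcc bc by (intro finsum_cong') (auto simp: nat_pow_distrib m_assoc)
      also have "\<dots> = ?a \<otimes>\<^bsub>A\<^esub> lin (cf x)"
        unfolding lin_def using x cfcc bc by (intro finsum_rdistr[symmetric]) auto
      finally have l: "lin (\<lambda>i. a \<otimes>\<^bsub>A\<^esub> cf x i) = ?a \<otimes>\<^bsub>A\<^esub> lin (cf x)" .
      have "lin (cf (?a \<otimes>\<^bsub>A\<^esub> x)) \<oplus>\<^bsub>A\<^esub> nf (?a \<otimes>\<^bsub>A\<^esub> x) = ?a \<otimes>\<^bsub>A\<^esub> x" using xeq x by simp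
      also have "\<dots> = ?a \<otimes>\<^bsub>A\<^esub> (lin (cf x) \<oplus>\<^bsub>A\<^esub> nf x)" using xeq x by simp
      also have "\<dots> = lin (\<lambda>i. a \<otimes>\<^bsub>A\<^esub> cf x i) \<oplus>\<^bsub>A\<^esub> ?a \<otimes>\<^bsub>A\<^esub> nf x"
        unfolding l using linc[OF cfc] nf Nc x by (simp add: r_distr)
      finally show "cf (?a \<otimes>\<^bsub>A\<^esub> x) i = a \<otimes>\<^bsub>A\<^esub> cf x i"
        using x i cfc cfcc nf N(2) by (intro lin_inj[of _ "\<lambda>i. a \<otimes>\<^bsub>A\<^esub> cf x i"]) auto
    next
      fix i j assume ij: "i < r" "j < r"
      let ?d = "\<lambda>i. if i = j then \<one>\<^bsub>A\<^esub> else \<zero>\<^bsub>A\<^esub>"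
      have "lin ?d = ?d j [^]\<^bsub>A\<^esub> ?q \<otimes>\<^bsub>A\<^esub> b j"
        unfolding lin_def using ij bc q0' by (intro finsum_only) auto
      then have "lin (cf (b j)) \<oplus>\<^bsub>A\<^esub> nf (b j) = lin ?d \<oplus>\<^bsub>A\<^esub> \<zero>\<^bsub>A\<^esub>" using xeq bc ij by simp
      then show "cf (b j) i = (if i = j then \<one>\<^bsub>A\<^esub> else \<zero>\<^bsub>A\<^esub>)"
        using lin_inj[of "cf (b j)" ?d "nf (b j)" "\<zero>\<^bsub>A\<^esub>" i] cfc[OF bc[OF ij(2)]] nf[OF bc[OF ij(2)]] ij N.zero_closed by auto
    qed (use bc cfcc in auto)
  }
  {
    assume "frob_dual ?q A r"
    then obtain y \<phi> where y: "\<And>i. i < r \<Longrightarrow> y i \<in> carrier A"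
      and \<phi>: "\<And>i x. i < r \<Longrightarrow> x \<in> carrier A \<Longrightarrow> \<phi> i x \<in> carrier A"
      "\<And>i x x'. i < r \<Longrightarrow> x \<in> carrier A \<Longrightarrow> x' \<in> carrier A \<Longrightarrow> \<phi> i (x \<oplus>\<^bsub>A\<^esub> x') = \<phi> i x \<oplus>\<^bsub>A\<^esub> \<phi> i x'"
      "\<And>i a x. i < r \<Longrightarrow> a \<in> carrier A \<Longrightarrow> x \<in> carrier A \<Longrightarrow> \<phi> i (a [^]\<^bsub>A\<^esub> ?q \<otimes>\<^bsub>A\<^esub> x) = a \<otimes>\<^bsub>A\<^esub> \<phi> i x"
      "\<And>i j. i < r \<Longrightarrow> j < r \<Longrightarrow> \<phi> i (y j) = (if i = j then \<one>\<^bsub>A\<^esub> else \<zero>\<^bsub>A\<^esub>)"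
      by (rule frob_dualE) (rule that)
    define lin where "lin = (\<lambda>c. finsum A (\<lambda>i. c i [^]\<^bsub>A\<^esub> ?q \<otimes>\<^bsub>A\<^esub> y i) {..<r})"
    define F where "F = lin ` ({..<r} \<rightarrow> carrier A)"
    define N where "N = {x \<in> carrier A. \<forall>i<r. \<phi> i x = \<zero>\<^bsub>A\<^esub>}"
    have lin_eq: "finsum A (\<lambda>i. c i [^]\<^bsub>A\<^esub> ?q \<otimes>\<^bsub>A\<^esub> y i) {..<r} = lin c" for c
      by (simp add: lin_def)
    have linc: "lin c \<in> carrier A" if "c \<in> {..<r} \<rightarrow> carrier A" for c
      unfolding lin_def using that y by (intro finsum_closed) auto
    have \<phi>0: "\<phi> i \<zero>\<^bsub>A\<^esub> = \<zero>\<^bsub>A\<^esub>" if "i < r" for i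
      using \<phi>(3)[OF that, of "\<zero>\<^bsub>A\<^esub>" "\<zero>\<^bsub>A\<^esub>"] \<phi>(1)[OF that] q0' by simp
    have \<phi>sum: "\<phi> i (finsum A g X') = finsum A (\<lambda>j. \<phi> i (g j)) X'"
      if "i < r" "finite X'" "g \<in> X' \<rightarrow> carrier A" for i g and X' :: "nat set"
      using that(2,3)
    proof (induction X' rule: finite_induct)
      case (insert j X')
      then show ?case using \<phi>(1,2)[OF that(1)] by (subst (1 2) finsum_insert) (auto simp: Pi_iff intro!: \<phi>(2)[OF that(1)])
    qed (simp add: \<phi>0 that)
    have \<phi>lin: "\<phi> i (lin c) = c i" if i: "i < r" and c: "c \<in> {..<r} \<rightarrow> carrier A" for i c
    proof -
      have ci: "c i \<in> carrier A" using c i by auto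
      have "\<phi> i (lin c) = finsum A (\<lambda>j. \<phi> i (c j [^]\<^bsub>A\<^esub> ?q \<otimes>\<^bsub>A\<^esub> y j)) {..<r}"
        unfolding lin_def using i c y by (intro \<phi>sum) auto
      also have "\<dots> = \<phi> i (c i [^]\<^bsub>A\<^esub> ?q \<otimes>\<^bsub>A\<^esub> y i)"
      proof (rule finsum_only)
        fix j assume j: "j \<in> {..<r}" "j \<noteq> i"
        then have "c j \<in> carrier A" using c by auto
        then show "\<phi> i (c j [^]\<^bsub>A\<^esub> ?q \<otimes>\<^bsub>A\<^esub> y j) = \<zero>\<^bsub>A\<^esub>" using i j y \<phi>(3,4) by simp
      qed (use i ci y \<phi>(1) in auto)
      also have "\<dots> = c i" using i ci y \<phi>(3,4) by simp
      finally show ?thesis .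
    qed
    have lin_add: "lin c \<oplus>\<^bsub>A\<^esub> lin c' = lin (\<lambda>i. c i \<oplus>\<^bsub>A\<^esub> c' i)"
      if "c \<in> {..<r} \<rightarrow> carrier A" "c' \<in> {..<r} \<rightarrow> carrier A" for c c'
    proof -
      have "lin (\<lambda>i. c i \<oplus>\<^bsub>A\<^esub> c' i) = finsum A (\<lambda>i. c i [^]\<^bsub>A\<^esub> ?q \<otimes>\<^bsub>A\<^esub> y i \<oplus>\<^bsub>A\<^esub> c' i [^]\<^bsub>A\<^esub> ?q \<otimes>\<^bsub>A\<^esub> y i) {..<r}"
        unfolding lin_def using that y by (intro finsum_cong') (auto simp: frob l_distr Pi_iff)
      also have "\<dots> = lin c \<oplus>\<^bsub>A\<^esub> lin c'"
        unfolding lin_def using that y by (intro finsum_addf) auto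
      finally show ?thesis by simp
    qed
    have lin_smult: "a [^]\<^bsub>A\<^esub> ?q \<otimes>\<^bsub>A\<^esub> lin c = lin (\<lambda>i. a \<otimes>\<^bsub>A\<^esub> c i)"
      if "c \<in> {..<r} \<rightarrow> carrier A" "a \<in> carrier A" for a c
    proof -
      have "a [^]\<^bsub>A\<^esub> ?q \<otimes>\<^bsub>A\<^esub> lin c = finsum A (\<lambda>i. a [^]\<^bsub>A\<^esub> ?q \<otimes>\<^bsub>A\<^esub> (c i [^]\<^bsub>A\<^esub> ?q \<otimes>\<^bsub>A\<^esub> y i)) {..<r}"
        unfolding lin_def using that y by (intro finsum_rdistr) auto
      also have "\<dots> = lin (\<lambda>i. a \<otimes>\<^bsub>A\<^esub> c i)"
        unfolding lin_def using that y by (intro finsum_cong') (auto simp: nat_pow_distrib m_assoc Pi_iff)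
      finally show ?thesis .
    qed
    have lin0: "lin (\<lambda>_. \<zero>\<^bsub>A\<^esub>) = \<zero>\<^bsub>A\<^esub>"
      unfolding lin_def using y q0' by (intro finsum_all_zero) auto
    have Fsub: "additive_subgroup F A"
    proof (intro additive_subgroupI add.subgroupI)
      show "F \<subseteq> carrier A" using linc by (auto simp: F_def)
      show "F \<noteq> {}" by (auto simp: F_def)
      fix a assume "a \<in> F"
      then obtain c where c: "c \<in> {..<r} \<rightarrow> carrier A" "a = lin c" by (auto simp: F_def)
      have c': "(\<lambda>i. \<ominus>\<^bsub>A\<^esub> c i) \<in> {..<r} \<rightarrow> carrier A" using c by auto
      have "lin (\<lambda>i. \<ominus>\<^bsub>A\<^esub> c i) \<oplus>\<^bsub>A\<^esub> a = lin (\<lambda>i. \<ominus>\<^bsub>A\<^esub> c i \<oplus>\<^bsub>A\<^esub> c i)"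
        unfolding c(2) by (rule lin_add[OF c' c(1)])
      also have "\<dots> = lin (\<lambda>_. \<zero>\<^bsub>A\<^esub>)"
        unfolding lin_def using c y by (intro finsum_cong') (auto simp: l_neg Pi_iff)
      finally have "\<ominus>\<^bsub>A\<^esub> a = lin (\<lambda>i. \<ominus>\<^bsub>A\<^esub> c i)"
        using lin0 linc[OF c'] linc[OF c(1)] c(2) by (intro minus_equality) auto
      then show "\<ominus>\<^bsub>A\<^esub> a \<in> F" using c' by (auto simp: F_def)
    next
      fix a b assume "a \<in> F" "b \<in> F"
      then obtain c c' where "c \<in> {..<r} \<rightarrow> carrier A" "a = lin c" "c' \<in> {..<r} \<rightarrow> carrier A" "b = lin c'"
        by (auto simp: F_def)
      then show "a \<oplus>\<^bsub>A\<^esub> b \<in> F" using lin_add[of c c'] by (auto simp: F_def)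
    qed
    have \<phi>neg: "\<phi> i (\<ominus>\<^bsub>A\<^esub> x) = \<ominus>\<^bsub>A\<^esub> \<phi> i x" if "i < r" "x \<in> carrier A" for i x
      using \<phi>(2)[OF that(1), of "\<ominus>\<^bsub>A\<^esub> x" x] \<phi>(1)[OF that(1)] that \<phi>0
      by (intro minus_equality[symmetric]) (auto simp: l_neg)
    have mz: "\<ominus>\<^bsub>A\<^esub> \<zero>\<^bsub>A\<^esub> = \<zero>\<^bsub>A\<^esub>" by (rule minus_equality) auto
    have Nsub: "additive_subgroup N A"
    proof (intro additive_subgroupI add.subgroupI)
      show "N \<noteq> {}" using \<phi>0 by (auto simp: N_def)
    qed (use \<phi>(2) \<phi>neg mz in \<open>auto simp: N_def\<close>)
    have sF: "submodule F A ?M" unfolding submodule_pushforward_iff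
    proof (intro conjI ballI Fsub)
      fix a x assume "a \<in> carrier A" "x \<in> F"
      then obtain c where c: "c \<in> {..<r} \<rightarrow> carrier A" "x = lin c" by (auto simp: F_def)
      have "(\<lambda>i. a \<otimes>\<^bsub>A\<^esub> c i) \<in> {..<r} \<rightarrow> carrier A" using c \<open>a \<in> _\<close> by auto
      then show "a [^]\<^bsub>A\<^esub> ?q \<otimes>\<^bsub>A\<^esub> x \<in> F"
        unfolding c(2) lin_smult[OF c(1) \<open>a \<in> _\<close>] F_def by blast
    qed
    have sN: "submodule N A ?M" unfolding submodule_pushforward_iff
      using Nsub \<phi>(3) by (auto simp: N_def)
    have free: "free_submodule_of_rank A ?M F r"
      unfolding free_submodule_of_rank_def M finsum_pushforward
    proof (intro conjI sF exI[of _ y] ballI)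
      show "y \<in> {..<r} \<rightarrow> F"
      proof
        fix j assume j: "j \<in> {..<r}"
        let ?d = "\<lambda>i. if i = j then \<one>\<^bsub>A\<^esub> else \<zero>\<^bsub>A\<^esub>"
        have "lin ?d = ?d j [^]\<^bsub>A\<^esub> ?q \<otimes>\<^bsub>A\<^esub> y j"
          unfolding lin_def using j y q0' by (intro finsum_only) auto
        then have "y j = lin ?d" using y j by simp
        then show "y j \<in> F" unfolding F_def by (intro image_eqI) auto
      qed
      fix x assume "x \<in> F"
      then obtain c where c: "c \<in> {..<r} \<rightarrow> carrier A" "x = lin c" by (auto simp: F_def)
      let ?c = "restrict c {..<r}"
      have c': "?c \<in> {..<r} \<rightarrow>\<^sub>E carrier A" using c(1) by (simp add: restrict_PiE_iff Pi_iff)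
      have xc: "x = lin ?c" unfolding c(2) lin_def using c(1) y by (intro finsum_cong') (auto simp: Pi_iff)
      show "\<exists>!c. c \<in> {..<r} \<rightarrow>\<^sub>E carrier A \<and> x = finsum A (\<lambda>i. c i [^]\<^bsub>A\<^esub> ?q \<otimes>\<^bsub>A\<^esub> y i) {..<r}"
        unfolding lin_eq
      proof (rule ex1I[of _ ?c])
        show "?c \<in> {..<r} \<rightarrow>\<^sub>E carrier A \<and> x = lin ?c" using c' xc by simp
        fix k assume k: "k \<in> {..<r} \<rightarrow>\<^sub>E carrier A \<and> x = lin k"
        have "k i = ?c i" if "i < r" for i
          using \<phi>lin[OF that, of k] \<phi>lin[OF that, of ?c] k xc c' by (metis PiE_iff Pi_iff)
        then show "k = ?c" by (intro PiE_ext[OF conjunct1[OF k] c']) (simp only: lessThan_iff)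
      qed
    qed
    have int: "F \<inter> N = {\<zero>\<^bsub>A\<^esub>}"
    proof
      show "{\<zero>\<^bsub>A\<^esub>} \<subseteq> F \<inter> N" using Fsub Nsub by (simp add: additive_subgroup.zero_closed)
      show "F \<inter> N \<subseteq> {\<zero>\<^bsub>A\<^esub>}"
      proof
        fix x assume x: "x \<in> F \<inter> N"
        then obtain c where c: "c \<in> {..<r} \<rightarrow> carrier A" "x = lin c" by (auto simp: F_def)
        have "c i = \<zero>\<^bsub>A\<^esub>" if "i < r" for i using x \<phi>lin[OF that c(1)] c(2) that by (auto simp: N_def)
        then have "lin c = \<zero>\<^bsub>A\<^esub>" unfolding lin_def using y q0' by (intro finsum_all_zero) auto
        then show "x \<in> {\<zero>\<^bsub>A\<^esub>}" using c by simp
      qed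
    qed
    have sum: "F <+>\<^bsub>A\<^esub> N = carrier A"
    proof
      show "F <+>\<^bsub>A\<^esub> N \<subseteq> carrier A" using linc by (auto simp: set_add_defs F_def N_def)
      show "carrier A \<subseteq> F <+>\<^bsub>A\<^esub> N"
      proof
        fix x assume x: "x \<in> carrier A"
        let ?c = "\<lambda>i. \<phi> i x"
        have c: "?c \<in> {..<r} \<rightarrow> carrier A" using \<phi>(1) x by auto
        have "x \<ominus>\<^bsub>A\<^esub> lin ?c \<in> N"
          using x linc[OF c] \<phi>(1,2) \<phi>neg \<phi>lin[OF _ c] by (auto simp: N_def a_minus_def r_neg)
        moreover have "x = lin ?c \<oplus>\<^bsub>A\<^esub> (x \<ominus>\<^bsub>A\<^esub> lin ?c)"
          using x linc[OF c] by (simp add: a_minus_def a_ac r_neg r_neg1 r_neg2)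
        moreover have "lin ?c \<in> F" using c by (auto simp: F_def)
        ultimately show "x \<in> F <+>\<^bsub>A\<^esub> N" unfolding set_add_defs by auto
      qed
    qed
    show "has_free_summand A ?M r"
      unfolding has_free_summand_def M using free sN int sum by blast
  }
qed


section \<open>Quadratic extensions\<close>

text \<open>\<open>S[z]/(z\<^sup>2 - c)\<close>, with \<open>g + h z\<close> represented by the pair \<open>(g, h)\<close>.\<close>

definition quad_ring :: "('a, 'm) ring_scheme \<Rightarrow> 'a \<Rightarrow> ('a \<times> 'a) ring" where
  "quad_ring S c = \<lparr>carrier = carrier S \<times> carrier S,
     monoid.mult = (\<lambda>(a, b) (a', b'). (a \<otimes>\<^bsub>S\<^esub> a' \<oplus>\<^bsub>S\<^esub> c \<otimes>\<^bsub>S\<^esub> (b \<otimes>\<^bsub>S\<^esub> b'), a \<otimes>\<^bsub>S\<^esub> b' \<oplus>\<^bsub>S\<^esub> b \<otimes>\<^bsub>S\<^esub> a')),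
     one = (\<one>\<^bsub>S\<^esub>, \<zero>\<^bsub>S\<^esub>), ring.zero = (\<zero>\<^bsub>S\<^esub>, \<zero>\<^bsub>S\<^esub>),
     add = (\<lambda>(a, b) (a', b'). (a \<oplus>\<^bsub>S\<^esub> a', b \<oplus>\<^bsub>S\<^esub> b'))\<rparr>"

lemma quad_simps [simp]:
  "carrier (quad_ring S c) = carrier S \<times> carrier S"
  "(a, b) \<otimes>\<^bsub>quad_ring S c\<^esub> (a', b') = (a \<otimes>\<^bsub>S\<^esub> a' \<oplus>\<^bsub>S\<^esub> c \<otimes>\<^bsub>S\<^esub> (b \<otimes>\<^bsub>S\<^esub> b'), a \<otimes>\<^bsub>S\<^esub> b' \<oplus>\<^bsub>S\<^esub> b \<otimes>\<^bsub>S\<^esub> a')"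
  "\<one>\<^bsub>quad_ring S c\<^esub> = (\<one>\<^bsub>S\<^esub>, \<zero>\<^bsub>S\<^esub>)" "\<zero>\<^bsub>quad_ring S c\<^esub> = (\<zero>\<^bsub>S\<^esub>, \<zero>\<^bsub>S\<^esub>)"
  "(a, b) \<oplus>\<^bsub>quad_ring S c\<^esub> (a', b') = (a \<oplus>\<^bsub>S\<^esub> a', b \<oplus>\<^bsub>S\<^esub> b')"
  by (simp_all add: quad_ring_def)

section \<open>Arithmetic of the quadratic ring and its identification with the quotient\<close>

context cring
begin

lemma quad_cring:
  assumes c: "c \<in> carrier R"
  shows "cring (quad_ring R c)"
proof (rule cringI)
  show "abelian_group (quad_ring R c)"
  proof (rule abelian_groupI)
    fix x assume "x \<in> carrier (quad_ring R c)"
    then show "\<exists>y\<in>carrier (quad_ring R c). y \<oplus>\<^bsub>quad_ring R c\<^esub> x = \<zero>\<^bsub>quad_ring R c\<^esub>"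
      by (intro bexI[of _ "(\<ominus> fst x, \<ominus> snd x)"]) (auto simp: l_neg)
  qed (auto simp: a_ac)
  show "Group.comm_monoid (quad_ring R c)"
    by (rule Group.comm_monoidI) (use c in \<open>auto simp: l_distr r_distr m_ac a_ac\<close>)
  fix x y z assume "x \<in> carrier (quad_ring R c)" "y \<in> carrier (quad_ring R c)" "z \<in> carrier (quad_ring R c)"
  then show "(x \<oplus>\<^bsub>quad_ring R c\<^esub> y) \<otimes>\<^bsub>quad_ring R c\<^esub> z = x \<otimes>\<^bsub>quad_ring R c\<^esub> z \<oplus>\<^bsub>quad_ring R c\<^esub> y \<otimes>\<^bsub>quad_ring R c\<^esub> z"
    using c by (auto simp: l_distr r_distr a_ac)
qed

lemma quad_embed_hom:
  assumes "c \<in> carrier R"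
  shows "(\<lambda>a. (a, \<zero>)) \<in> ring_hom R (quad_ring R c)"
  using assms by (intro ring_hom_memI) auto

lemma quad_pow_embed:
  assumes "c \<in> carrier R" "a \<in> carrier R"
  shows "(a, \<zero>) [^]\<^bsub>quad_ring R c\<^esub> (k::nat) = (a [^] k, \<zero>)"
proof (induction k)
  case (Suc k)
  then show ?case using assms by simp
qed simp

lemma quad_pow_z:
  assumes "c \<in> carrier R"
  shows "(\<zero>, \<one>) [^]\<^bsub>quad_ring R c\<^esub> (2 * k + 1 :: nat) = (\<zero>, c [^] k)"
proof (induction k)
  case (Suc k)
  interpret Q: cring "quad_ring R c" by (rule quad_cring[OF assms])
  have "2 * Suc k + 1 = Suc (Suc (2 * k + 1))" by simp
  then have "(\<zero>, \<one>) [^]\<^bsub>quad_ring R c\<^esub> (2 * Suc k + 1) =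
      (\<zero>, c [^] k) \<otimes>\<^bsub>quad_ring R c\<^esub> (\<zero>, \<one>) \<otimes>\<^bsub>quad_ring R c\<^esub> (\<zero>, \<one>)"
    using Suc by (simp only: Q.nat_pow_Suc)
  then show ?case using assms by (simp add: m_comm)
qed (use assms in simp)

lemma quad_char:
  assumes "c \<in> carrier R" "[(p::nat)] \<cdot> \<one> = \<zero>"
  shows "[p] \<cdot>\<^bsub>quad_ring R c\<^esub> \<one>\<^bsub>quad_ring R c\<^esub> = \<zero>\<^bsub>quad_ring R c\<^esub>"
proof -
  interpret Q: cring "quad_ring R c" by (rule quad_cring[OF assms(1)])
  have h: "ring_hom_ring R (quad_ring R c) (\<lambda>a. (a, \<zero>))"
    using quad_embed_hom[OF assms(1)]
    unfolding ring_hom_ring_def ring_hom_ring_axioms_def by (intro conjI ring_axioms Q.ring_axioms)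
  have "[p] \<cdot>\<^bsub>quad_ring R c\<^esub> \<one>\<^bsub>quad_ring R c\<^esub> = ([p] \<cdot> \<one>, \<zero>)"
    by (rule ring_hom_ring.hom_add_pow_one[OF h, symmetric])
  then show ?thesis using assms(2) by simp
qed

text \<open>Frobenius is additive, so a + b z goes to a^q + b^q z^q, and z^q = c^k z because q = 2 k
  + 1 and z^2 = c.\<close>

lemma quad_frobenius:
  assumes c: "c \<in> carrier R" and p: "Factorial_Ring.prime (p::nat)" "[p] \<cdot> \<one> = \<zero>" and q: "p ^ e = 2 * k + 1"
    and ab: "a \<in> carrier R" "b \<in> carrier R"
  shows "(a, b) [^]\<^bsub>quad_ring R c\<^esub> (p ^ e) = (a [^] (p ^ e), b [^] (p ^ e) \<otimes> c [^] k)"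
proof -
  interpret Q: cring "quad_ring R c" by (rule quad_cring[OF c])
  let ?q = "p ^ e"
  have "(a, b) = (a, \<zero>) \<oplus>\<^bsub>quad_ring R c\<^esub> (b, \<zero>) \<otimes>\<^bsub>quad_ring R c\<^esub> (\<zero>, \<one>)" using ab c by simp
  also have "\<dots> [^]\<^bsub>quad_ring R c\<^esub> ?q = (a, \<zero>) [^]\<^bsub>quad_ring R c\<^esub> ?q \<oplus>\<^bsub>quad_ring R c\<^esub>
      ((b, \<zero>) \<otimes>\<^bsub>quad_ring R c\<^esub> (\<zero>, \<one>)) [^]\<^bsub>quad_ring R c\<^esub> ?q"
    by (rule Q.frobenius_add[OF p(1) quad_char[OF c p(2)]]) (use ab c in auto)
  also have "((b, \<zero>) \<otimes>\<^bsub>quad_ring R c\<^esub> (\<zero>, \<one>)) [^]\<^bsub>quad_ring R c\<^esub> ?q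
      = (b, \<zero>) [^]\<^bsub>quad_ring R c\<^esub> ?q \<otimes>\<^bsub>quad_ring R c\<^esub> (\<zero>, \<one>) [^]\<^bsub>quad_ring R c\<^esub> ?q"
    by (rule Q.nat_pow_distrib) (use ab in auto)
  also have "(\<zero>, \<one>) [^]\<^bsub>quad_ring R c\<^esub> ?q = (\<zero>, c [^] k)" unfolding q by (rule quad_pow_z[OF c])
  finally show ?thesis using ab c by (simp add: quad_pow_embed)
qed

text \<open>\<open>V k\<close> is the sum of c^j t(k + 2 j) over all j. It makes sense because c has
  no constant term: c^j has order at least j, so only finitely many j contribute to a given
  coefficient. With z^2 = c it evaluates a series in z.\<close>

lemma geometric_series:
  fixes I :: "'i set"
  assumes c: "c \<in> carrier (PS I)" "c \<in> ord_ge 1" and t: "\<And>k::nat. t k \<in> carrier (PS I)"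
  obtains V where "\<And>k. V k \<in> carrier (PS I)"
    "\<And>k. V k = t k \<oplus>\<^bsub>PS I\<^esub> c \<otimes>\<^bsub>PS I\<^esub> V (k + 2)"
proof -
  interpret S: cring "PS I" by (rule ps_cring)
  define g where "g = (\<lambda>k j. c [^]\<^bsub>PS I\<^esub> j \<otimes>\<^bsub>PS I\<^esub> t (k + 2 * j))"
  define W where "W = (\<lambda>N k. finsum (PS I) (g k) {..N})"
  \<comment> \<open>The coefficient at a monomial is taken from the partial sum that ends at its
    degree; later terms no longer change it.\<close>
  define V where "V = (\<lambda>k m. W (size m) k m)"
  have gc: "g k j \<in> carrier (PS I)" for k j using c t by (simp add: g_def)
  have Wc: "W N k \<in> carrier (PS I)" for N k unfolding W_def using gc by (intro S.finsum_closed) auto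
  have Vc: "V k \<in> carrier (PS I)" for k
    by (rule ps_carrierI) (simp_all add: V_def ps_carrierD[OF Wc])
  have go: "g k j \<in> ord_ge j" for k j
  proof -
    have "t (k + 2 * j) \<otimes>\<^bsub>PS I\<^esub> c [^]\<^bsub>PS I\<^esub> j \<in> ord_ge j"
      using c t by (intro ord_ge_mult_l ord_ge_pow) auto
    then show ?thesis using c t by (simp add: g_def S.m_comm)
  qed
  have WV: "W N k m = V k m" if "size m \<le> N" for N k m
  proof -
    have "W N k m = finsum R (\<lambda>j. g k j m) {..N}" unfolding W_def using gc by (intro ps_finsum) auto
    also have "\<dots> = finsum R (\<lambda>j. g k j m) {..size m}"
      using that ord_geD[OF go] by (intro finsum_neutral) (auto simp: ps_carrierD[OF gc])
    also have "\<dots> = V k m" unfolding V_def W_def using gc by (intro ps_finsum[symmetric]) auto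
    finally show ?thesis .
  qed
  have rec: "W (Suc N) k = t k \<oplus>\<^bsub>PS I\<^esub> c \<otimes>\<^bsub>PS I\<^esub> W N (k + 2)" for N k
  proof -
    have "W (Suc N) k = finsum (PS I) (\<lambda>j. g k (Suc j)) {..N} \<oplus>\<^bsub>PS I\<^esub> g k 0"
      unfolding W_def using gc by (intro S.finsum_Suc2) auto
    also have "finsum (PS I) (\<lambda>j. g k (Suc j)) {..N} = finsum (PS I) (\<lambda>j. c \<otimes>\<^bsub>PS I\<^esub> g (k + 2) j) {..N}"
    proof (intro S.finsum_cong')
      fix j
      show "g k (Suc j) = c \<otimes>\<^bsub>PS I\<^esub> g (k + 2) j"
        using c t by (simp add: g_def S.m_ac)
    qed (use c gc in auto)
    also have "\<dots> = c \<otimes>\<^bsub>PS I\<^esub> W N (k + 2)"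
      unfolding W_def using c gc by (intro S.finsum_rdistr[symmetric]) auto
    also have "g k 0 = t k" using t by (simp add: g_def)
    finally show ?thesis using c t Wc by (simp add: S.a_comm)
  qed
  have "V k = t k \<oplus>\<^bsub>PS I\<^esub> c \<otimes>\<^bsub>PS I\<^esub> V (k + 2)" for k
  proof
    fix m :: "'i multiset"
    have "(c \<otimes>\<^bsub>PS I\<^esub> V (k + 2)) m = (c \<otimes>\<^bsub>PS I\<^esub> W (size m) (k + 2)) m"
      unfolding ps_simps
    proof (intro finsum_cong')
      fix a assume "a \<in> {a. a \<subseteq># m}"
      then have "W (size m) (k + 2) (m - a) = V (k + 2) (m - a)"
        by (intro WV) (simp add: size_Diff_submset)
      then show "c a \<otimes> V (k + 2) (m - a) = c a \<otimes> W (size m) (k + 2) (m - a)" by simp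
    qed (auto simp: ps_carrierD[OF Wc] ps_carrierD[OF c(1)])
    then have "(t k \<oplus>\<^bsub>PS I\<^esub> c \<otimes>\<^bsub>PS I\<^esub> V (k + 2)) m = W (Suc (size m)) k m"
      unfolding rec by (simp add: ps_simps(4))
    then show "V k m = (t k \<oplus>\<^bsub>PS I\<^esub> c \<otimes>\<^bsub>PS I\<^esub> V (k + 2)) m" using WV[of m "Suc (size m)" k] by simp
  qed
  then show thesis using that Vc by blast
qed

text \<open>Monomials in the single variable z are multisets over \<open>unit\<close>, hence powers
  of z determined by their size.\<close>

lemma unit_multiset: "m = replicate_mset (size m) (() :: unit)"
  by (rule multiset_eqI) (induction m, auto)

lemma unit_multiset_eqI: "size m = size m' \<Longrightarrow> m = (m' :: unit multiset)"
  by (metis unit_multiset)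

text \<open>Division by f + z^2 as in Weierstrass division, with f in the maximal ideal: every
  series in z has exactly one remainder a + b z. A geometric series provides the remainder;
  uniqueness holds because the quotient would lie in every power of the maximal ideal.\<close>

lemma quad_ring_iso_quotient:
  fixes I :: "'i set"
  defines "S \<equiv> power_series_ring R I"
  defines "T \<equiv> power_series_ring S {()}"
  defines "z \<equiv> ring.indexed_var S ()"
  assumes f: "f \<in> carrier S" "f \<in> ord_ge 1"
  shows "\<exists>\<psi>. \<psi> \<in> ring_iso (quad_ring S (\<ominus>\<^bsub>S\<^esub> f))
     (T Quot (PIdl\<^bsub>T\<^esub> (ring.indexed_const S f \<oplus>\<^bsub>T\<^esub> z [^]\<^bsub>T\<^esub> (2::nat))))"
proof -
  interpret S: cring S unfolding S_def by (rule ps_cring)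
  interpret T: cring T unfolding T_def by (rule S.ps_cring)
  let ?c = "\<ominus>\<^bsub>S\<^esub> f"
  define g where "g = ring.indexed_const S f \<oplus>\<^bsub>T\<^esub> z [^]\<^bsub>T\<^esub> (2::nat)"
  let ?z2 = "{#(), ()#}"
  have sz: "m = {#} \<longleftrightarrow> size m = 0" "m = {#()#} \<longleftrightarrow> size m = 1" "m = ?z2 \<longleftrightarrow> size m = 2" for m
  proof -
    show "m = {#()#} \<longleftrightarrow> size m = 1" by (rule iffI, simp, rule unit_multiset_eqI, simp)
    show "m = ?z2 \<longleftrightarrow> size m = 2" by (rule iffI, simp, rule unit_multiset_eqI, simp)
  qed simp
  have mc: "pmono S a \<mu> \<in> carrier T" if "a \<in> carrier S" for a \<mu>
    unfolding T_def using that by (intro S.pmono_closed) auto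
  have z: "z = pmono S \<one>\<^bsub>S\<^esub> {#()#}" unfolding z_def by (rule S.indexed_var_pmono)
  have z2: "z [^]\<^bsub>T\<^esub> (2::nat) = pmono S \<one>\<^bsub>S\<^esub> ?z2"
    unfolding z T_def by (subst S.pmono_pow) (auto simp: numeral_2_eq_2)
  have g: "g = pmono S f {#} \<oplus>\<^bsub>T\<^esub> pmono S \<one>\<^bsub>S\<^esub> ?z2"
    unfolding g_def z2 S.indexed_const_pmono ..
  have gT: "g \<in> carrier T" unfolding g using f mc by auto
  have T_add: "(a \<oplus>\<^bsub>T\<^esub> b) m = a m \<oplus>\<^bsub>S\<^esub> b m" for a b m unfolding T_def by (rule ps_simps(4))
  have TD: "t m \<in> carrier S" if "t \<in> carrier T" for t m using that unfolding T_def by (rule ps_carrierD(1))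
  have gQ: "(g \<otimes>\<^bsub>T\<^esub> Q) m = f \<otimes>\<^bsub>S\<^esub> Q m \<oplus>\<^bsub>S\<^esub> (if 2 \<le> size m then Q (m - ?z2) else \<zero>\<^bsub>S\<^esub>)"
    if Q: "Q \<in> carrier T" for Q m
  proof -
    have Q': "Q \<in> carrier (S.PS {()})" using Q by (simp add: T_def)
    have "(g \<otimes>\<^bsub>T\<^esub> Q) m = (pmono S f {#} \<otimes>\<^bsub>T\<^esub> Q) m \<oplus>\<^bsub>S\<^esub> (pmono S \<one>\<^bsub>S\<^esub> ?z2 \<otimes>\<^bsub>T\<^esub> Q) m"
      unfolding g using f Q mc by (simp add: T.l_distr T_add)
    also have "(pmono S f {#} \<otimes>\<^bsub>T\<^esub> Q) m = f \<otimes>\<^bsub>S\<^esub> Q m"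
      using S.pmono_mult[OF f(1) Q', of "{#}" m] by (simp add: T_def)
    also have "(pmono S \<one>\<^bsub>S\<^esub> ?z2 \<otimes>\<^bsub>T\<^esub> Q) m = (if ?z2 \<subseteq># m then Q (m - ?z2) else \<zero>\<^bsub>S\<^esub>)"
      using S.pmono_mult[OF S.one_closed Q', of ?z2 m] TD[OF Q] by (simp add: T_def)
    also have "?z2 \<subseteq># m \<longleftrightarrow> 2 \<le> size m"
    proof -
      obtain k where "m = replicate_mset k ()" using unit_multiset by blast
      then show ?thesis by (auto simp: subseteq_mset_def)
    qed
    finally show ?thesis .
  qed
  define \<iota> where "\<iota> = (\<lambda>(a, b). pmono S a {#} \<oplus>\<^bsub>T\<^esub> pmono S b {#()#})"
  have \<iota>T: "\<iota> x \<in> carrier T" if "x \<in> carrier S \<times> carrier S" for x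
    using that mc by (auto simp: \<iota>_def)
  have \<iota>m: "\<iota> (a, b) m = (if size m = 0 then a else if size m = 1 then b else \<zero>\<^bsub>S\<^esub>)"
    if "a \<in> carrier S" "b \<in> carrier S" for a b m
    using that unfolding \<iota>_def split T_add pmono_def sz by auto
  let ?J = "PIdl\<^bsub>T\<^esub> g"
  have J: "ideal ?J T" using gT by (rule T.cgenideal_ideal)
  interpret J: ideal ?J T by (rule J)
  have Jmem: "x \<in> ?J \<longleftrightarrow> (\<exists>Q\<in>carrier T. x = g \<otimes>\<^bsub>T\<^esub> Q)" for x
    unfolding cgenideal_def using gT T.m_comm by auto
  have uniq: "a = \<zero>\<^bsub>S\<^esub> \<and> b = \<zero>\<^bsub>S\<^esub>" if ab: "a \<in> carrier S" "b \<in> carrier S" and "\<iota> (a, b) \<in> ?J" for a b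
  proof -
    obtain Q where Q: "Q \<in> carrier T" "\<iota> (a, b) = g \<otimes>\<^bsub>T\<^esub> Q" using \<open>\<iota> (a, b) \<in> ?J\<close> Jmem by auto
    have Qm: "Q m \<in> carrier S" for m using TD[OF Q(1)] .
    \<comment> \<open>The left side has no terms of z-degree 2 or more, so each coefficient of Q is
      -f times the coefficient two degrees higher. Iterating gives arbitrarily high order.\<close>
    have rec: "Q m = ?c \<otimes>\<^bsub>S\<^esub> Q (m + ?z2)" for m
    proof -
      have "\<zero>\<^bsub>S\<^esub> = f \<otimes>\<^bsub>S\<^esub> Q (m + ?z2) \<oplus>\<^bsub>S\<^esub> Q m"
        using fun_cong[OF Q(2), of "m + ?z2"] \<iota>m[OF ab, of "m + ?z2"] gQ[OF Q(1), of "m + ?z2"] by simp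
      then have "\<ominus>\<^bsub>S\<^esub> (f \<otimes>\<^bsub>S\<^esub> Q (m + ?z2)) = Q m"
        using Qm f by (intro S.minus_equality) (simp_all add: S.a_comm)
      then show ?thesis using Qm f by (simp add: S.l_minus)
    qed
    have "Q m \<in> ord_ge D" for m D
    proof (induction D arbitrary: m)
      case (Suc D)
      have "f \<otimes>\<^bsub>S\<^esub> Q (m + ?z2) \<in> ord_ge (1 + D)"
        using f Qm Suc unfolding S_def by (intro ord_ge_mult) auto
      then have "\<ominus>\<^bsub>S\<^esub> (f \<otimes>\<^bsub>S\<^esub> Q (m + ?z2)) \<in> ord_ge (1 + D)"
        using f Qm unfolding S_def by (intro ord_ge_minus S.m_closed[unfolded S_def]) auto
      then show ?case using rec[of m] Qm f by (simp add: S.l_minus)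
    qed simp
    then have "Q m = \<zero>\<^bsub>S\<^esub>" for m
    proof -
      assume *: "\<And>m D. Q m \<in> ord_ge D"
      show ?thesis
      proof
        fix k show "Q m k = \<zero>\<^bsub>S\<^esub> k" using ord_geD[OF *[of m "Suc (size k)"], of k] by (simp add: S_def ps_simps)
      qed
    qed
    then have gQ0: "(g \<otimes>\<^bsub>T\<^esub> Q) m = \<zero>\<^bsub>S\<^esub>" for m using gQ[OF Q(1), of m] f by simp
    show ?thesis using gQ0[of "{#}"] gQ0[of "{#()#}"] Q(2) \<iota>m[OF ab] by (metis One_nat_def size_empty size_single zero_neq_one)
  qed
  have ex: "\<exists>x\<in>carrier S \<times> carrier S. t \<ominus>\<^bsub>T\<^esub> \<iota> x \<in> ?J" if t: "t \<in> carrier T" for t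
  proof -
    have c: "?c \<in> carrier (PS I)" "?c \<in> ord_ge 1" using f unfolding S_def by (auto intro: ord_ge_minus S.a_inv_closed[unfolded S_def])
    have tc: "t (replicate_mset k ()) \<in> carrier (PS I)" for k using TD[OF t] unfolding S_def .
    obtain V where V: "\<And>k. V k \<in> carrier S"
      "\<And>k. V k = t (replicate_mset k ()) \<oplus>\<^bsub>S\<^esub> ?c \<otimes>\<^bsub>S\<^esub> V (k + 2)"
      using geometric_series[of ?c I "\<lambda>k. t (replicate_mset k ())", OF c tc] unfolding S_def by metis
    \<comment> \<open>The quotient has the z-coefficients V 2, V 3, ..., and the remainder is V 0 +
      V 1 z.\<close>
    define Q where "Q = (\<lambda>m :: unit multiset. V (size m + 2))"
    have Q: "Q \<in> carrier T" unfolding T_def by (rule ps_carrierI) (auto simp: Q_def V(1))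
    have t_eq: "t m = f \<otimes>\<^bsub>S\<^esub> V (size m + 2) \<oplus>\<^bsub>S\<^esub> V (size m)" for m
    proof -
      have "V (size m) = t m \<oplus>\<^bsub>S\<^esub> ?c \<otimes>\<^bsub>S\<^esub> V (size m + 2)"
        using V(2)[of "size m"] unit_multiset[of m] by metis
      then have e: "f \<otimes>\<^bsub>S\<^esub> V (size m + 2) \<oplus>\<^bsub>S\<^esub> V (size m) = f \<otimes>\<^bsub>S\<^esub> V (size m + 2) \<oplus>\<^bsub>S\<^esub> (t m \<oplus>\<^bsub>S\<^esub> ?c \<otimes>\<^bsub>S\<^esub> V (size m + 2))"
        by simp
      have "f \<otimes>\<^bsub>S\<^esub> V (size m + 2) \<in> carrier S" "t m \<in> carrier S" using f V(1) TD[OF t] by auto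
      moreover have "x \<oplus>\<^bsub>S\<^esub> (y \<oplus>\<^bsub>S\<^esub> \<ominus>\<^bsub>S\<^esub> x) = y" if "x \<in> carrier S" "y \<in> carrier S" for x y
        using that S.a_lcomm[of x y "\<ominus>\<^bsub>S\<^esub> x"] by (simp add: S.r_neg)
      ultimately show ?thesis unfolding e using S.l_minus[OF f(1) V(1)] by simp
    qed
    have "t = g \<otimes>\<^bsub>T\<^esub> Q \<oplus>\<^bsub>T\<^esub> \<iota> (V 0, V 1)"
    proof
      fix m
      have "(g \<otimes>\<^bsub>T\<^esub> Q \<oplus>\<^bsub>T\<^esub> \<iota> (V 0, V 1)) m = (f \<otimes>\<^bsub>S\<^esub> V (size m + 2) \<oplus>\<^bsub>S\<^esub>
          (if 2 \<le> size m then V (size m) else \<zero>\<^bsub>S\<^esub>)) \<oplus>\<^bsub>S\<^esub> \<iota> (V 0, V 1) m"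
      proof -
        have "V (size (m - ?z2) + 2) = V (size m)" if "2 \<le> size m"
        proof -
          obtain k where "m = replicate_mset k ()" using unit_multiset by blast
          then have "?z2 \<subseteq># m" using that by (auto simp: subseteq_mset_def)
          then have "size (m - ?z2) = size m - 2" by (simp add: size_Diff_submset)
          then have "size (m - ?z2) + 2 = size m" using that by linarith
          then show ?thesis by (simp only:)
        qed
        then show ?thesis unfolding T_add gQ[OF Q] by (simp add: Q_def)
      qed
      also have "\<dots> = f \<otimes>\<^bsub>S\<^esub> V (size m + 2) \<oplus>\<^bsub>S\<^esub> V (size m)"
      proof (cases "2 \<le> size m")
        case True then show ?thesis unfolding \<iota>m[OF V(1) V(1), of 0 1 m] using V(1) f by auto
      next
        case False
        then have "size m = 0 \<or> size m = 1" by linarith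
        then show ?thesis unfolding \<iota>m[OF V(1) V(1), of 0 1 m] using V(1) f by auto
      qed
      finally show "t m = (g \<otimes>\<^bsub>T\<^esub> Q \<oplus>\<^bsub>T\<^esub> \<iota> (V 0, V 1)) m" using t_eq by simp
    qed
    then have "t \<ominus>\<^bsub>T\<^esub> \<iota> (V 0, V 1) = g \<otimes>\<^bsub>T\<^esub> Q"
      using \<iota>T[of "(V 0, V 1)"] V(1) gT Q by (simp add: a_minus_def T.a_assoc T.r_neg)
    then show ?thesis using Q Jmem V(1) by (intro bexI[of _ "(V 0, V 1)"]) auto
  qed
  have \<iota>_add: "\<iota> (x \<oplus>\<^bsub>quad_ring S ?c\<^esub> y) = \<iota> x \<oplus>\<^bsub>T\<^esub> \<iota> y"
    if xy: "x \<in> carrier S \<times> carrier S" "y \<in> carrier S \<times> carrier S" for x y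
  proof
    fix m
    obtain a b a' b' where "x = (a, b)" "y = (a', b')" "a \<in> carrier S" "b \<in> carrier S" "a' \<in> carrier S" "b' \<in> carrier S"
      using xy by auto
    then show "\<iota> (x \<oplus>\<^bsub>quad_ring S ?c\<^esub> y) m = (\<iota> x \<oplus>\<^bsub>T\<^esub> \<iota> y) m" by (simp add: T_add \<iota>m)
  qed
  have \<iota>_mult: "\<iota> x \<otimes>\<^bsub>T\<^esub> \<iota> y \<ominus>\<^bsub>T\<^esub> \<iota> (x \<otimes>\<^bsub>quad_ring S ?c\<^esub> y) \<in> ?J"
    if xy: "x \<in> carrier S \<times> carrier S" "y \<in> carrier S \<times> carrier S" for x y
  proof -
    obtain a b a' b' where xy': "x = (a, b)" "y = (a', b')" and ab: "a \<in> carrier S" "b \<in> carrier S" "a' \<in> carrier S" "b' \<in> carrier S"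
      using xy by auto
    have mm: "pmono S u \<mu> \<otimes>\<^bsub>T\<^esub> pmono S v \<nu> = pmono S (u \<otimes>\<^bsub>S\<^esub> v) (\<mu> + \<nu>)" if "u \<in> carrier S" "v \<in> carrier S" for u v \<mu> \<nu>
      unfolding T_def using that by (intro S.pmono_mult_pmono) auto
    have "\<iota> x \<otimes>\<^bsub>T\<^esub> \<iota> y = pmono S (a \<otimes>\<^bsub>S\<^esub> a') {#} \<oplus>\<^bsub>T\<^esub> pmono S (a \<otimes>\<^bsub>S\<^esub> b') {#()#} \<oplus>\<^bsub>T\<^esub>
        (pmono S (b \<otimes>\<^bsub>S\<^esub> a') {#()#} \<oplus>\<^bsub>T\<^esub> pmono S (b \<otimes>\<^bsub>S\<^esub> b') ?z2)"
      unfolding xy' \<iota>_def using ab mc by (simp add: T.l_distr T.r_distr mm T.a_ac)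
    \<comment> \<open>The only product that leaves the span of 1 and z is b b' z^2; trading z^2 for
      -f there costs exactly the multiple b b' of g.\<close>
    moreover have "\<dots> = g \<otimes>\<^bsub>T\<^esub> pmono S (b \<otimes>\<^bsub>S\<^esub> b') {#} \<oplus>\<^bsub>T\<^esub> \<iota> (x \<otimes>\<^bsub>quad_ring S ?c\<^esub> y)"
    proof
      fix m
      note 0 = sz[of m]
      have 1: "2 \<le> size m \<Longrightarrow> m - ?z2 = {#} \<longleftrightarrow> size m = 2"
      proof -
        assume "2 \<le> size m"
        obtain k where k: "m = replicate_mset k ()" using unit_multiset by blast
        then have "?z2 \<subseteq># m" using \<open>2 \<le> size m\<close> by (auto simp: subseteq_mset_def)
        then have "size (m - ?z2) = size m - 2" by (simp add: size_Diff_submset)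
        then show "m - ?z2 = {#} \<longleftrightarrow> size m = 2" unfolding sz using \<open>2 \<le> size m\<close> by linarith
      qed
      have L: "(pmono S (a \<otimes>\<^bsub>S\<^esub> a') {#} \<oplus>\<^bsub>T\<^esub> pmono S (a \<otimes>\<^bsub>S\<^esub> b') {#()#} \<oplus>\<^bsub>T\<^esub>
        (pmono S (b \<otimes>\<^bsub>S\<^esub> a') {#()#} \<oplus>\<^bsub>T\<^esub> pmono S (b \<otimes>\<^bsub>S\<^esub> b') ?z2)) m =
         (if size m = 0 then a \<otimes>\<^bsub>S\<^esub> a' else if size m = 1 then a \<otimes>\<^bsub>S\<^esub> b' \<oplus>\<^bsub>S\<^esub> b \<otimes>\<^bsub>S\<^esub> a'
          else if size m = 2 then b \<otimes>\<^bsub>S\<^esub> b' else \<zero>\<^bsub>S\<^esub>)"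
        unfolding T_add pmono_def 0 using ab by auto
      have cc: "a \<otimes>\<^bsub>S\<^esub> a' \<oplus>\<^bsub>S\<^esub> ?c \<otimes>\<^bsub>S\<^esub> (b \<otimes>\<^bsub>S\<^esub> b') \<in> carrier S" "a \<otimes>\<^bsub>S\<^esub> b' \<oplus>\<^bsub>S\<^esub> b \<otimes>\<^bsub>S\<^esub> a' \<in> carrier S"
        using ab f by auto
      have e0: "f \<otimes>\<^bsub>S\<^esub> (b \<otimes>\<^bsub>S\<^esub> b') \<oplus>\<^bsub>S\<^esub> (a \<otimes>\<^bsub>S\<^esub> a' \<oplus>\<^bsub>S\<^esub> ?c \<otimes>\<^bsub>S\<^esub> (b \<otimes>\<^bsub>S\<^esub> b')) = a \<otimes>\<^bsub>S\<^esub> a'"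
        using ab f S.a_lcomm[of "f \<otimes>\<^bsub>S\<^esub> (b \<otimes>\<^bsub>S\<^esub> b')" "a \<otimes>\<^bsub>S\<^esub> a'"] by (simp add: S.l_minus S.r_neg)
      have Rr: "(g \<otimes>\<^bsub>T\<^esub> pmono S (b \<otimes>\<^bsub>S\<^esub> b') {#} \<oplus>\<^bsub>T\<^esub> \<iota> (x \<otimes>\<^bsub>quad_ring S ?c\<^esub> y)) m =
          f \<otimes>\<^bsub>S\<^esub> (if size m = 0 then b \<otimes>\<^bsub>S\<^esub> b' else \<zero>\<^bsub>S\<^esub>) \<oplus>\<^bsub>S\<^esub> (if size m = 2 then b \<otimes>\<^bsub>S\<^esub> b' else \<zero>\<^bsub>S\<^esub>)
          \<oplus>\<^bsub>S\<^esub> (if size m = 0 then a \<otimes>\<^bsub>S\<^esub> a' \<oplus>\<^bsub>S\<^esub> ?c \<otimes>\<^bsub>S\<^esub> (b \<otimes>\<^bsub>S\<^esub> b') else if size m = 1 then a \<otimes>\<^bsub>S\<^esub> b' \<oplus>\<^bsub>S\<^esub> b \<otimes>\<^bsub>S\<^esub> a' else \<zero>\<^bsub>S\<^esub>)"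
        unfolding T_add gQ[OF mc[OF S.m_closed[OF ab(2,4)]]] xy' quad_simps \<iota>m[OF cc]
        using 0 1 by (simp add: pmono_def)
      show "(pmono S (a \<otimes>\<^bsub>S\<^esub> a') {#} \<oplus>\<^bsub>T\<^esub> pmono S (a \<otimes>\<^bsub>S\<^esub> b') {#()#} \<oplus>\<^bsub>T\<^esub>
        (pmono S (b \<otimes>\<^bsub>S\<^esub> a') {#()#} \<oplus>\<^bsub>T\<^esub> pmono S (b \<otimes>\<^bsub>S\<^esub> b') ?z2)) m =
        (g \<otimes>\<^bsub>T\<^esub> pmono S (b \<otimes>\<^bsub>S\<^esub> b') {#} \<oplus>\<^bsub>T\<^esub> \<iota> (x \<otimes>\<^bsub>quad_ring S ?c\<^esub> y)) m"
        unfolding L Rr using ab f cc e0 by auto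
    qed
    moreover have "\<iota> (x \<otimes>\<^bsub>quad_ring S ?c\<^esub> y) \<in> carrier T" using xy' ab f by (intro \<iota>T) auto
    ultimately have "\<iota> x \<otimes>\<^bsub>T\<^esub> \<iota> y \<ominus>\<^bsub>T\<^esub> \<iota> (x \<otimes>\<^bsub>quad_ring S ?c\<^esub> y) = g \<otimes>\<^bsub>T\<^esub> pmono S (b \<otimes>\<^bsub>S\<^esub> b') {#}"
      using gT mc ab by (simp add: a_minus_def T.a_assoc T.r_neg)
    then show ?thesis using Jmem mc ab by (metis S.m_closed)
  qed
  define \<psi> where "\<psi> = (\<lambda>x. ?J +>\<^bsub>T\<^esub> \<iota> x)"
  have hom: "(+>\<^bsub>T\<^esub>) ?J \<in> ring_hom T (T Quot ?J)" by (rule J.rcos_ring_hom)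
  interpret Qc: cring "quad_ring S ?c" using f by (intro S.quad_cring) auto
  have "\<psi> \<in> ring_iso (quad_ring S ?c) (T Quot ?J)"
  proof (rule ring_iso_memI)
    fix x y assume x: "x \<in> carrier (quad_ring S ?c)" and y: "y \<in> carrier (quad_ring S ?c)"
    then have xy: "x \<in> carrier S \<times> carrier S" "y \<in> carrier S \<times> carrier S" by auto
    show "\<psi> x \<in> carrier (T Quot ?J)" unfolding \<psi>_def using ring_hom_memE(1)[OF hom] \<iota>T[OF xy(1)] by simp
    show "\<psi> (x \<oplus>\<^bsub>quad_ring S ?c\<^esub> y) = \<psi> x \<oplus>\<^bsub>T Quot ?J\<^esub> \<psi> y"
      unfolding \<psi>_def \<iota>_add[OF xy] using ring_hom_memE(3)[OF hom] \<iota>T xy by simp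
    have "\<iota> (x \<otimes>\<^bsub>quad_ring S ?c\<^esub> y) \<in> carrier T" using Qc.m_closed[OF x y] by (intro \<iota>T) simp
    then have "?J +>\<^bsub>T\<^esub> (\<iota> x \<otimes>\<^bsub>T\<^esub> \<iota> y) = ?J +>\<^bsub>T\<^esub> \<iota> (x \<otimes>\<^bsub>quad_ring S ?c\<^esub> y)"
      using T.quotient_eq_iff_same_a_r_cos[OF J] \<iota>_mult[OF xy] \<iota>T xy by simp
    then show "\<psi> (x \<otimes>\<^bsub>quad_ring S ?c\<^esub> y) = \<psi> x \<otimes>\<^bsub>T Quot ?J\<^esub> \<psi> y"
      unfolding \<psi>_def using ring_hom_memE(2)[OF hom] \<iota>T xy by simp
  next
    have "\<iota> \<one>\<^bsub>quad_ring S ?c\<^esub> = \<one>\<^bsub>T\<^esub>"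
      by (rule ext) (auto simp: \<iota>m, auto simp: T_def ps_simps)
    then show "\<psi> \<one>\<^bsub>quad_ring S ?c\<^esub> = \<one>\<^bsub>T Quot ?J\<^esub>" unfolding \<psi>_def using ring_hom_memE(4)[OF hom] by simp
  next
    show "bij_betw \<psi> (carrier (quad_ring S ?c)) (carrier (T Quot ?J))"
      unfolding bij_betw_def
    proof
      show "inj_on \<psi> (carrier (quad_ring S ?c))"
      proof (rule inj_onI)
        fix x y assume x: "x \<in> carrier (quad_ring S ?c)" and y: "y \<in> carrier (quad_ring S ?c)" and eq: "\<psi> x = \<psi> y"
        have xy: "x \<in> carrier S \<times> carrier S" "y \<in> carrier S \<times> carrier S" using x y by auto
        have d: "x \<ominus>\<^bsub>quad_ring S ?c\<^esub> y \<in> carrier (quad_ring S ?c)" using x y by (rule Qc.minus_closed)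
        have "x = (x \<ominus>\<^bsub>quad_ring S ?c\<^esub> y) \<oplus>\<^bsub>quad_ring S ?c\<^esub> y" using x y by (simp add: a_minus_def Qc.a_assoc Qc.l_neg del: quad_simps)
        then have "\<iota> x = \<iota> (x \<ominus>\<^bsub>quad_ring S ?c\<^esub> y) \<oplus>\<^bsub>T\<^esub> \<iota> y" using \<iota>_add[of "x \<ominus>\<^bsub>quad_ring S ?c\<^esub> y" y] d xy by simp
        then have "\<iota> x \<ominus>\<^bsub>T\<^esub> \<iota> y = \<iota> (x \<ominus>\<^bsub>quad_ring S ?c\<^esub> y)"
          using \<iota>T[of "x \<ominus>\<^bsub>quad_ring S ?c\<^esub> y"] d \<iota>T[OF xy(2)] by (simp add: a_minus_def T.a_assoc T.r_neg)
        moreover have "\<iota> x \<ominus>\<^bsub>T\<^esub> \<iota> y \<in> ?J"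
          using eq T.quotient_eq_iff_same_a_r_cos[OF J] \<iota>T xy unfolding \<psi>_def by blast
        ultimately have "\<iota> (x \<ominus>\<^bsub>quad_ring S ?c\<^esub> y) \<in> ?J" by simp
        then have "x \<ominus>\<^bsub>quad_ring S ?c\<^esub> y = \<zero>\<^bsub>quad_ring S ?c\<^esub>"
          using uniq[of "fst (x \<ominus>\<^bsub>quad_ring S ?c\<^esub> y)" "snd (x \<ominus>\<^bsub>quad_ring S ?c\<^esub> y)"] d by (auto simp: prod_eq_iff)
        then show "x = y" using x y by (simp del: quad_simps)
      qed
      show "\<psi> ` carrier (quad_ring S ?c) = carrier (T Quot ?J)"
      proof
        show "\<psi> ` carrier (quad_ring S ?c) \<subseteq> carrier (T Quot ?J)"
          unfolding \<psi>_def using ring_hom_memE(1)[OF hom] \<iota>T by auto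
        show "carrier (T Quot ?J) \<subseteq> \<psi> ` carrier (quad_ring S ?c)"
        proof
          fix Y assume "Y \<in> carrier (T Quot ?J)"
          then obtain t where t: "t \<in> carrier T" "Y = ?J +>\<^bsub>T\<^esub> t" unfolding FactRing_def A_RCOSETS_def' by auto
          obtain x where x: "x \<in> carrier S \<times> carrier S" "t \<ominus>\<^bsub>T\<^esub> \<iota> x \<in> ?J" using ex[OF t(1)] by auto
          then have "Y = \<psi> x" unfolding \<psi>_def t(2) using T.quotient_eq_iff_same_a_r_cos[OF J t(1) \<iota>T[OF x(1)]] by simp
          then show "Y \<in> \<psi> ` carrier (quad_ring S ?c)" using x(1) by simp
        qed
      qed
    qed
  qed
  then show ?thesis unfolding g_def by blast
qed

end

lemma (in cring) frobenius_finsum: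
  assumes p: "Factorial_Ring.prime (p::nat)" "[p] \<cdot> \<one> = \<zero>" and "f \<in> A \<rightarrow> carrier R"
  shows "finsum R f A [^] (p ^ e) = finsum R (\<lambda>i. f i [^] (p ^ e)) A"
proof -
  have z: "\<zero> [^] (p ^ e) = \<zero>" using prime_gt_0_nat[OF p(1)] by (simp add: nat_pow_zero)
  show ?thesis using assms(3)
  proof (induction A rule: infinite_finite_induct)
    case (insert x F)
    then show ?case by (subst (1 2) finsum_insert) (auto simp: Pi_iff frobenius_add[OF p])
  qed (simp_all add: z)
qed

section \<open>Primes and units of the quadratic ring over power series\<close>

context kseries
begin

lemma mult_const_coeff:
  assumes "f \<in> carrier S" "g \<in> carrier S"
  shows "(f \<otimes>\<^bsub>S\<^esub> g) {#} = f {#} \<otimes> g {#}"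
  using assms by (simp add: ps_simps(1) ps_carrierD)

text \<open>Contraction to \<open>S\<close> keeps a chain strict, as for every integral extension:
  nested primes with the same contraction coincide. Here the integral equation is quadratic, so the
  argument is carried out with the conjugate element.\<close>

lemma prime_chain_quad_le:
  assumes c: "c \<in> carrier S"
    and prime: "\<And>i. i \<le> l \<Longrightarrow> primeideal (P i) (quad_ring S c)" and strict: "\<And>i. i < l \<Longrightarrow> P i \<subset> P (Suc i)"
  shows "l \<le> card I"
proof -
  interpret Q: cring "quad_ring S c" by (rule S.quad_cring[OF c])
  have h: "ring_hom_ring S (quad_ring S c) (\<lambda>a. (a, \<zero>\<^bsub>S\<^esub>))"
    using S.quad_embed_hom[OF c] unfolding ring_hom_ring_def ring_hom_ring_axioms_def
    by (intro conjI S.ring_axioms Q.ring_axioms)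
  define B where "B = (\<lambda>i. {s \<in> carrier S. (s, \<zero>\<^bsub>S\<^esub>) \<in> P i})"
  show ?thesis
  proof (rule S_prime_chain_le[of l B])
    show "primeideal (B i) S" if "i \<le> l" for i
      unfolding B_def using ring_hom_ring.primeideal_vimage[OF h S.cring_axioms prime[OF that]] .
    show "B i \<subset> B (Suc i)" if i: "i < l" for i
    proof
      show "B i \<subseteq> B (Suc i)" using strict[OF i] by (auto simp: B_def)
      interpret P: primeideal "P i" "quad_ring S c" using prime i by simp
      interpret P': primeideal "P (Suc i)" "quad_ring S c" using prime i by simp
      obtain y where y: "y \<in> P (Suc i)" "y \<notin> P i" using strict[OF i] by blast
      then have yc: "y \<in> carrier (quad_ring S c)" using P'.a_subset by blast
      then obtain a b where ab: "y = (a, b)" "a \<in> carrier S" "b \<in> carrier S" by auto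
      show "B i \<noteq> B (Suc i)"
      proof
        assume eq: "B i = B (Suc i)"
        \<comment> \<open>\<open>y\<close> is a root of \<open>y\<^sup>2 - 2 a y + (a\<^sup>2 - c b\<^sup>2)\<close>, whose coefficients lie in \<open>S\<close>.\<close>
        define y' where "y' = (\<ominus>\<^bsub>S\<^esub> a, b)"
        have y'c: "y' \<in> carrier (quad_ring S c)" using ab by (simp add: y'_def)
        define N where "N = \<ominus>\<^bsub>S\<^esub> (a \<otimes>\<^bsub>S\<^esub> a) \<oplus>\<^bsub>S\<^esub> c \<otimes>\<^bsub>S\<^esub> (b \<otimes>\<^bsub>S\<^esub> b)"
        have N: "N \<in> carrier S" using ab c by (simp add: N_def)
        have yy': "y \<otimes>\<^bsub>quad_ring S c\<^esub> y' = (N, \<zero>\<^bsub>S\<^esub>)"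
        proof -
          have 1: "a \<otimes>\<^bsub>S\<^esub> \<ominus>\<^bsub>S\<^esub> a = \<ominus>\<^bsub>S\<^esub> (a \<otimes>\<^bsub>S\<^esub> a)" by (rule S.r_minus[OF ab(2,2)])
          have 2: "b \<otimes>\<^bsub>S\<^esub> \<ominus>\<^bsub>S\<^esub> a = \<ominus>\<^bsub>S\<^esub> (a \<otimes>\<^bsub>S\<^esub> b)"
            unfolding S.r_minus[OF ab(3,2)] S.m_comm[OF ab(3,2)] ..
          show ?thesis unfolding ab(1) y'_def N_def quad_simps 1 2 S.r_neg[OF S.m_closed[OF ab(2,3)]] ..
        qed
        have "(N, \<zero>\<^bsub>S\<^esub>) \<in> P (Suc i)" using P'.I_r_closed[OF y(1) y'c] yy' by simp
        then have "N \<in> B i" using N eq by (simp add: B_def)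
        then have "y \<otimes>\<^bsub>quad_ring S c\<^esub> y' \<in> P i" using yy' by (simp add: B_def)
        then have y'P: "y' \<in> P i" using P.I_prime[OF yc y'c] y by blast
        then have "y' \<in> P (Suc i)" using strict[OF i] by blast
        \<comment> \<open>The difference 2 a lies in \<open>S\<close> and in the upper prime, hence,
          the contractions being equal, in the lower one; adding \<open>y'\<close> back would put
          \<open>y\<close> there too.\<close>
        then have "y \<ominus>\<^bsub>quad_ring S c\<^esub> y' \<in> P (Suc i)" using y by (simp add: a_minus_def P'.a_closed P'.a_inv_closed)
        moreover have e: "y = (a \<oplus>\<^bsub>S\<^esub> a, \<zero>\<^bsub>S\<^esub>) \<oplus>\<^bsub>quad_ring S c\<^esub> y'"
          unfolding ab(1) y'_def quad_simps S.a_assoc[OF ab(2) ab(2) S.a_inv_closed[OF ab(2)]]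
            S.r_neg[OF ab(2)] S.r_zero[OF ab(2)] S.l_zero[OF ab(3)] ..
        moreover have ac: "(a \<oplus>\<^bsub>S\<^esub> a, \<zero>\<^bsub>S\<^esub>) \<in> carrier (quad_ring S c)" using ab by simp
        moreover have "y \<ominus>\<^bsub>quad_ring S c\<^esub> y' = (a \<oplus>\<^bsub>S\<^esub> a, \<zero>\<^bsub>S\<^esub>)"
          unfolding a_minus_def by (subst e, subst Q.a_assoc[OF ac y'c Q.a_inv_closed[OF y'c]])
            (simp only: Q.r_neg[OF y'c] Q.r_zero[OF ac])
        ultimately have "(a \<oplus>\<^bsub>S\<^esub> a, \<zero>\<^bsub>S\<^esub>) \<in> P (Suc i)" by simp
        then have "a \<oplus>\<^bsub>S\<^esub> a \<in> B (Suc i)" using ab by (simp add: B_def)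
        then have "(a \<oplus>\<^bsub>S\<^esub> a, \<zero>\<^bsub>S\<^esub>) \<in> P i" unfolding eq[symmetric] by (simp add: B_def)
        then have "(a \<oplus>\<^bsub>S\<^esub> a, \<zero>\<^bsub>S\<^esub>) \<oplus>\<^bsub>quad_ring S c\<^esub> y' \<in> P i" using y'P by (rule P.a_closed)
        then have "y \<in> P i" by (simp only: e[symmetric])
        then show False using y by blast
      qed
    qed
  qed
qed

text \<open>This is the residue map. It respects products because the extra term c b b' has constant
  coefficient zero.\<close>

lemma quad_eps_hom:
  assumes c: "c \<in> carrier S" "c {#} = \<zero>"
  shows "(\<lambda>x. fst x {#}) \<in> ring_hom (quad_ring S c) R"
proof (rule ring_hom_memI)
  fix x y assume "x \<in> carrier (quad_ring S c)" "y \<in> carrier (quad_ring S c)"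
  then show "fst (x \<otimes>\<^bsub>quad_ring S c\<^esub> y) {#} = fst x {#} \<otimes> fst y {#}"
    using c by (auto simp: ps_simps(4) mult_const_coeff ps_carrierD)
qed (auto simp: ps_carrierD ps_simps)

text \<open>The inverse of a + b z is (a - b z) / N with the norm N = a^2 - c b^2. As c has no
  constant term, N has the square of the constant coefficient of a, so N is a unit.\<close>

lemma quad_unit:
  assumes c: "c \<in> carrier S" "c {#} = \<zero>" and x: "x \<in> carrier (quad_ring S c)" "fst x {#} \<noteq> \<zero>"
  shows "x \<in> Units (quad_ring S c)"
proof -
  interpret Q: cring "quad_ring S c" by (rule S.quad_cring[OF c(1)])
  obtain a b where ab: "x = (a, b)" "a \<in> carrier S" "b \<in> carrier S" using x by auto
  define N where "N = a \<otimes>\<^bsub>S\<^esub> a \<oplus>\<^bsub>S\<^esub> \<ominus>\<^bsub>S\<^esub> (c \<otimes>\<^bsub>S\<^esub> (b \<otimes>\<^bsub>S\<^esub> b))"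
  have N: "N \<in> carrier S" using ab c by (simp add: N_def)
  have cb: "c \<otimes>\<^bsub>S\<^esub> (b \<otimes>\<^bsub>S\<^esub> b) \<in> carrier S" using ab c by simp
  have "N {#} = a {#} \<otimes> a {#} \<oplus> \<ominus> (c {#} \<otimes> (b \<otimes>\<^bsub>S\<^esub> b) {#})"
    unfolding N_def ps_simps(4) ps_minus[OF cb] using ab c by (simp only: mult_const_coeff S.m_closed)
  then have "N {#} = a {#} \<otimes> a {#}" using ab c by (simp add: ps_carrierD mult_const_coeff minus_equality)
  then have "N {#} \<noteq> \<zero>" using x ab by (simp add: integral_iff ps_carrierD)
  then have NU: "N \<in> Units S" using N by (intro S_unit)
  define y where "y = (a \<otimes>\<^bsub>S\<^esub> inv\<^bsub>S\<^esub> N, \<ominus>\<^bsub>S\<^esub> b \<otimes>\<^bsub>S\<^esub> inv\<^bsub>S\<^esub> N)"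
  have iN: "inv\<^bsub>S\<^esub> N \<in> carrier S" using NU by simp
  have y: "y \<in> carrier (quad_ring S c)" using ab iN by (simp add: y_def)
  have "x \<otimes>\<^bsub>quad_ring S c\<^esub> y = (N \<otimes>\<^bsub>S\<^esub> inv\<^bsub>S\<^esub> N, \<zero>\<^bsub>S\<^esub>)"
    using ab c iN by (simp add: y_def N_def S.l_distr S.m_assoc S.l_minus S.r_minus S.m_ac S.l_neg)
  then have "x \<otimes>\<^bsub>quad_ring S c\<^esub> y = \<one>\<^bsub>quad_ring S c\<^esub>" using NU by simp
  then show ?thesis using x(1) y Q.m_comm[OF x(1) y] unfolding Units_def
    by (intro CollectI conjI bexI[of _ y]) simp_all
qed

end

text \<open>The \<open>lam i\<close> form a basis of \<open>R\<close> over \<open>R\<^sup>q\<close>, and \<open>co i x\<close> is the \<open>q\<close>-th root of the \<open>i\<close>-th coordinate of \<open>x\<close>.\<close>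

locale frob_basis = field R for R :: "('a, 'm) ring_scheme" (structure) +
  fixes q N :: nat and lam :: "nat \<Rightarrow> 'a" and co :: "nat \<Rightarrow> 'a \<Rightarrow> 'a"
  assumes lam_closed: "i < N \<Longrightarrow> lam i \<in> carrier R"
    and co_closed: "i < N \<Longrightarrow> x \<in> carrier R \<Longrightarrow> co i x \<in> carrier R"
    and co_add: "i < N \<Longrightarrow> x \<in> carrier R \<Longrightarrow> y \<in> carrier R \<Longrightarrow> co i (x \<oplus> y) = co i x \<oplus> co i y"
    and co_smult: "i < N \<Longrightarrow> t \<in> carrier R \<Longrightarrow> x \<in> carrier R \<Longrightarrow> co i (t [^] q \<otimes> x) = t \<otimes> co i x"
    and co_lam: "i < N \<Longrightarrow> j < N \<Longrightarrow> co i (lam j) = (if i = j then \<one> else \<zero>)"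
    and co_span: "x \<in> carrier R \<Longrightarrow> x = finsum R (\<lambda>i. co i x [^] q \<otimes> lam i) {..<N}"

section \<open>Bases of a field over its subfields of p-power powers\<close>

lemma (in field) combine_eq_finsum:
  assumes "set Ks \<subseteq> carrier R" "set Us \<subseteq> carrier R" "length Ks = length Us"
  shows "combine Ks Us = finsum R (\<lambda>i. Ks ! i \<otimes> Us ! i) {..<length Us}"
  using assms
proof (induction Us arbitrary: Ks)
  case (Cons u Us)
  then obtain k Ks' where Ks: "Ks = k # Ks'" "length Ks' = length Us" by (cases Ks) auto
  have c: "(\<lambda>i. Ks ! i \<otimes> (u # Us) ! i) \<in> {..length Us} \<rightarrow> carrier R"
  proof
    fix i assume "i \<in> {..length Us}"
    then have "Ks ! i \<in> set Ks" "(u # Us) ! i \<in> set (u # Us)" using Cons.prems by (auto simp del: set_simps intro!: nth_mem)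
    then show "Ks ! i \<otimes> (u # Us) ! i \<in> carrier R" using Cons.prems by blast
  qed
  have "finsum R (\<lambda>i. Ks ! i \<otimes> (u # Us) ! i) {..<length (u # Us)}
      = finsum R (\<lambda>i. Ks ! i \<otimes> (u # Us) ! i) {..length Us}" by (simp add: lessThan_Suc_atMost)
  also have "\<dots> = k \<otimes> u \<oplus> finsum R (\<lambda>i. Ks' ! i \<otimes> Us ! i) {..<length Us}"
  proof (cases "length Us")
    case 0
    then show ?thesis using Cons.prems Ks by simp
  next
    case (Suc l)
    have "finsum R (\<lambda>i. Ks ! i \<otimes> (u # Us) ! i) {..Suc l} =
      finsum R (\<lambda>i. Ks ! Suc i \<otimes> (u # Us) ! Suc i) {..l} \<oplus> Ks ! 0 \<otimes> (u # Us) ! 0"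
      using c unfolding Suc by (rule finsum_Suc2)
    also have "\<dots> = k \<otimes> u \<oplus> finsum R (\<lambda>i. Ks' ! i \<otimes> Us ! i) {..l}"
    proof -
      have "finsum R (\<lambda>i. Ks' ! i \<otimes> Us ! i) {..l} \<in> carrier R"
        using Cons.prems Ks Suc by (intro finsum_closed) (auto intro!: m_closed simp: subset_iff nth_mem)
      then show ?thesis using Cons.prems Ks by (simp add: a_comm)
    qed
    finally show ?thesis unfolding Suc by (simp add: lessThan_Suc_atMost)
  qed
  finally show ?case using Cons.IH[of Ks'] Cons.prems Ks by simp
qed simp

lemma (in field) pth_powers_subfield:
  assumes p: "Factorial_Ring.prime (p::nat)" "[p] \<cdot> \<one> = \<zero>"
  shows "subfield (pth_powers p R) R"
proof -
  have "(\<lambda>x. x [^] p) \<in> ring_hom R R"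
    using freshman[OF p] by (intro ring_hom_memI) (auto simp: nat_pow_distrib)
  then interpret F: ring_hom_ring R R "\<lambda>x. x [^] p"
    by (simp add: ring_hom_ring_def ring_hom_ring_axioms_def ring_axioms)
  show ?thesis unfolding pth_powers_def by (rule F.img_is_subfield(2)[OF carrier_is_subfield one_not_zero])
qed

text \<open>By additivity (x - y)^p = 0, and a field has no nonzero nilpotents.\<close>

lemma (in field) frobenius_inj:
  assumes p: "Factorial_Ring.prime (p::nat)" "[p] \<cdot> \<one> = \<zero>"
    and xy: "x \<in> carrier R" "y \<in> carrier R" "x [^] p = y [^] p"
  shows "x = y"
proof -
  have "(x \<ominus> y \<oplus> y) [^] p = (x \<ominus> y) [^] p \<oplus> y [^] p" using xy by (intro freshman[OF p]) auto
  moreover have "x \<ominus> y \<oplus> y = x" using xy by (simp add: a_minus_def a_assoc l_neg)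
  ultimately have "\<zero> \<oplus> y [^] p = (x \<ominus> y) [^] p \<oplus> y [^] p" using xy by simp
  then have "(x \<ominus> y) [^] p = \<zero>" using xy by (metis add.right_cancel minus_closed nat_pow_closed zero_closed)
  then have "x \<ominus> y \<notin> Units R" using Units_pow_closed[of "x \<ominus> y" p] field_Units by auto
  then have "x \<ominus> y = \<zero>" using xy field_Units by auto
  then show ?thesis using xy by simp
qed

text \<open>Coordinates in a basis over the p-th powers are p-th powers, and their roots are unique
  because Frobenius is injective. Recording the roots instead of the coordinates turns linearity
  over p-th powers into the rule
  \<open>co i (t [^] p \<otimes> x) = t \<otimes> co i x\<close>.\<close>

lemma (in field) frob_basis_prime:
  assumes p: "Factorial_Ring.prime (p::nat)" "[p] \<cdot> \<one> = \<zero>" and dim: "dimension s (pth_powers p R) (carrier R)"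
  shows "\<exists>lam co. frob_basis R p s lam co"
proof -
  let ?F = "pth_powers p R"
  have sub: "subfield ?F R" by (rule pth_powers_subfield[OF p])
  obtain Us where Us: "set Us \<subseteq> carrier R" "independent ?F Us" "length Us = s" "Span ?F Us = carrier R"
    using exists_base[OF sub dim] by blast
  have Fc: "?F \<subseteq> carrier R" by (auto simp: pth_powers_def)
  define lin where "lin = (\<lambda>k. finsum R (\<lambda>i. k i [^] p \<otimes> Us ! i) {..<s})"
  have uc: "Us ! i \<in> carrier R" if "i < s" for i using Us that by (auto simp: subset_iff nth_mem)
  have lin_comb: "lin k = combine (map (\<lambda>i. k i [^] p) [0..<s]) Us" if "\<And>i. i < s \<Longrightarrow> k i \<in> carrier R" for k
  proof -
    have "combine (map (\<lambda>i. k i [^] p) [0..<s]) Us = finsum R (\<lambda>i. map (\<lambda>i. k i [^] p) [0..<s] ! i \<otimes> Us ! i) {..<length Us}"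
      using that Us by (intro combine_eq_finsum) auto
    also have "\<dots> = lin k" unfolding lin_def Us(3) using that uc by (intro finsum_cong') auto
    finally show ?thesis by simp
  qed
  have uniq: "k i = k' i" if "\<And>i. i < s \<Longrightarrow> k i \<in> carrier R" "\<And>i. i < s \<Longrightarrow> k' i \<in> carrier R" "lin k = lin k'" "i < s" for k k' i
  proof -
    let ?l = "\<lambda>k. map (\<lambda>i. k i [^] p) [0..<s]"
    have e: "combine (?l k) Us = combine (?l k') Us"
    proof -
      have "lin k = combine (?l k) Us" "lin k' = combine (?l k') Us" using that(1,2) by (auto intro: lin_comb)
      then show ?thesis using that(3) by simp
    qed
    have lF: "set (?l k) \<subseteq> ?F" "set (?l k') \<subseteq> ?F" using that by (auto simp: pth_powers_def)
    have "combine (?l k) Us \<in> Span ?F Us"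
      unfolding Us(4) using lF(1) Fc Us(1) by (intro combine_in_carrier) auto
    then have D: "\<exists>!Ks. set Ks \<subseteq> ?F \<and> length Ks = length Us \<and> combine (?l k) Us = combine Ks Us"
      by (rule unique_decomposition[OF sub Us(2)])
    have 1: "set (?l k) \<subseteq> ?F \<and> length (?l k) = length Us \<and> combine (?l k) Us = combine (?l k) Us"
      using lF(1) Us(3) by simp
    have 2: "set (?l k') \<subseteq> ?F \<and> length (?l k') = length Us \<and> combine (?l k) Us = combine (?l k') Us"
      using lF(2) Us(3) e by simp
    have "?l k = ?l k'"
      by (rule ex1_implies_unique[where P = "\<lambda>Ks. set Ks \<subseteq> ?F \<and> length Ks = length Us \<and> combine (?l k) Us = combine Ks Us"])
        (fact D 1 2)+
    then have "?l k ! i = ?l k' ! i" by (simp only:)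
    then have "k i [^] p = k' i [^] p" using that(4) by (simp add: nth_map)
    with that(1,2)[OF that(4)] show ?thesis by (rule frobenius_inj[OF p])
  qed
  have ex: "\<exists>k. (\<forall>i<s. k i \<in> carrier R) \<and> x = lin k" if x: "x \<in> carrier R" for x
  proof -
    have "x \<in> Span ?F Us" using Us x by simp
    then obtain Ks where Ks: "set Ks \<subseteq> ?F" "length Ks = length Us" "x = combine Ks Us"
      using unique_decomposition[OF sub Us(2)] by blast
    have "\<forall>i<s. \<exists>y. y \<in> carrier R \<and> Ks ! i = y [^] p"
      using Ks(1,2) Us(3) unfolding pth_powers_def by (auto simp: subset_iff in_set_conv_nth)
    then obtain k where k: "\<And>i. i < s \<Longrightarrow> k i \<in> carrier R" "\<And>i. i < s \<Longrightarrow> Ks ! i = k i [^] p" by metis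
    have "x = finsum R (\<lambda>i. Ks ! i \<otimes> Us ! i) {..<s}"
      using combine_eq_finsum[of Ks Us] Ks Fc Us by auto
    also have "\<dots> = lin k" unfolding lin_def using k uc by (intro finsum_cong') auto
    finally show ?thesis using k by blast
  qed
  have "\<exists>co. \<forall>x\<in>carrier R. (\<forall>i<s. co x i \<in> carrier R) \<and> x = lin (co x)"
    using ex by (intro bchoice ballI) blast
  then obtain co where co: "\<And>x i. x \<in> carrier R \<Longrightarrow> i < s \<Longrightarrow> co x i \<in> carrier R" "\<And>x. x \<in> carrier R \<Longrightarrow> x = lin (co x)"
    by blast
  have "frob_basis R p s (\<lambda>i. Us ! i) (\<lambda>i x. co x i)"
  proof
    fix i x y assume i: "i < s" and xy: "x \<in> carrier R" "y \<in> carrier R"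
    have "lin (\<lambda>i. co x i \<oplus> co y i) = finsum R (\<lambda>i. co x i [^] p \<otimes> Us ! i \<oplus> co y i [^] p \<otimes> Us ! i) {..<s}"
      unfolding lin_def using co(1)[OF xy(1)] co(1)[OF xy(2)] uc by (intro finsum_cong') (auto simp: freshman[OF p] l_distr)
    also have "\<dots> = lin (co x) \<oplus> lin (co y)"
      unfolding lin_def using co(1)[OF xy(1)] co(1)[OF xy(2)] uc by (intro finsum_addf) auto
    also have "\<dots> = x \<oplus> y" using co(2) xy by simp
    also have "\<dots> = lin (co (x \<oplus> y))" using co(2) xy by simp
    finally have "lin (co (x \<oplus> y)) = lin (\<lambda>i. co x i \<oplus> co y i)" by simp
    then show "co (x \<oplus> y) i = co x i \<oplus> co y i"
      using uniq[of "co (x \<oplus> y)" "\<lambda>i. co x i \<oplus> co y i" i] co(1) xy i by simp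
  next
    fix i t x assume i: "i < s" and tx: "t \<in> carrier R" "x \<in> carrier R"
    have "lin (\<lambda>i. t \<otimes> co x i) = finsum R (\<lambda>i. t [^] p \<otimes> (co x i [^] p \<otimes> Us ! i)) {..<s}"
      unfolding lin_def using co(1)[OF tx(2)] tx uc by (intro finsum_cong') (auto simp: nat_pow_distrib m_assoc)
    also have "\<dots> = t [^] p \<otimes> lin (co x)"
      unfolding lin_def using co(1)[OF tx(2)] tx uc by (intro finsum_rdistr[symmetric]) auto
    also have "\<dots> = t [^] p \<otimes> x" using co(2) tx by simp
    also have "\<dots> = lin (co (t [^] p \<otimes> x))" using co(2) tx by simp
    finally have "lin (co (t [^] p \<otimes> x)) = lin (\<lambda>i. t \<otimes> co x i)" by simp
    then show "co (t [^] p \<otimes> x) i = t \<otimes> co x i"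
      using uniq[of "co (t [^] p \<otimes> x)" "\<lambda>i. t \<otimes> co x i" i] co(1) tx i by simp
  next
    fix i j assume ij: "i < s" "j < s"
    let ?d = "\<lambda>i. if i = j then \<one> else \<zero>"
    have z: "\<zero> [^] p = \<zero>" using prime_gt_0_nat[OF p(1)] by (simp add: nat_pow_zero)
    have "lin ?d = ?d j [^] p \<otimes> Us ! j"
      unfolding lin_def using ij uc z by (intro finsum_only) auto
    then have "lin (co (Us ! j)) = lin ?d" using co(2)[OF uc[OF ij(2)]] uc[OF ij(2)] by simp
    then show "co (Us ! j) i = (if i = j then \<one> else \<zero>)"
      using uniq[of "co (Us ! j)" ?d i] co(1)[OF uc[OF ij(2)]] ij by simp
  next
    fix x assume "x \<in> carrier R"
    then show "x = finsum R (\<lambda>i. co x i [^] p \<otimes> Us ! i) {..<s}" using co(2) unfolding lin_def by blast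
  qed (use uc co(1) in auto)
  then show ?thesis by blast
qed

lemma bij_betw_divmod:
  fixes s N :: nat
  assumes "s > 0"
  shows "bij_betw (\<lambda>k. (k div s, k mod s)) {..<N * s} ({..<N} \<times> {..<s})"
proof (rule bij_betw_byWitness[where f' = "\<lambda>(i, j). i * s + j"])
  show "(\<lambda>k. (k div s, k mod s)) ` {..<N * s} \<subseteq> {..<N} \<times> {..<s}"
    using assms by (auto simp: less_mult_imp_div_less)
  show "(\<lambda>(i, j). i * s + j) ` ({..<N} \<times> {..<s}) \<subseteq> {..<N * s}"
  proof (rule image_subsetI)
    fix x assume "x \<in> {..<N} \<times> {..<s}"
    then obtain i j where ij: "x = (i, j)" "Suc i \<le> N" "j < s" by auto
    have "Suc i * s \<le> N * s" using ij(2) by (rule mult_le_mono1)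
    then show "(case x of (i, j) \<Rightarrow> i * s + j) \<in> {..<N * s}" using ij by simp
  qed
qed (use assms in auto)

text \<open>The tower of powers: expand x over q-th powers, then expand the q-th root of each
  coordinate over p-th powers. The new basis elements are
  \<open>mu\<^sub>j\<^sup>q lam\<^sub>i\<close>, with the pair (i, j) encoded as k = i s +
  j.\<close>

lemma (in field) frob_basis_comp:
  assumes p: "Factorial_Ring.prime (p::nat)" "[p] \<cdot> \<one> = \<zero>"
    and A: "frob_basis R (p ^ e) N lam co" and B: "frob_basis R p s mu cm" and "s > 0"
  shows "\<exists>lam co. frob_basis R (p ^ Suc e) (N * s) lam co"
proof -
  interpret A: frob_basis R "p ^ e" N lam co by fact
  interpret B: frob_basis R p s mu cm by fact
  let ?q = "p ^ e"
  have qq: "x [^] (p ^ Suc e) = (x [^] p) [^] ?q" if "x \<in> carrier R" for x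
    using that by (simp add: nat_pow_pow)
  define l where "l = (\<lambda>k. mu (k mod s) [^] ?q \<otimes> lam (k div s))"
  define c where "c = (\<lambda>k x. cm (k mod s) (co (k div s) x))"
  have lt: "k mod s < s" "k div s < N" if "k < N * s" for k
    using that \<open>s > 0\<close> by (auto simp: less_mult_imp_div_less)
  have "frob_basis R (p ^ Suc e) (N * s) l c"
  proof
    fix i j assume ij: "i < N * s" "j < N * s"
    have "c i (l j) = cm (i mod s) (mu (j mod s) \<otimes> co (i div s) (lam (j div s)))"
      unfolding c_def l_def using lt[OF ij(1)] lt[OF ij(2)] by (simp add: A.co_smult A.lam_closed B.lam_closed)
    also have "\<dots> = (if i div s = j div s \<and> i mod s = j mod s then \<one> else \<zero>)"
    proof -
      have "cm (i mod s) \<zero> = \<zero>"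
        using B.co_smult[of "i mod s" \<zero> \<zero>] lt[OF ij(1)] B.co_closed[of "i mod s" \<zero>] by simp
      then show ?thesis using lt[OF ij(1)] lt[OF ij(2)] by (auto simp: A.co_lam B.co_lam B.lam_closed)
    qed
    also have "(i div s = j div s \<and> i mod s = j mod s) \<longleftrightarrow> i = j" by (metis div_mult_mod_eq)
    finally show "c i (l j) = (if i = j then \<one> else \<zero>)" .
  next
    fix i t x assume i: "i < N * s" and tx: "t \<in> carrier R" "x \<in> carrier R"
    show "c i (t [^] (p ^ Suc e) \<otimes> x) = t \<otimes> c i x"
      unfolding c_def qq[OF tx(1)] using lt[OF i] tx by (simp add: A.co_smult B.co_smult A.co_closed)
  next
    fix x assume x: "x \<in> carrier R"
    have c1: "co i x \<in> carrier R" if "i < N" for i using A.co_closed that x by simp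
    have cc: "(cm j (co i x) [^] p) [^] ?q \<otimes> (mu j [^] ?q \<otimes> lam i) \<in> carrier R" if "i < N" "j < s" for i j
      using that c1 by (simp add: B.co_closed B.lam_closed A.lam_closed)
    have "x = finsum R (\<lambda>i. co i x [^] ?q \<otimes> lam i) {..<N}" by (rule A.co_span[OF x])
    also have "\<dots> = finsum R (\<lambda>i. finsum R (\<lambda>j. (cm j (co i x) [^] p) [^] ?q \<otimes> (mu j [^] ?q \<otimes> lam i)) {..<s}) {..<N}"
    proof (intro finsum_cong')
      fix i assume i: "i \<in> {..<N}"
      then have ci: "co i x \<in> carrier R" and li: "lam i \<in> carrier R" using c1 A.lam_closed by auto
      have "co i x [^] ?q = finsum R (\<lambda>j. cm j (co i x) [^] p \<otimes> mu j) {..<s} [^] ?q"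
        using B.co_span[OF ci] by simp
      also have "\<dots> = finsum R (\<lambda>j. (cm j (co i x) [^] p \<otimes> mu j) [^] ?q) {..<s}"
        using ci B.co_closed B.lam_closed by (intro frobenius_finsum[OF p]) auto
      also have "\<dots> \<otimes> lam i = finsum R (\<lambda>j. (cm j (co i x) [^] p \<otimes> mu j) [^] ?q \<otimes> lam i) {..<s}"
        using ci li B.co_closed B.lam_closed by (intro finsum_ldistr) auto
      also have "\<dots> = finsum R (\<lambda>j. (cm j (co i x) [^] p) [^] ?q \<otimes> (mu j [^] ?q \<otimes> lam i)) {..<s}"
        using ci li B.co_closed B.lam_closed by (intro finsum_cong') (auto simp: nat_pow_distrib m_assoc)
      finally show "co i x [^] ?q \<otimes> lam i = finsum R (\<lambda>j. (cm j (co i x) [^] p) [^] ?q \<otimes> (mu j [^] ?q \<otimes> lam i)) {..<s}" .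
    qed (use cc in \<open>auto intro!: finsum_closed\<close>)
    also have "\<dots> = finsum R (\<lambda>(i, j). (cm j (co i x) [^] p) [^] ?q \<otimes> (mu j [^] ?q \<otimes> lam i)) ({..<N} \<times> {..<s})"
      using finsum_Sigma[of "{..<N}" "\<lambda>_. {..<s}" "\<lambda>(i, j). (cm j (co i x) [^] p) [^] ?q \<otimes> (mu j [^] ?q \<otimes> lam i)"] cc by simp
    also have "\<dots> = finsum R (\<lambda>k. c k x [^] (p ^ Suc e) \<otimes> l k) {..<N * s}"
    proof (rule finsum_bij[OF bij_betw_divmod[OF \<open>s > 0\<close>], symmetric])
      fix k assume "k \<in> {..<N * s}"
      then have "cm (k mod s) (co (k div s) x) \<in> carrier R" using lt[of k] c1 B.co_closed by simp
      then show "c k x [^] p ^ Suc e \<otimes> l k =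
         (case (k div s, k mod s) of (i, j) \<Rightarrow> (cm j (co i x) [^] p) [^] p ^ e \<otimes> (mu j [^] p ^ e \<otimes> lam i))"
        by (simp only: c_def l_def split qq)
    qed (use cc in auto)
    finally show "x = finsum R (\<lambda>k. c k x [^] (p ^ Suc e) \<otimes> l k) {..<N * s}" .
  qed (use lt in \<open>auto simp: c_def l_def A.co_closed B.co_closed A.lam_closed B.lam_closed A.co_add B.co_add\<close>)
  then show ?thesis by blast
qed

lemma (in field) frob_basis_exists:
  assumes p: "Factorial_Ring.prime (p::nat)" "[p] \<cdot> \<one> = \<zero>" and dim: "dimension s (pth_powers p R) (carrier R)"
  shows "s > 0" "\<exists>lam co. frob_basis R (p ^ e) (s ^ e) lam co"
proof -
  obtain mu cm where B: "frob_basis R p s mu cm" using frob_basis_prime[OF p dim] by blast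
  interpret B: frob_basis R p s mu cm by fact
  show s: "s > 0"
  proof (rule ccontr)
    assume "\<not> s > 0"
    then have "\<one> = \<zero>" using B.co_span[OF one_closed] by simp
    then show False by simp
  qed
  show "\<exists>lam co. frob_basis R (p ^ e) (s ^ e) lam co"
  proof (induction e)
    case 0
    have "frob_basis R 1 1 (\<lambda>_. \<one>) (\<lambda>_ x. x)"
      by unfold_locales (auto simp: lessThan_Suc)
    then show ?case by auto
  next
    case (Suc e)
    then obtain lam co where "frob_basis R (p ^ e) (s ^ e) lam co" by blast
    then have "\<exists>lam co. frob_basis R (p ^ Suc e) (s ^ e * s) lam co" by (rule frob_basis_comp[OF p _ B s])
    then show ?case by (simp only: power_Suc2)
  qed
qed


section \<open>Upper bound for the free rank\<close>

text \<open>Stated for bare additive maps between different groups, since the functionals and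
  coordinate maps used below are not all ring homomorphisms.\<close>

lemma finsum_additive:
  assumes "abelian_group A" "abelian_group B"
    and cl: "\<And>x. x \<in> carrier A \<Longrightarrow> \<phi> x \<in> carrier B"
    and add: "\<And>x y. x \<in> carrier A \<Longrightarrow> y \<in> carrier A \<Longrightarrow> \<phi> (x \<oplus>\<^bsub>A\<^esub> y) = \<phi> x \<oplus>\<^bsub>B\<^esub> \<phi> y"
    and g: "g \<in> X' \<rightarrow> carrier A"
  shows "\<phi> (finsum A g X') = finsum B (\<lambda>x. \<phi> (g x)) X'"
proof -
  interpret A: abelian_group A by fact
  interpret B: abelian_group B by fact
  have "\<phi> \<zero>\<^bsub>A\<^esub> \<oplus>\<^bsub>B\<^esub> \<phi> \<zero>\<^bsub>A\<^esub> = \<phi> \<zero>\<^bsub>A\<^esub> \<oplus>\<^bsub>B\<^esub> \<zero>\<^bsub>B\<^esub>" using add[of "\<zero>\<^bsub>A\<^esub>" "\<zero>\<^bsub>A\<^esub>"] cl[of "\<zero>\<^bsub>A\<^esub>"] by simp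
  then have z: "\<phi> \<zero>\<^bsub>A\<^esub> = \<zero>\<^bsub>B\<^esub>" using cl[of "\<zero>\<^bsub>A\<^esub>"] by (simp only: B.add.l_cancel A.zero_closed B.zero_closed)
  show ?thesis using g
  proof (induction X' rule: infinite_finite_induct)
    case (insert x F)
    then have gx: "g x \<in> carrier A" "g \<in> F \<rightarrow> carrier A" by auto
    then have c: "finsum A g F \<in> carrier A" "(\<lambda>x. \<phi> (g x)) \<in> F \<rightarrow> carrier B" "\<phi> (g x) \<in> carrier B"
      using cl by (auto intro: A.finsum_closed)
    have "\<phi> (finsum A g (insert x F)) = \<phi> (g x \<oplus>\<^bsub>A\<^esub> finsum A g F)"
      using insert gx by (subst A.finsum_insert) auto
    also have "\<dots> = \<phi> (g x) \<oplus>\<^bsub>B\<^esub> \<phi> (finsum A g F)" using gx c by (intro add)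
    also have "\<dots> = finsum B (\<lambda>x. \<phi> (g x)) (insert x F)"
      using insert gx c by (subst B.finsum_insert) auto
    finally show ?case .
  qed (simp_all add: z)
qed

section \<open>Boxes of exponents and division of exponents by q\<close>

lemma count_sum_replicate:
  assumes "finite I"
  shows "count (\<Sum>j\<in>I. replicate_mset (f j) j) i = (if i \<in> I then f i else 0)"
proof -
  have "count (\<Sum>j\<in>I. replicate_mset (f j) j) i = (\<Sum>j\<in>I. if i = j then f j else 0)"
    by (simp add: count_sum)
  then show ?thesis using assms by simp
qed

lemma bij_box:
  assumes "finite I"
  shows "bij_betw (\<lambda>a. restrict (count a) I) {a :: 'i multiset. set_mset a \<subseteq> I \<and> (\<forall>j\<in>I. count a j < b j)} (PiE I (\<lambda>j. {..<b j}))"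
proof (rule bij_betw_byWitness[where f' = "\<lambda>f. \<Sum>j\<in>I. replicate_mset (f j) j"])
  let ?A = "{a :: 'i multiset. set_mset a \<subseteq> I \<and> (\<forall>j\<in>I. count a j < b j)}"
  show "\<forall>a\<in>?A. (\<Sum>j\<in>I. replicate_mset (restrict (count a) I j) j) = a"
  proof
    fix a assume a: "a \<in> ?A"
    show "(\<Sum>j\<in>I. replicate_mset (restrict (count a) I j) j) = a"
    proof (rule multiset_eqI)
      fix i
      have "i \<notin> I \<Longrightarrow> i \<notin># a" using a by auto
      then show "count (\<Sum>j\<in>I. replicate_mset (restrict (count a) I j) j) i = count a i"
        unfolding count_sum_replicate[OF assms] by (simp add: not_in_iff)
    qed
  qed
  show "\<forall>f\<in>PiE I (\<lambda>j. {..<b j}). restrict (count (\<Sum>j\<in>I. replicate_mset (f j) j)) I = f"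
  proof
    fix f assume f: "f \<in> PiE I (\<lambda>j. {..<b j})"
    show "restrict (count (\<Sum>j\<in>I. replicate_mset (f j) j)) I = f"
    proof
      fix i show "restrict (count (\<Sum>j\<in>I. replicate_mset (f j) j)) I i = f i"
        by (cases "i \<in> I") (simp_all add: count_sum_replicate[OF assms] PiE_arb[OF f])
    qed
  qed
  show "(\<lambda>a. restrict (count a) I) ` ?A \<subseteq> PiE I (\<lambda>j. {..<b j})" by auto
  show "(\<lambda>f. \<Sum>j\<in>I. replicate_mset (f j) j) ` PiE I (\<lambda>j. {..<b j}) \<subseteq> ?A"
  proof (rule image_subsetI)
    fix f assume f: "f \<in> PiE I (\<lambda>j. {..<b j})"
    have "set_mset (\<Sum>j\<in>I. replicate_mset (f j) j) \<subseteq> I"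
    proof
      fix i assume "i \<in># (\<Sum>j\<in>I. replicate_mset (f j) j)"
      then show "i \<in> I" using count_sum_replicate[OF assms, of f i] by (metis count_eq_zero_iff)
    qed
    then show "(\<Sum>j\<in>I. replicate_mset (f j) j) \<in> ?A" using f by (auto simp: count_sum_replicate[OF assms])
  qed
qed

lemma card_box:
  assumes "finite I"
  shows "card {a :: 'i multiset. set_mset a \<subseteq> I \<and> (\<forall>j\<in>I. count a j < b j)} = (\<Prod>j\<in>I. b j)"
  using bij_betw_same_card[OF bij_box[OF assms, of b]] assms by (simp add: card_PiE)

lemma finite_box:
  assumes "finite I"
  shows "finite {a :: 'i multiset. set_mset a \<subseteq> I \<and> (\<forall>j\<in>I. count a j < b j)}"
  using bij_betw_finite[OF bij_box[OF assms, of b]] assms by (simp add: finite_PiE)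

lemma set_repeat_mset_subset: "set_mset (repeat_mset n A) \<subseteq> set_mset A"
proof
  fix x assume "x \<in># repeat_mset n A"
  then have "count (repeat_mset n A) x > 0" by (simp only: count_greater_zero_iff)
  then have "count A x > 0" by simp
  then show "x \<in># A" by (simp only: count_greater_zero_iff)
qed

text \<open>Division with remainder in each variable. With its uniqueness it is the reason why the
  monomials with exponents below q form a basis over the q-th powers.\<close>

lemma mset_div_mod:
  assumes "(q::nat) > 0"
  obtains m a where "M = repeat_mset q m + a" "\<And>j. count a j < q"
proof -
  define m where "m = (\<Sum>j\<in>set_mset M. replicate_mset (count M j div q) j)"
  have cm: "count m j = count M j div q" for j
    unfolding m_def count_sum_replicate[OF finite_set_mset] by (auto simp: not_in_iff)
  have sub: "repeat_mset q m \<subseteq># M" by (simp add: subseteq_mset_def cm)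
  have "M = repeat_mset q m + (M - repeat_mset q m)" using sub by simp
  moreover have "count (M - repeat_mset q m) j < q" for j
    using assms by (simp add: cm minus_mult_div_eq_mod)
  ultimately show thesis using that by blast
qed

lemma mset_div_mod_unique:
  assumes eq: "repeat_mset q m + a = repeat_mset q m' + a'" and "\<And>j. count a j < q" "\<And>j. count a' j < q"
  shows "m = m'" "a = a'"
proof -
  have c: "q * count m j + count a j = q * count m' j + count a' j" for j
    using arg_cong[OF eq, of "\<lambda>x. count x j"] by simp
  have "count m j = count m' j" for j
  proof -
    have "(q * count m j + count a j) div q = (q * count m' j + count a' j) div q" using c by simp
    then show ?thesis using assms(2)[of j] assms(3)[of j] by simp
  qed
  then show "m = m'" by (rule multiset_eqI)
  then show "a = a'" using eq by simp
qed

section \<open>Coordinates on the push-forward of the power series ring\<close>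

locale kfrob = kseries R I + frob_basis R "p ^ e" N lam co
  for R :: "('a, 'm) ring_scheme" (structure) and I :: "'i::wellorder set" and p e N :: nat
    and lam :: "nat \<Rightarrow> 'a" and co :: "nat \<Rightarrow> 'a \<Rightarrow> 'a" +
  assumes prime_p: "Factorial_Ring.prime p" and char_p: "[p] \<cdot> \<one> = \<zero>"
begin

abbreviation q where "q \<equiv> p ^ e"

lemma q_pos: "q > 0" using prime_gt_0_nat[OF prime_p] by simp

lemma zero_pow_q: "\<zero> [^] q = \<zero>" using q_pos by (simp add: nat_pow_zero)

lemma S_char: "[p] \<cdot>\<^bsub>S\<^esub> \<one>\<^bsub>S\<^esub> = \<zero>\<^bsub>S\<^esub>"
proof -
  have "([k] \<cdot>\<^bsub>S\<^esub> \<one>\<^bsub>S\<^esub>) m = [k] \<cdot> (\<one>\<^bsub>S\<^esub> m)" for k :: nat and m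
    by (induction k) (auto simp: ps_simps)
  then show ?thesis using char_p by (auto simp: ps_simps fun_eq_iff)
qed

lemma co_zero: "i < N \<Longrightarrow> co i \<zero> = \<zero>"
  using co_smult[of i \<zero> \<zero>] co_closed[of i \<zero>] by simp

text \<open>For the coefficient at \<open>m\<close>, g may be replaced by its truncation at the
  degree of \<open>m\<close>: that is a finite sum, on which Frobenius acts term by term, and the
  q-th power of the rest has order above the degree of \<open>m\<close>. The index set is finite for
  the same reason.\<close>

lemma frob_coeff_aux:
  assumes g: "g \<in> carrier S"
  shows "(g [^]\<^bsub>S\<^esub> q) m = finsum R (\<lambda>k. if m = repeat_mset q k then g k [^] q else \<zero>) {k. set_mset k \<subseteq> I \<and> size k < Suc (size m)}"
proof -
  let ?A = "{k. set_mset k \<subseteq> I \<and> size k < Suc (size m)}"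
  have fin: "finite ?A" by (rule finite_monomials[OF finI])
  have gc: "g k \<in> carrier R" for k using ps_carrierD(1)[OF g] .
  have mc: "pmono R (g k) k \<in> carrier S" if "k \<in> ?A" for k using gc that by auto
  have rc: "pmono R (g k [^] q) (repeat_mset q k) \<in> carrier S" if "k \<in> ?A" for k
    using gc that set_repeat_mset_subset[of q k] by (intro pmono_closed) auto
  define g' where "g' = finsum S (\<lambda>k. pmono R (g k) k) ?A"
  have g': "g' \<in> carrier S" unfolding g'_def using mc by (intro S.finsum_closed) auto
  define d where "d = g \<ominus>\<^bsub>S\<^esub> g'"
  have d: "d \<in> carrier S" using g g' by (simp add: d_def)
  have g'k: "g' k = g k" if k: "size k \<le> size m" for k
  proof -
    have "g' k = finsum R (\<lambda>k'. pmono R (g k') k' k) ?A" unfolding g'_def using mc by (intro ps_finsum) auto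
    also have "\<dots> = g k"
    proof (cases "set_mset k \<subseteq> I")
      case True
      have "finsum R (\<lambda>k'. pmono R (g k') k' k) ?A = pmono R (g k) k k"
        using fin True k gc by (intro finsum_only) (auto simp: pmono_def)
      then show ?thesis by (simp add: pmono_def)
    next
      case False
      have "finsum R (\<lambda>k'. pmono R (g k') k' k) ?A = \<zero>"
        using False by (intro finsum_all_zero) (auto simp: pmono_def)
      then show ?thesis using ps_carrierD(2)[OF g False] by simp
    qed
    finally show ?thesis .
  qed
  have do: "d \<in> ord_ge (Suc (size m))"
    unfolding ord_ge_def d_def a_minus_def ps_simps(4) using g'k gc by (auto simp: ps_minus[OF g'] r_neg)
  have dq: "d [^]\<^bsub>S\<^esub> q \<in> ord_ge (Suc (size m))"
  proof -
    \<comment> \<open>One factor \<open>d\<close> already supplies the order; the remaining factors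
      only have to lie in the ring.\<close>
    obtain q' where q': "q = Suc q'" using q_pos gr0_conv_Suc by blast
    show ?thesis unfolding q' S.nat_pow_Suc using d do by (intro ord_ge_mult_l) auto
  qed
  have "g = g' \<oplus>\<^bsub>S\<^esub> d" unfolding d_def using g g' S.a_lcomm[of g' g "\<ominus>\<^bsub>S\<^esub> g'"] by (simp add: a_minus_def S.r_neg)
  then have "g [^]\<^bsub>S\<^esub> q = g' [^]\<^bsub>S\<^esub> q \<oplus>\<^bsub>S\<^esub> d [^]\<^bsub>S\<^esub> q"
    using S.frobenius_add[OF prime_p S_char g' d, of e] by simp
  then have "(g [^]\<^bsub>S\<^esub> q) m = (g' [^]\<^bsub>S\<^esub> q) m"
    using ord_geD[OF dq, of m] ps_carrierD(1)[OF S.nat_pow_closed[OF g']] by (simp add: ps_simps(4))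
  also have "g' [^]\<^bsub>S\<^esub> q = finsum S (\<lambda>k. pmono R (g k) k [^]\<^bsub>S\<^esub> q) ?A"
    unfolding g'_def using mc by (intro S.frobenius_finsum[OF prime_p S_char]) auto
  also have "\<dots> = finsum S (\<lambda>k. pmono R (g k [^] q) (repeat_mset q k)) ?A"
  proof (intro S.finsum_cong')
    fix k assume "k \<in> ?A"
    then show "pmono R (g k) k [^]\<^bsub>S\<^esub> q = pmono R (g k [^] q) (repeat_mset q k)" using gc by (intro pmono_pow) auto
  qed (use rc in auto)
  also have "\<dots> m = finsum R (\<lambda>k. pmono R (g k [^] q) (repeat_mset q k) m) ?A"
    using rc by (intro ps_finsum) auto
  also have "\<dots> = finsum R (\<lambda>k. if m = repeat_mset q k then g k [^] q else \<zero>) ?A"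
    by (simp add: pmono_def)
  finally show ?thesis .
qed

lemma frob_coeff:
  assumes g: "g \<in> carrier S"
  shows "(g [^]\<^bsub>S\<^esub> q) (repeat_mset q k) = g k [^] q"
proof -
  let ?m = "repeat_mset q k"
  let ?A = "{k. set_mset k \<subseteq> I \<and> size k < Suc (size ?m)}"
  have inj: "repeat_mset q k = repeat_mset q k' \<longleftrightarrow> k = k'" for k'
    using q_pos by (auto simp only: repeat_mset_cancel1)
  have "(g [^]\<^bsub>S\<^esub> q) ?m = finsum R (\<lambda>k'. if ?m = repeat_mset q k' then g k' [^] q else \<zero>) ?A"
    by (rule frob_coeff_aux[OF g])
  also have "\<dots> = g k [^] q"
  proof (cases "set_mset k \<subseteq> I")
    case True
    have "1 * size k \<le> q * size k" using q_pos by (intro mult_le_mono1) linarith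
    then have "size k < Suc (size ?m)" by (simp only: mult_1 size_repeat_mset less_Suc_eq_le)
    then have "finsum R (\<lambda>k'. if ?m = repeat_mset q k' then g k' [^] q else \<zero>) ?A = (if ?m = repeat_mset q k then g k [^] q else \<zero>)"
      using True finite_monomials[OF finI] ps_carrierD(1)[OF g] by (intro finsum_only) (auto simp: inj)
    then show ?thesis by simp
  next
    case False
    then have "finsum R (\<lambda>k'. if ?m = repeat_mset q k' then g k' [^] q else \<zero>) ?A = \<zero>"
      by (intro finsum_all_zero) (auto simp: inj)
    then show ?thesis using ps_carrierD(2)[OF g False] zero_pow_q by simp
  qed
  finally show ?thesis .
qed

lemma frob_coeff_zero:
  assumes "g \<in> carrier S" "\<And>k. m \<noteq> repeat_mset q k"
  shows "(g [^]\<^bsub>S\<^esub> q) m = \<zero>"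
  unfolding frob_coeff_aux[OF assms(1)] using assms(2) by (intro finsum_all_zero) auto

text \<open>The q-th power of s has only exponents divisible by q. Since a stays below q in every
  variable, a divisor q k of the exponent q m + a must have k dividing m.\<close>

lemma frob_mult_section:
  assumes s: "s \<in> carrier S" and x: "x \<in> carrier S" and a: "\<And>j. count a j < q"
  shows "(s [^]\<^bsub>S\<^esub> q \<otimes>\<^bsub>S\<^esub> x) (repeat_mset q m + a) =
    finsum R (\<lambda>k. s k [^] q \<otimes> x (repeat_mset q (m - k) + a)) {k. k \<subseteq># m}"
proof -
  let ?M = "repeat_mset q m + a"
  have sc: "(s [^]\<^bsub>S\<^esub> q) b \<in> carrier R" "x b \<in> carrier R" "s b \<in> carrier R" for b
    using ps_carrierD(1)[OF S.nat_pow_closed[OF s]] ps_carrierD(1)[OF x] ps_carrierD(1)[OF s] by auto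
  have sub: "repeat_mset q k \<subseteq># ?M \<longleftrightarrow> k \<subseteq># m" for k
  proof
    assume k: "repeat_mset q k \<subseteq># ?M"
    have "count k j \<le> count m j" for j
    proof -
      have "q * count k j \<le> q * count m j + count a j" using k by (auto simp: subseteq_mset_def dest: spec[of _ j])
      also have "\<dots> < q * Suc (count m j)" using a[of j] by simp
      finally have "count k j < Suc (count m j)" using mult_less_cancel1 by blast
      then show ?thesis by simp
    qed
    then show "k \<subseteq># m" by (simp add: subseteq_mset_def)
  next
    assume "k \<subseteq># m"
    then show "repeat_mset q k \<subseteq># ?M" by (auto simp: subseteq_mset_def intro!: trans_le_add1 mult_le_mono2)
  qed
  have "(s [^]\<^bsub>S\<^esub> q \<otimes>\<^bsub>S\<^esub> x) ?M = finsum R (\<lambda>b. (s [^]\<^bsub>S\<^esub> q) b \<otimes> x (?M - b)) {b. b \<subseteq># ?M}"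
    by (simp add: ps_simps(1))
  also have "\<dots> = finsum R (\<lambda>b. (s [^]\<^bsub>S\<^esub> q) b \<otimes> x (?M - b)) (repeat_mset q ` {k. k \<subseteq># m})"
  proof (rule finsum_neutral)
    show "repeat_mset q ` {k. k \<subseteq># m} \<subseteq> {b. b \<subseteq># ?M}" using sub by auto
    fix b assume b: "b \<in> {b. b \<subseteq># ?M} - repeat_mset q ` {k. k \<subseteq># m}"
    have "(s [^]\<^bsub>S\<^esub> q) b = \<zero>"
    proof (rule frob_coeff_zero[OF s])
      fix k show "b \<noteq> repeat_mset q k" using b sub[of k] by auto
    qed
    then show "(s [^]\<^bsub>S\<^esub> q) b \<otimes> x (?M - b) = \<zero>" using sc by simp
  qed (use sc in auto)
  also have "\<dots> = finsum R (\<lambda>k. s k [^] q \<otimes> x (repeat_mset q (m - k) + a)) {k. k \<subseteq># m}"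
  proof (rule finsum_bij[symmetric])
    show "bij_betw (repeat_mset q) {k. k \<subseteq># m} (repeat_mset q ` {k. k \<subseteq># m})"
      using q_pos by (auto simp: bij_betw_def inj_on_def repeat_mset_cancel1)
    fix k assume k: "k \<in> {k. k \<subseteq># m}"
    have "repeat_mset q (m - k) + a = ?M - repeat_mset q k"
    proof (rule multiset_eqI)
      fix j
      have "q * count k j \<le> q * count m j" using k by (auto simp: subseteq_mset_def)
      then show "count (repeat_mset q (m - k) + a) j = count (?M - repeat_mset q k) j"
        by (simp add: diff_mult_distrib2)
    qed
    then show "s k [^] q \<otimes> x (repeat_mset q (m - k) + a) = (s [^]\<^bsub>S\<^esub> q) (repeat_mset q k) \<otimes> x (?M - repeat_mset q k)"
      using frob_coeff[OF s] by simp
  qed (use sc in auto)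
  finally show ?thesis .
qed

text \<open>The coordinate of \<open>F\<^sub>*\<^sup>e x\<close> at the basis element \<open>F\<^sub>*\<^sup>e(lam i \<cdot> x\<^sup>a)\<close> of the free \<open>S\<close>-module \<open>F\<^sub>*\<^sup>e S\<close>.\<close>

definition tr :: "nat \<Rightarrow> 'i multiset \<Rightarrow> ('i multiset \<Rightarrow> 'a) \<Rightarrow> 'i multiset \<Rightarrow> 'a" where
  "tr i a x = (\<lambda>m. co i (x (repeat_mset q m + a)))"

lemma tr_closed:
  assumes "i < N" "x \<in> carrier S"
  shows "tr i a x \<in> carrier S"
proof (rule ps_carrierI)
  fix m assume m: "\<not> set_mset m \<subseteq> I"
  have "set_mset m \<subseteq> set_mset (repeat_mset q m + a)"
  proof
    fix j assume "j \<in># m"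
    then have "count (repeat_mset q m + a) j > 0" using q_pos by simp
    then show "j \<in># repeat_mset q m + a" by (simp only: count_greater_zero_iff)
  qed
  then have "\<not> set_mset (repeat_mset q m + a) \<subseteq> I" using m by blast
  then show "tr i a x m = \<zero>" unfolding tr_def using ps_carrierD(2)[OF assms(2)] co_zero[OF assms(1)] by simp
qed (use assms in \<open>simp_all add: tr_def co_closed ps_carrierD\<close>)

lemma tr_add:
  assumes "i < N" "x \<in> carrier S" "y \<in> carrier S"
  shows "tr i a (x \<oplus>\<^bsub>S\<^esub> y) = tr i a x \<oplus>\<^bsub>S\<^esub> tr i a y"
  using assms by (simp add: fun_eq_iff tr_def ps_simps(4) co_add ps_carrierD)

text \<open>The coefficients of the product at exponents q m + a form a convolution with the q-th
  powers \<open>s k [^] q\<close>, from which \<open>co i\<close> extracts the roots.\<close>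

lemma tr_semilinear:
  assumes i: "i < N" and s: "s \<in> carrier S" and x: "x \<in> carrier S" and a: "\<And>j. count a j < q"
  shows "tr i a (s [^]\<^bsub>S\<^esub> q \<otimes>\<^bsub>S\<^esub> x) = s \<otimes>\<^bsub>S\<^esub> tr i a x"
proof
  fix m
  have sc: "x b \<in> carrier R" "s b \<in> carrier R" for b
    using ps_carrierD(1)[OF x] ps_carrierD(1)[OF s] by auto
  have "tr i a (s [^]\<^bsub>S\<^esub> q \<otimes>\<^bsub>S\<^esub> x) m = co i (finsum R (\<lambda>k. s k [^] q \<otimes> x (repeat_mset q (m - k) + a)) {k. k \<subseteq># m})"
    unfolding tr_def frob_mult_section[OF s x a] ..
  also have "\<dots> = finsum R (\<lambda>k. co i (s k [^] q \<otimes> x (repeat_mset q (m - k) + a))) {k. k \<subseteq># m}"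
    using i sc by (intro finsum_additive[of R R "co i"]) (auto intro!: abelian_group_axioms co_closed co_add)
  also have "\<dots> = finsum R (\<lambda>k. s k \<otimes> tr i a x (m - k)) {k. k \<subseteq># m}"
    unfolding tr_def using i sc by (intro finsum_cong') (auto simp: co_smult co_closed)
  also have "\<dots> = (s \<otimes>\<^bsub>S\<^esub> tr i a x) m" by (simp add: ps_simps(1))
  finally show "tr i a (s [^]\<^bsub>S\<^esub> q \<otimes>\<^bsub>S\<^esub> x) m = (s \<otimes>\<^bsub>S\<^esub> tr i a x) m" .
qed

definition box :: "'i multiset set" where
  "box = {a. set_mset a \<subseteq> I \<and> (\<forall>j\<in>I. count a j < q)}"

lemma box_count: "a \<in> box \<Longrightarrow> count a j < q"
proof (cases "j \<in> I")
  case False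
  assume "a \<in> box"
  then have "j \<notin># a" using False by (auto simp: box_def)
  then have "count a j = 0" by (simp add: not_in_iff)
  then show ?thesis using q_pos by simp
qed (simp add: box_def)

lemma finite_box': "finite box" unfolding box_def by (rule finite_box[OF finI])

text \<open>Write M = q m + a. By uniqueness of the remainder only basis elements with exponent a
  contribute at M, and their sum over i is the expansion of \<open>x M\<close> in the basis
  \<open>lam\<close>.\<close>

lemma tr_span:
  assumes x: "x \<in> carrier S"
  shows "x = finsum S (\<lambda>(i, a). tr i a x [^]\<^bsub>S\<^esub> q \<otimes>\<^bsub>S\<^esub> pmono R (lam i) a) ({..<N} \<times> box)"
proof
  fix M :: "'i multiset"
  let ?X = "{..<N} \<times> box"
  let ?t = "\<lambda>(i, a). tr i a x [^]\<^bsub>S\<^esub> q \<otimes>\<^bsub>S\<^esub> pmono R (lam i) a"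
  have xc: "x b \<in> carrier R" for b using ps_carrierD(1)[OF x] .
  have lc: "pmono R (lam i) a \<in> carrier S" if "i < N" "a \<in> box" for i a
    using that lam_closed by (auto simp: box_def)
  have tc: "?t \<in> ?X \<rightarrow> carrier S" using lc x tr_closed by auto
  obtain m a where M: "M = repeat_mset q m + a" "\<And>j. count a j < q"
    using mset_div_mod[OF q_pos] by blast
  have val: "?t (i, b) M = (if b = a then co i (x M) [^] q \<otimes> lam i else \<zero>)" if ib: "i < N" "b \<in> box" for i b
  proof -
    have bc: "count b j < q" for j using box_count ib by simp
    have trc: "tr i b x \<in> carrier S" using ib x tr_closed by simp
    have "?t (i, b) M = (pmono R (lam i) b \<otimes>\<^bsub>S\<^esub> tr i b x [^]\<^bsub>S\<^esub> q) M"
      using S.m_comm[OF S.nat_pow_closed[OF trc] lc[OF ib]] by simp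
    also have "\<dots> = (if b \<subseteq># M then lam i \<otimes> (tr i b x [^]\<^bsub>S\<^esub> q) (M - b) else \<zero>)"
      by (rule pmono_mult[OF lam_closed[OF ib(1)] S.nat_pow_closed[OF trc]])
    also have "\<dots> = (if b = a then co i (x M) [^] q \<otimes> lam i else \<zero>)"
    proof (cases "b = a")
      case True
      then have "b \<subseteq># M" "M - b = repeat_mset q m" using M(1) by auto
      then have "lam i \<otimes> (tr i b x [^]\<^bsub>S\<^esub> q) (M - b) = lam i \<otimes> (tr i b x m) [^] q"
        using frob_coeff[OF trc] by simp
      also have "\<dots> = co i (x M) [^] q \<otimes> lam i"
        unfolding tr_def True M(1)[symmetric] using ib xc by (intro m_comm) (auto intro: lam_closed co_closed)
      finally show ?thesis using True \<open>b \<subseteq># M\<close> by simp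
    next
      case False
      have "(tr i b x [^]\<^bsub>S\<^esub> q) (M - b) = \<zero>" if "b \<subseteq># M"
      proof (rule frob_coeff_zero[OF trc])
        fix k
        show "M - b \<noteq> repeat_mset q k"
        proof
          assume "M - b = repeat_mset q k"
          then have "M = repeat_mset q k + b" using that by (metis subset_mset.diff_add)
          then show False using mset_div_mod_unique(2)[of q m a k b] M bc False by simp
        qed
      qed
      then show ?thesis using False ib by (simp add: lam_closed)
    qed
    finally show ?thesis .
  qed
  have "finsum S ?t ?X M = finsum R (\<lambda>y. ?t y M) ?X" using tc by (rule ps_finsum)
  also have "\<dots> = finsum R (\<lambda>(i, b). if b = a then co i (x M) [^] q \<otimes> lam i else \<zero>) ?X"
    using val xc by (intro finsum_cong') (auto simp: co_closed lam_closed)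
  also have "\<dots> = finsum R (\<lambda>i. finsum R (\<lambda>b. if b = a then co i (x M) [^] q \<otimes> lam i else \<zero>) box) {..<N}"
    using finsum_Sigma[of "{..<N}" "\<lambda>_. box" "\<lambda>(i, b). if b = a then co i (x M) [^] q \<otimes> lam i else \<zero>"]
      finite_box' xc by (simp add: co_closed lam_closed)
  also have "\<dots> = x M"
  proof (cases "a \<in> box")
    case True
    have "finsum R (\<lambda>i. finsum R (\<lambda>b. if b = a then co i (x M) [^] q \<otimes> lam i else \<zero>) box) {..<N}
        = finsum R (\<lambda>i. co i (x M) [^] q \<otimes> lam i) {..<N}"
    proof (intro finsum_cong')
      fix i assume i: "i \<in> {..<N}"
      have "finsum R (\<lambda>b. if b = a then co i (x M) [^] q \<otimes> lam i else \<zero>) box = (if a = a then co i (x M) [^] q \<otimes> lam i else \<zero>)"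
        using True finite_box' i xc by (intro finsum_only) (auto simp: co_closed lam_closed)
      then show "finsum R (\<lambda>b. if b = a then co i (x M) [^] q \<otimes> lam i else \<zero>) box = co i (x M) [^] q \<otimes> lam i" by simp
    qed (use xc in \<open>auto simp: co_closed lam_closed\<close>)
    then show ?thesis using co_span[OF xc[of M]] by simp
  next
    case False
    then have "\<not> set_mset M \<subseteq> I" using M by (auto simp: box_def)
    then have xM: "x M = \<zero>" using ps_carrierD(2)[OF x] by blast
    have "finsum R (\<lambda>i. finsum R (\<lambda>b. if b = a then co i (x M) [^] q \<otimes> lam i else \<zero>) box) {..<N} = \<zero>"
      using False by (intro finsum_all_zero) auto
    then show ?thesis using xM by simp
  qed
  finally show "x M = finsum S ?t ?X M" by simp
qed

text \<open>With D the exponent of f, these are the a for which the monomial a times f^u still has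
  all exponents below q. The levels u = h and u = h + 1 belong to the generators without and with
  z.\<close>

definition cell :: "'i multiset \<Rightarrow> nat \<Rightarrow> 'i multiset set" where
  "cell D u = {a. set_mset a \<subseteq> I \<and> (\<forall>j\<in>I. count a j + u * count D j < q)}"

lemma cell_sub_box: "cell D u \<subseteq> box"
  unfolding cell_def box_def by (auto intro: le_less_trans[OF le_add1])

lemma finite_cell: "finite (cell D u)"
  by (rule finite_subset[OF cell_sub_box finite_box'])

text \<open>Compare the \<open>z\<close>-components of \<open>z \<phi>(E) = x\<^sub>j \<phi>(E')\<close>, where \<open>z (u + v z) = c v + u z\<close>.\<close>

lemma functional_vanishes:
  fixes c defines "Q \<equiv> quad_ring S c"
  assumes c: "c \<in> carrier S" "c {#} = \<zero>" and j: "j \<in> I"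
    and cl: "\<And>x. x \<in> carrier Q \<Longrightarrow> \<phi> x \<in> carrier Q"
    and sl: "\<And>a x. a \<in> carrier Q \<Longrightarrow> x \<in> carrier Q \<Longrightarrow> \<phi> (a [^]\<^bsub>Q\<^esub> q \<otimes>\<^bsub>Q\<^esub> x) = a \<otimes>\<^bsub>Q\<^esub> \<phi> x"
    and E: "E \<in> carrier Q" "E' \<in> carrier Q"
    and eq: "(\<zero>\<^bsub>S\<^esub>, \<one>\<^bsub>S\<^esub>) [^]\<^bsub>Q\<^esub> q \<otimes>\<^bsub>Q\<^esub> E = (pmono R \<one> {#j#}, \<zero>\<^bsub>S\<^esub>) [^]\<^bsub>Q\<^esub> q \<otimes>\<^bsub>Q\<^esub> E'"
  shows "fst (\<phi> E) {#} = \<zero>"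
proof -
  have xc: "pmono R \<one> {#j#} \<in> carrier S" using j by simp
  have "(\<zero>\<^bsub>S\<^esub>, \<one>\<^bsub>S\<^esub>) \<otimes>\<^bsub>Q\<^esub> \<phi> E = (pmono R \<one> {#j#}, \<zero>\<^bsub>S\<^esub>) \<otimes>\<^bsub>Q\<^esub> \<phi> E'"
  proof -
    have "\<phi> ((\<zero>\<^bsub>S\<^esub>, \<one>\<^bsub>S\<^esub>) [^]\<^bsub>Q\<^esub> q \<otimes>\<^bsub>Q\<^esub> E) = (\<zero>\<^bsub>S\<^esub>, \<one>\<^bsub>S\<^esub>) \<otimes>\<^bsub>Q\<^esub> \<phi> E"
      using E by (intro sl) (auto simp: Q_def)
    moreover have "\<phi> ((pmono R \<one> {#j#}, \<zero>\<^bsub>S\<^esub>) [^]\<^bsub>Q\<^esub> q \<otimes>\<^bsub>Q\<^esub> E') = (pmono R \<one> {#j#}, \<zero>\<^bsub>S\<^esub>) \<otimes>\<^bsub>Q\<^esub> \<phi> E'"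
      using E xc by (intro sl) (auto simp: Q_def)
    ultimately show ?thesis using eq by simp
  qed
  moreover obtain u v u' v' where uv: "\<phi> E = (u, v)" "\<phi> E' = (u', v')" "u \<in> carrier S" "v \<in> carrier S" "u' \<in> carrier S" "v' \<in> carrier S"
    using cl[OF E(1)] cl[OF E(2)] by (auto simp: Q_def)
  ultimately have "u = pmono R \<one> {#j#} \<otimes>\<^bsub>S\<^esub> v'"
    unfolding Q_def using xc c by simp
  then have "u {#} = \<zero>" using pmono_mult[OF one_closed uv(6), of "{#j#}" "{#}"] by simp
  then show ?thesis using uv by simp
qed

text \<open>A functional followed by the residue map is determined by its values on the generators
  in \<open>J\<close>, as the others go to zero. With more than \<open>card J\<close> functionals, a
  nontrivial combination has zero residue everywhere, which contradicts the dual elements.\<close>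

lemma frob_dual_le:
  assumes D: "set_mset D \<subseteq> I" "D \<noteq> {#}" and h: "q = 2 * h + 1"
    and dual: "frob_dual q (quad_ring S (pmono R (\<ominus> \<one>) D)) r"
  shows "r \<le> N * (card (cell D h) + card (cell D (h + 1)))"
proof (rule ccontr)
  assume contra: "\<not> r \<le> N * (card (cell D h) + card (cell D (h + 1)))"
  define c where "c = pmono R (\<ominus> \<one>) D"
  define Q where "Q = quad_ring S c"
  have c: "c \<in> carrier S" "c {#} = \<zero>"
    using D(1) pmono_closed[of "\<ominus> \<one>" D I] D(2) by (simp_all add: c_def) (simp add: pmono_def)
  interpret Q: cring Q unfolding Q_def by (rule S.quad_cring[OF c(1)])
  have Qc: "x \<in> carrier Q \<longleftrightarrow> fst x \<in> carrier S \<and> snd x \<in> carrier S" for x by (cases x) (simp add: Q_def)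
  obtain y \<phi> where y: "\<And>i. i < r \<Longrightarrow> y i \<in> carrier Q"
    and \<phi>: "\<And>i x. i < r \<Longrightarrow> x \<in> carrier Q \<Longrightarrow> \<phi> i x \<in> carrier Q"
    "\<And>i x x'. i < r \<Longrightarrow> x \<in> carrier Q \<Longrightarrow> x' \<in> carrier Q \<Longrightarrow> \<phi> i (x \<oplus>\<^bsub>Q\<^esub> x') = \<phi> i x \<oplus>\<^bsub>Q\<^esub> \<phi> i x'"
    "\<And>i a x. i < r \<Longrightarrow> a \<in> carrier Q \<Longrightarrow> x \<in> carrier Q \<Longrightarrow> \<phi> i (a [^]\<^bsub>Q\<^esub> q \<otimes>\<^bsub>Q\<^esub> x) = a \<otimes>\<^bsub>Q\<^esub> \<phi> i x"
    "\<And>i j. i < r \<Longrightarrow> j < r \<Longrightarrow> \<phi> i (y j) = (if i = j then \<one>\<^bsub>Q\<^esub> else \<zero>\<^bsub>Q\<^esub>)"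
    using dual unfolding c_def[symmetric] Q_def[symmetric] by (rule frob_dualE) (rule that)
  define \<epsilon> where "\<epsilon> = (\<lambda>x :: ('i multiset \<Rightarrow> 'a) \<times> ('i multiset \<Rightarrow> 'a). fst x {#})"
  have \<epsilon>: "\<epsilon> \<in> ring_hom Q R" unfolding \<epsilon>_def Q_def by (rule quad_eps_hom[OF c])
  \<comment> \<open>The index \<open>True\<close> marks the generators with the factor z,
    \<open>False\<close> those without.\<close>
  define en where "en = (\<lambda>(t, i, a). if t then (\<zero>\<^bsub>S\<^esub>, pmono R (lam i) a) else (pmono R (lam i) a, \<zero>\<^bsub>S\<^esub>))"
  define T where "T = (\<lambda>x (t, i, a). tr i a (if t then snd x else fst x))"
  define F where "F = (UNIV :: bool set) \<times> ({..<N} \<times> box)"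
  \<comment> \<open>The generators that can have a nonzero residue. Applying z^q multiplies by c^h,
    and on generators containing z by one more factor c.\<close>
  define J where "J = Sigma (UNIV :: bool set) (\<lambda>t. {..<N} \<times> (if t then cell D (h + 1) else cell D h))"
  have Ffin: "finite F" using finite_box' by (simp add: F_def)
  have JF: "J \<subseteq> F" by (auto simp: J_def F_def split: if_splits dest: subsetD[OF cell_sub_box])
  have Jfin: "finite J" using JF Ffin finite_subset by blast
  have cardJ: "card J = N * (card (cell D h) + card (cell D (h + 1)))"
    unfolding J_def by (subst card_SigmaI) (auto simp: UNIV_bool finite_cell card_cartesian_product algebra_simps)
  have mc: "pmono R (lam i) a \<in> carrier S" if "i < N" "a \<in> box" for i a
    using that lam_closed by (auto simp: box_def)
  have enc: "en f \<in> carrier Q" if "f \<in> F" for f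
    using that mc by (auto simp: F_def en_def Q_def)
  have Tc: "T x f \<in> carrier S" if "x \<in> carrier Q" "f \<in> F" for x f
    using that tr_closed by (auto simp: F_def T_def Qc)
  have span: "x = finsum Q (\<lambda>f. (T x f, \<zero>\<^bsub>S\<^esub>) [^]\<^bsub>Q\<^esub> q \<otimes>\<^bsub>Q\<^esub> en f) F" if x: "x \<in> carrier Q" for x
  proof -
    let ?g = "\<lambda>f. (T x f, \<zero>\<^bsub>S\<^esub>) [^]\<^bsub>Q\<^esub> q \<otimes>\<^bsub>Q\<^esub> en f"
    have g_eq: "?g (t, i, a) = (if t then (\<zero>\<^bsub>S\<^esub>, tr i a (snd x) [^]\<^bsub>S\<^esub> q \<otimes>\<^bsub>S\<^esub> pmono R (lam i) a)
        else (tr i a (fst x) [^]\<^bsub>S\<^esub> q \<otimes>\<^bsub>S\<^esub> pmono R (lam i) a, \<zero>\<^bsub>S\<^esub>))" if "i < N" "a \<in> box" for t i a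
    proof -
      have tc: "tr i a (snd x) \<in> carrier S" "tr i a (fst x) \<in> carrier S" using that x tr_closed by (auto simp: Qc)
      show ?thesis
        using tc mc[OF that] c(1) S.quad_pow_embed[OF c(1) tc(1)] S.quad_pow_embed[OF c(1) tc(2)]
        by (simp add: T_def en_def Q_def)
    qed
    have gc: "?g \<in> F \<rightarrow> carrier Q"
    proof
      fix f assume f: "f \<in> F"
      have "(T x f, \<zero>\<^bsub>S\<^esub>) \<in> carrier Q" using Tc[OF x f] by (simp add: Q_def)
      then show "?g f \<in> carrier Q" using enc[OF f] by simp
    qed
    have tt: "(\<lambda>(i, a). tr i a s [^]\<^bsub>S\<^esub> q \<otimes>\<^bsub>S\<^esub> pmono R (lam i) a) \<in> {..<N} \<times> box \<rightarrow> carrier S" if "s \<in> carrier S" for s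
      using that mc tr_closed by auto
    have ttc: "tr i a (fst x) [^]\<^bsub>S\<^esub> q \<otimes>\<^bsub>S\<^esub> pmono R (lam i) a \<in> carrier S"
      "tr i a (snd x) [^]\<^bsub>S\<^esub> q \<otimes>\<^bsub>S\<^esub> pmono R (lam i) a \<in> carrier S" if "i < N" "a \<in> box" for i a
      using x that mc[OF that] tr_closed[of i] by (auto simp: Qc)
    have "fst (finsum Q ?g F) = finsum S (\<lambda>f. fst (?g f)) F"
      using gc by (intro finsum_additive[where A = Q and B = S and \<phi> = fst] Q.abelian_group_axioms S.abelian_group_axioms) (auto simp: Q_def)
    also have "\<dots> = finsum S (\<lambda>f. fst (?g f)) ({False} \<times> ({..<N} \<times> box))"
      using Ffin g_eq ttc by (intro S.finsum_neutral) (auto simp: F_def)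
    also have "\<dots> = finsum S (\<lambda>(i, a). tr i a (fst x) [^]\<^bsub>S\<^esub> q \<otimes>\<^bsub>S\<^esub> pmono R (lam i) a) ({..<N} \<times> box)"
      using tt[of "fst x"] x g_eq by (intro S.finsum_bij[of snd]) (auto simp: Qc bij_betw_def inj_on_def)
    also have "\<dots> = fst x" using tr_span[of "fst x"] x by (simp add: Qc)
    finally have 1: "fst (finsum Q ?g F) = fst x" .
    have "snd (finsum Q ?g F) = finsum S (\<lambda>f. snd (?g f)) F"
      using gc by (intro finsum_additive[where A = Q and B = S and \<phi> = snd] Q.abelian_group_axioms S.abelian_group_axioms) (auto simp: Q_def)
    also have "\<dots> = finsum S (\<lambda>f. snd (?g f)) ({True} \<times> ({..<N} \<times> box))"
      using Ffin g_eq ttc by (intro S.finsum_neutral) (auto simp: F_def)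
    also have "\<dots> = finsum S (\<lambda>(i, a). tr i a (snd x) [^]\<^bsub>S\<^esub> q \<otimes>\<^bsub>S\<^esub> pmono R (lam i) a) ({..<N} \<times> box)"
      using tt[of "snd x"] x g_eq by (intro S.finsum_bij[of snd]) (auto simp: Qc bij_betw_def inj_on_def)
    also have "\<dots> = snd x" using tr_span[of "snd x"] x by (simp add: Qc)
    finally show ?thesis using 1 by (simp add: prod_eq_iff)
  qed
  have zq: "(\<zero>\<^bsub>S\<^esub>, \<one>\<^bsub>S\<^esub>) [^]\<^bsub>Q\<^esub> q = (\<zero>\<^bsub>S\<^esub>, c [^]\<^bsub>S\<^esub> h)" unfolding Q_def h by (rule S.quad_pow_z[OF c(1)])
  have cpow: "c [^]\<^bsub>S\<^esub> k = pmono R ((\<ominus> \<one>) [^] k) (repeat_mset k D)" for k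
    unfolding c_def using D by (intro pmono_pow) auto
  have xpow: "(pmono R \<one> {#j#}, \<zero>\<^bsub>S\<^esub>) [^]\<^bsub>Q\<^esub> q = (pmono R \<one> (repeat_mset q {#j#}), \<zero>\<^bsub>S\<^esub>)" if "j \<in> I" for j
  proof -
    have "(pmono R \<one> {#j#}, \<zero>\<^bsub>S\<^esub>) [^]\<^bsub>Q\<^esub> q = (pmono R \<one> {#j#} [^]\<^bsub>S\<^esub> q, \<zero>\<^bsub>S\<^esub>)"
      unfolding Q_def using that c by (intro S.quad_pow_embed) auto
    then show ?thesis using that by (subst (asm) pmono_pow) auto
  qed
  have factor: "pmono R u M = pmono R \<one> (repeat_mset q {#j#}) \<otimes>\<^bsub>S\<^esub> pmono R u (M - repeat_mset q {#j#})"
    if "u \<in> carrier R" "set_mset M \<subseteq> I" "q \<le> count M j" for u M j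
  proof -
    have s: "set_mset (M - repeat_mset q {#j#}) \<subseteq> I" using that(2) by (auto dest: in_diffD)
    have "repeat_mset q {#j#} + (M - repeat_mset q {#j#}) = M"
      using that(3) by (intro multiset_eqI) auto
    then show ?thesis using pmono_mult_pmono[OF one_closed that(1) s, of "repeat_mset q {#j#}"] that(1) by simp
  qed
  have setM: "set_mset (repeat_mset k D + a) \<subseteq> I" if "a \<in> box" for k a
    using that D(1) set_repeat_mset_subset[of k D] by (auto simp: box_def)
  \<comment> \<open>Outside its cell, the image of a generator under z^q has an exponent of at least
    q in some variable j, so the q-th power of that variable splits off and
    \<open>functional_vanishes\<close> applies.\<close>
  have vanish: "\<epsilon> (\<phi> m (en f)) = \<zero>" if m: "m < r" and f: "f \<in> F - J" for m f
  proof -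
    obtain t i a where f': "f = (t, i, a)" "i < N" "a \<in> box" "a \<notin> (if t then cell D (h + 1) else cell D h)"
      using f by (cases f) (auto simp: F_def J_def split: if_splits)
    define k where "k = (if t then h + 1 else h)"
    obtain j where j: "j \<in> I" "q \<le> count (repeat_mset k D + a) j"
      using f'(3,4) unfolding cell_def box_def k_def by (auto simp: not_less add.commute split: if_splits)
    define u where "u = (\<ominus> \<one>) [^] k \<otimes> lam i"
    have u: "u \<in> carrier R" unfolding u_def using f' lam_closed by simp
    let ?M = "repeat_mset k D + a"
    have sM: "set_mset ?M \<subseteq> I" by (rule setM[OF f'(3)])
    have sM': "set_mset (?M - repeat_mset q {#j#}) \<subseteq> I"
      using subset_trans[OF set_mset_mono[OF diff_subset_eq_self] sM] .
    have ck: "c [^]\<^bsub>S\<^esub> k \<otimes>\<^bsub>S\<^esub> pmono R (lam i) a = pmono R u ?M"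
      unfolding cpow u_def using f' lam_closed by (intro pmono_mult_pmono) (auto simp: box_def)
    define E' where "E' = (if t then (pmono R u (?M - repeat_mset q {#j#}), \<zero>\<^bsub>S\<^esub>) else (\<zero>\<^bsub>S\<^esub>, pmono R u (?M - repeat_mset q {#j#})))"
    have pc: "pmono R u (?M - repeat_mset q {#j#}) \<in> carrier S" using u sM' by (rule pmono_closed)
    have xc: "pmono R \<one> (repeat_mset q {#j#}) \<in> carrier S" using j(1) by (intro pmono_closed) auto
    have ff: "pmono R u ?M = pmono R \<one> (repeat_mset q {#j#}) \<otimes>\<^bsub>S\<^esub> pmono R u (?M - repeat_mset q {#j#})"
      by (rule factor[OF u sM j(2)])
    have "(\<zero>\<^bsub>S\<^esub>, \<one>\<^bsub>S\<^esub>) [^]\<^bsub>Q\<^esub> q \<otimes>\<^bsub>Q\<^esub> en f = (pmono R \<one> {#j#}, \<zero>\<^bsub>S\<^esub>) [^]\<^bsub>Q\<^esub> q \<otimes>\<^bsub>Q\<^esub> E'"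
    proof (cases t)
      case True
      \<comment> \<open>The product of the two z-parts contributes z^2 = c, whence the level h +
        1.\<close>
      have "(\<zero>\<^bsub>S\<^esub>, c [^]\<^bsub>S\<^esub> h) \<otimes>\<^bsub>Q\<^esub> en f = (c \<otimes>\<^bsub>S\<^esub> (c [^]\<^bsub>S\<^esub> h \<otimes>\<^bsub>S\<^esub> pmono R (lam i) a), \<zero>\<^bsub>S\<^esub>)"
        using True f' mc[OF f'(2,3)] c(1) by (simp add: en_def Q_def)
      also have "c \<otimes>\<^bsub>S\<^esub> (c [^]\<^bsub>S\<^esub> h \<otimes>\<^bsub>S\<^esub> pmono R (lam i) a) = pmono R u ?M"
      proof -
        have "c [^]\<^bsub>S\<^esub> (h + 1) = c \<otimes>\<^bsub>S\<^esub> c [^]\<^bsub>S\<^esub> h"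
          using S.m_comm[OF c(1) S.nat_pow_closed[OF c(1)], of h] by simp
        then have "c \<otimes>\<^bsub>S\<^esub> (c [^]\<^bsub>S\<^esub> h \<otimes>\<^bsub>S\<^esub> pmono R (lam i) a) = c [^]\<^bsub>S\<^esub> k \<otimes>\<^bsub>S\<^esub> pmono R (lam i) a"
          using True S.m_assoc[OF c(1) S.nat_pow_closed[OF c(1)] mc[OF f'(2,3)], of h] by (simp add: k_def)
        then show ?thesis using ck by (simp only:)
      qed
      finally show ?thesis unfolding zq xpow[OF j(1)] E'_def using True ff pc xc c(1) by (simp add: Q_def)
    next
      case False
      have "(\<zero>\<^bsub>S\<^esub>, c [^]\<^bsub>S\<^esub> h) \<otimes>\<^bsub>Q\<^esub> en f = (\<zero>\<^bsub>S\<^esub>, c [^]\<^bsub>S\<^esub> h \<otimes>\<^bsub>S\<^esub> pmono R (lam i) a)"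
        using False f' mc[OF f'(2,3)] c(1) by (simp add: en_def Q_def)
      also have "c [^]\<^bsub>S\<^esub> h \<otimes>\<^bsub>S\<^esub> pmono R (lam i) a = pmono R u ?M"
        using ck False by (simp add: k_def)
      finally show ?thesis unfolding zq xpow[OF j(1)] E'_def using False ff pc xc c(1) by (simp add: Q_def)
    qed
    moreover have "E' \<in> carrier Q" using pc by (simp add: E'_def Q_def)
    ultimately show ?thesis unfolding \<epsilon>_def
      using functional_vanishes[of c j "\<phi> m" "en f" E', folded Q_def] c j(1) \<phi>(1,3) m enc f by blast
  qed
  have \<epsilon>c: "\<epsilon> x \<in> carrier R" if "x \<in> carrier Q" for x using ring_hom_memE(1)[OF \<epsilon> that] .
  \<comment> \<open>Semilinearity followed by the residue map leaves only the constant coefficients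
    of the coordinates, so the residue of the functional is linear over the field in its values on
    generators.\<close>
  have expand: "\<epsilon> (\<phi> m x) = finsum R (\<lambda>f. T x f {#} \<otimes> \<epsilon> (\<phi> m (en f))) J" if m: "m < r" and x: "x \<in> carrier Q" for m x
  proof -
    let ?g = "\<lambda>f. (T x f, \<zero>\<^bsub>S\<^esub>) [^]\<^bsub>Q\<^esub> q \<otimes>\<^bsub>Q\<^esub> en f"
    have Tq: "(T x f, \<zero>\<^bsub>S\<^esub>) \<in> carrier Q" if "f \<in> F" for f using Tc[OF x that] by (simp add: Q_def)
    have gc: "?g \<in> F \<rightarrow> carrier Q" using Tq enc by auto
    have Tm: "T x f {#} \<in> carrier R" if "f \<in> F" for f using ps_carrierD(1)[OF Tc[OF x that]] .
    have "\<epsilon> (\<phi> m x) = \<epsilon> (\<phi> m (finsum Q ?g F))" using span[OF x] by simp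
    also have "\<dots> = finsum R (\<lambda>f. \<epsilon> (\<phi> m (?g f))) F"
      using gc m \<phi>(1,2) \<epsilon>c ring_hom_memE(3)[OF \<epsilon>]
      by (intro finsum_additive[where A = Q and B = R and \<phi> = "\<lambda>x. \<epsilon> (\<phi> m x)"] Q.abelian_group_axioms abelian_group_axioms) auto
    also have "\<dots> = finsum R (\<lambda>f. T x f {#} \<otimes> \<epsilon> (\<phi> m (en f))) F"
    proof (intro finsum_cong')
      fix f assume f: "f \<in> F"
      have "\<epsilon> (\<phi> m (?g f)) = \<epsilon> ((T x f, \<zero>\<^bsub>S\<^esub>) \<otimes>\<^bsub>Q\<^esub> \<phi> m (en f))" using \<phi>(3)[OF m Tq[OF f] enc[OF f]] by simp
      also have "\<dots> = \<epsilon> (T x f, \<zero>\<^bsub>S\<^esub>) \<otimes> \<epsilon> (\<phi> m (en f))"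
        using ring_hom_memE(2)[OF \<epsilon> Tq[OF f] \<phi>(1)[OF m enc[OF f]]] .
      finally show "\<epsilon> (\<phi> m (?g f)) = T x f {#} \<otimes> \<epsilon> (\<phi> m (en f))" by (simp add: \<epsilon>_def)
    qed (use Tm \<epsilon>c \<phi>(1)[OF m] enc in auto)
    also have "\<dots> = finsum R (\<lambda>f. T x f {#} \<otimes> \<epsilon> (\<phi> m (en f))) J"
      using Ffin JF vanish[OF m] Tm \<epsilon>c \<phi>(1)[OF m] enc by (intro finsum_neutral) auto
    finally show ?thesis .
  qed
  have ac: "\<epsilon> (\<phi> m (en f)) \<in> carrier R" if "m < r" "f \<in> J" for m f
    using that JF enc \<phi>(1) \<epsilon>c by blast
  \<comment> \<open>There are more functionals than surviving generators, so a nonzero combination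
    of the functionals has residue zero on all of these.\<close>
  have "card J < card {..<r}" using contra cardJ by simp
  then obtain v where v: "v \<in> {..<r} \<rightarrow> carrier R" "\<exists>m\<in>{..<r}. v m \<noteq> \<zero>"
    "\<forall>f\<in>J. finsum R (\<lambda>m. v m \<otimes> \<epsilon> (\<phi> m (en f))) {..<r} = \<zero>"
    using homogeneous_system[of J "{..<r}" "\<lambda>m f. \<epsilon> (\<phi> m (en f))"] Jfin ac by auto
  have vc: "v m \<in> carrier R" if "m < r" for m using v(1) that by auto
  have "v l = \<zero>" if l: "l < r" for l
  proof -
    have Tm: "T (y l) f {#} \<in> carrier R" if "f \<in> J" for f using ps_carrierD(1)[OF Tc[OF y[OF l]]] JF that by blast
    \<comment> \<open>Evaluated at \<open>y l\<close>, the combination gives \<open>v l\<close> by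
      duality, and it gives zero by the expansion over \<open>J\<close>.\<close>
    have "finsum R (\<lambda>m. v m \<otimes> \<epsilon> (\<phi> m (y l))) {..<r} = v l \<otimes> \<epsilon> (\<phi> l (y l))"
      using l \<phi>(4) vc by (intro finsum_only) (auto simp: \<epsilon>_def Q_def ps_simps)
    also have "\<dots> = v l" using l \<phi>(4) vc by (simp add: \<epsilon>_def Q_def ps_simps)
    finally have "v l = finsum R (\<lambda>m. v m \<otimes> \<epsilon> (\<phi> m (y l))) {..<r}" by simp
    also have "\<dots> = finsum R (\<lambda>m. finsum R (\<lambda>f. T (y l) f {#} \<otimes> (v m \<otimes> \<epsilon> (\<phi> m (en f)))) J) {..<r}"
    proof (intro finsum_cong')
      fix m assume m: "m \<in> {..<r}"
      have "v m \<otimes> \<epsilon> (\<phi> m (y l)) = v m \<otimes> finsum R (\<lambda>f. T (y l) f {#} \<otimes> \<epsilon> (\<phi> m (en f))) J"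
        using expand[of m "y l"] m y l by simp
      also have "\<dots> = finsum R (\<lambda>f. v m \<otimes> (T (y l) f {#} \<otimes> \<epsilon> (\<phi> m (en f)))) J"
        using Jfin m vc Tm ac by (intro finsum_rdistr) auto
      also have "\<dots> = finsum R (\<lambda>f. T (y l) f {#} \<otimes> (v m \<otimes> \<epsilon> (\<phi> m (en f)))) J"
        using m vc Tm ac by (intro finsum_cong') (auto simp: m_lcomm)
      finally show "v m \<otimes> \<epsilon> (\<phi> m (y l)) = finsum R (\<lambda>f. T (y l) f {#} \<otimes> (v m \<otimes> \<epsilon> (\<phi> m (en f)))) J" .
    qed (use vc Tm ac in \<open>auto intro!: finsum_closed\<close>)
    also have "\<dots> = finsum R (\<lambda>f. finsum R (\<lambda>m. T (y l) f {#} \<otimes> (v m \<otimes> \<epsilon> (\<phi> m (en f)))) {..<r}) J"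
      using Jfin vc Tm ac by (intro finsum_swap) auto
    also have "\<dots> = \<zero>"
    proof (rule finsum_all_zero)
      fix f assume f: "f \<in> J"
      have "finsum R (\<lambda>m. T (y l) f {#} \<otimes> (v m \<otimes> \<epsilon> (\<phi> m (en f)))) {..<r}
          = T (y l) f {#} \<otimes> finsum R (\<lambda>m. v m \<otimes> \<epsilon> (\<phi> m (en f))) {..<r}"
        using f vc Tm ac by (intro finsum_rdistr[symmetric]) auto
      then show "finsum R (\<lambda>m. T (y l) f {#} \<otimes> (v m \<otimes> \<epsilon> (\<phi> m (en f)))) {..<r} = \<zero>" using v(3) f Tm by simp
    qed
    finally show ?thesis .
  qed
  then show False using v(2) by auto
qed

end


section \<open>Lower bound for the free rank\<close>

lemma frob_dual_index:
  assumes fin: "finite J" and y: "\<And>j. j \<in> J \<Longrightarrow> y j \<in> carrier A"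
    and \<phi>: "\<And>j x. j \<in> J \<Longrightarrow> x \<in> carrier A \<Longrightarrow> \<phi> j x \<in> carrier A"
    "\<And>j x x'. j \<in> J \<Longrightarrow> x \<in> carrier A \<Longrightarrow> x' \<in> carrier A \<Longrightarrow> \<phi> j (x \<oplus>\<^bsub>A\<^esub> x') = \<phi> j x \<oplus>\<^bsub>A\<^esub> \<phi> j x'"
    "\<And>j a x. j \<in> J \<Longrightarrow> a \<in> carrier A \<Longrightarrow> x \<in> carrier A \<Longrightarrow> \<phi> j (a [^]\<^bsub>A\<^esub> q \<otimes>\<^bsub>A\<^esub> x) = a \<otimes>\<^bsub>A\<^esub> \<phi> j x"
    "\<And>i j. i \<in> J \<Longrightarrow> j \<in> J \<Longrightarrow> \<phi> i (y j) = (if i = j then \<one>\<^bsub>A\<^esub> else \<zero>\<^bsub>A\<^esub>)"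
  shows "frob_dual q A (card J)"
proof -
  obtain g where g: "bij_betw g {0..<card J} J" using ex_bij_betw_nat_finite[OF fin] by blast
  have gJ: "g i \<in> J" if "i < card J" for i using g that by (auto simp: bij_betw_def)
  have gi: "g i = g j \<longleftrightarrow> i = j" if "i < card J" "j < card J" for i j
    using g that by (auto simp: bij_betw_def inj_on_def)
  show ?thesis
    by (rule frob_dualI[where y = "\<lambda>i. y (g i)" and \<phi> = "\<lambda>i. \<phi> (g i)"]) (simp_all add: y \<phi> gJ gi)
qed

section \<open>Coordinate functionals for a squarefree monomial\<close>

context kfrob
begin

text \<open>An empty cell is counted correctly: truncated subtraction produces a zero factor as soon
  as \<open>u * count D j\<close> reaches q in some variable of \<open>I\<close>.\<close>

lemma card_cell: "card (cell D u) = (\<Prod>j\<in>I. q - u * count D j)"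
proof -
  have "cell D u = {a. set_mset a \<subseteq> I \<and> (\<forall>j\<in>I. count a j < q - u * count D j)}"
    unfolding cell_def by (simp add: less_diff_conv)
  then show ?thesis using card_box[OF finI] by simp
qed

lemma tr_pmono:
  assumes i: "i < N" and a: "a \<in> box" "b \<in> box" and x: "x \<in> carrier R"
  shows "tr i b (pmono R x a) = (if b = a then pmono R (co i x) {#} else \<zero>\<^bsub>S\<^esub>)"
proof
  fix m
  have "repeat_mset q m + b = a \<longleftrightarrow> m = {#} \<and> b = a"
  proof
    assume "repeat_mset q m + b = a"
    then have "repeat_mset q m + b = repeat_mset q {#} + a" by simp
    then show "m = {#} \<and> b = a" using mset_div_mod_unique[of q m b "{#}" a] box_count a by blast
  qed auto
  then show "tr i b (pmono R x a) m = (if b = a then pmono R (co i x) {#} else \<zero>\<^bsub>S\<^esub>) m"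
    using co_zero[OF i] by (auto simp: tr_def pmono_def ps_simps)
qed

lemma tr_shift:
  assumes "P \<in> carrier S"
  shows "tr i (a + M) (pmono R \<one> M \<otimes>\<^bsub>S\<^esub> P) = tr i a P"
proof
  fix m
  have "repeat_mset q m + (a + M) - M = repeat_mset q m + a" by (simp add: add.assoc[symmetric])
  moreover have "M \<subseteq># repeat_mset q m + (a + M)" by (simp add: subseteq_mset_def)
  ultimately show "tr i (a + M) (pmono R \<one> M \<otimes>\<^bsub>S\<^esub> P) m = tr i a P m"
    unfolding tr_def pmono_mult[OF one_closed assms] by (simp add: ps_carrierD(1)[OF assms])
qed

text \<open>Membership in the cell says that each exponent of a over \<open>I\<close> is below u' =
  q - u. Subtracting u' therefore borrows one q and leaves the exponent increased by u; the borrowed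
  q in each variable is the factor with exponent D.\<close>

lemma tr_wrap:
  assumes i: "i < N" and P: "P \<in> carrier S" and D: "\<And>j. count D j = (if j \<in> I then 1 else 0)"
    and u: "u + u' = q" and a: "a \<in> cell D u"
  shows "tr i a (pmono R \<one> (repeat_mset u' D) \<otimes>\<^bsub>S\<^esub> P) = pmono R \<one> D \<otimes>\<^bsub>S\<^esub> tr i (a + repeat_mset u D) P"
proof
  fix m
  have au: "count a j < u'" if "j \<in> I" for j using a that u D[of j] unfolding cell_def by auto
  have sub: "repeat_mset u' D \<subseteq># repeat_mset q m + a \<longleftrightarrow> D \<subseteq># m"
  proof
    assume L: "repeat_mset u' D \<subseteq># repeat_mset q m + a"
    show "D \<subseteq># m" unfolding subseteq_mset_def
    proof
      fix j
      show "count D j \<le> count m j"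
      proof (cases "j \<in> I")
        case True
        have "u' \<le> q * count m j + count a j" using L D[of j] True by (auto simp: subseteq_mset_def dest: spec[of _ j])
        then have "count m j \<noteq> 0" using au[OF True] by (intro notI) simp
        then show ?thesis using D[of j] True by simp
      qed (simp add: D)
    qed
  next
    assume R: "D \<subseteq># m"
    show "repeat_mset u' D \<subseteq># repeat_mset q m + a" unfolding subseteq_mset_def
    proof
      fix j
      have "count D j \<le> count m j" using R by (simp add: subseteq_mset_def)
      then have "u' * count D j \<le> q * count m j" using u by (intro mult_le_mono) auto
      then show "count (repeat_mset u' D) j \<le> count (repeat_mset q m + a) j" by simp
    qed
  qed
  have eq: "repeat_mset q m + a - repeat_mset u' D = repeat_mset q (m - D) + (a + repeat_mset u D)" if R: "D \<subseteq># m"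
  proof (rule multiset_eqI)
    fix j
    show "count (repeat_mset q m + a - repeat_mset u' D) j = count (repeat_mset q (m - D) + (a + repeat_mset u D)) j"
    proof (cases "j \<in> I")
      case True
      then have "count m j \<ge> 1" using R D[of j] by (auto simp: subseteq_mset_def dest: spec[of _ j])
      then obtain k where k: "count m j = Suc k" by (metis Suc_le_D One_nat_def)
      have "q * Suc k + count a j - u' = q * k + count a j + u" using u[symmetric] by (simp add: algebra_simps)
      then show ?thesis using True by (simp add: D k)
    qed (simp add: D)
  qed
  have tc: "tr i (a + repeat_mset u D) P \<in> carrier S" by (rule tr_closed[OF i P])
  show "tr i a (pmono R \<one> (repeat_mset u' D) \<otimes>\<^bsub>S\<^esub> P) m = (pmono R \<one> D \<otimes>\<^bsub>S\<^esub> tr i (a + repeat_mset u D) P) m"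
    unfolding pmono_mult[OF one_closed tc] unfolding tr_def pmono_mult[OF one_closed P] sub
    using eq co_zero[OF i] i by (simp add: ps_carrierD(1)[OF P] co_closed)
qed

text \<open>The signs in the powers of c = -f are collected in powers of this element, which
  Frobenius fixes because q is odd.\<close>

abbreviation nu where "nu \<equiv> \<ominus>\<^bsub>S\<^esub> \<one>\<^bsub>S\<^esub>"

lemma nu_sq: "nu [^]\<^bsub>S\<^esub> (k::nat) \<otimes>\<^bsub>S\<^esub> nu [^]\<^bsub>S\<^esub> k = \<one>\<^bsub>S\<^esub>"
proof -
  have "nu \<otimes>\<^bsub>S\<^esub> nu = \<one>\<^bsub>S\<^esub>" by (simp add: S.l_minus S.r_minus)
  then show ?thesis using S.nat_pow_distrib[of nu nu k] by simp
qed

lemma nu_pow_add2: "nu [^]\<^bsub>S\<^esub> (k + 2 :: nat) = nu [^]\<^bsub>S\<^esub> k"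
  using nu_sq[of 1] by (simp add: numeral_2_eq_2 S.m_assoc)

lemma nu_pow_q:
  assumes "q = 2 * h + 1"
  shows "(nu [^]\<^bsub>S\<^esub> k) [^]\<^bsub>S\<^esub> q = nu [^]\<^bsub>S\<^esub> (k::nat)"
proof -
  have c: "nu [^]\<^bsub>S\<^esub> k \<in> carrier S" by simp
  have "(nu [^]\<^bsub>S\<^esub> k) [^]\<^bsub>S\<^esub> (2 * h) = \<one>\<^bsub>S\<^esub>"
    using S.nat_pow_pow[OF c, of 2 h, symmetric] nu_sq[of k] by (simp add: numeral_2_eq_2)
  then show ?thesis unfolding assms using c by simp
qed

lemma tr_sign:
  assumes "q = 2 * h + 1" "i < N" "x \<in> carrier S" "\<And>j. count a j < q"
  shows "tr i a (nu [^]\<^bsub>S\<^esub> (k::nat) \<otimes>\<^bsub>S\<^esub> x) = nu [^]\<^bsub>S\<^esub> k \<otimes>\<^bsub>S\<^esub> tr i a x"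
  using tr_semilinear[OF assms(2) _ assms(3,4), of "nu [^]\<^bsub>S\<^esub> k"] nu_pow_q[OF assms(1)] by simp

text \<open>Each generator in its cell has a coordinate functional that is linear over the whole
  ring. The first component of its value is the coordinate at the generator; the second is forced by
  linearity in z and reads the coordinate at the exponent to which z^q moves the generator. The cell
  condition says that this exponent is still below q.\<close>

lemma frob_dual_ge:
  assumes D: "\<And>j. count D j = (if j \<in> I then 1 else 0)" and ne: "I \<noteq> {}" and h: "q = 2 * h + 1"
  shows "frob_dual q (quad_ring S (pmono R (\<ominus> \<one>) D)) (N * (card (cell D h) + card (cell D (h + 1))))"
proof -
  define c where "c = pmono R (\<ominus> \<one>) D"
  define Q where "Q = quad_ring S c"
  have setD: "set_mset D \<subseteq> I" using D by (metis count_eq_zero_iff subsetI)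
  have cS: "c \<in> carrier S" unfolding c_def using setD by (intro pmono_closed) auto
  have xDc: "pmono R \<one> D \<in> carrier S" using setD by (intro pmono_closed) auto
  have c_nu: "c = nu \<otimes>\<^bsub>S\<^esub> pmono R \<one> D"
  proof
    fix m
    have "nu \<otimes>\<^bsub>S\<^esub> pmono R \<one> D = \<ominus>\<^bsub>S\<^esub> pmono R \<one> D" using xDc by (simp add: S.l_minus)
    then show "c m = (nu \<otimes>\<^bsub>S\<^esub> pmono R \<one> D) m"
      using ps_minus[OF xDc, of m] by (auto simp: c_def pmono_def minus_equality)
  qed
  have cpow: "c [^]\<^bsub>S\<^esub> k = nu [^]\<^bsub>S\<^esub> k \<otimes>\<^bsub>S\<^esub> pmono R \<one> (repeat_mset k D)" for k :: nat
  proof -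
    have "c [^]\<^bsub>S\<^esub> k = nu [^]\<^bsub>S\<^esub> k \<otimes>\<^bsub>S\<^esub> pmono R \<one> D [^]\<^bsub>S\<^esub> k"
      unfolding c_nu using xDc by (intro S.nat_pow_distrib) auto
    also have "pmono R \<one> D [^]\<^bsub>S\<^esub> k = pmono R \<one> (repeat_mset k D)"
      using pmono_pow[OF one_closed setD, of k] by simp
    finally show ?thesis .
  qed
  have xkc: "pmono R \<one> (repeat_mset k D) \<in> carrier S" for k
    using setD set_repeat_mset_subset[of k D] by (intro pmono_closed) auto
  interpret Q: cring Q unfolding Q_def by (rule S.quad_cring[OF cS])
  have Qc: "x \<in> carrier Q \<longleftrightarrow> fst x \<in> carrier S \<and> snd x \<in> carrier S" for x by (cases x) (simp add: Q_def)
  define J where "J = Sigma (UNIV :: bool set) (\<lambda>t. {..<N} \<times> (if t then cell D (h + 1) else cell D h))"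
  have Jfin: "finite J" unfolding J_def by (intro finite_SigmaI) (auto simp: finite_cell)
  have cardJ: "card J = N * (card (cell D h) + card (cell D (h + 1)))"
    unfolding J_def by (subst card_SigmaI) (auto simp: UNIV_bool finite_cell card_cartesian_product algebra_simps)
  define en where "en = (\<lambda>(t, i, a). if t then (\<zero>\<^bsub>S\<^esub>, pmono R (lam i) a) else (pmono R (lam i) a, \<zero>\<^bsub>S\<^esub>))"
  \<comment> \<open>The power of c with which z^q moves a generator of the given kind.\<close>
  define uu where "uu = (\<lambda>t. if t then h + 1 else h)"
  define \<phi> where "\<phi> = (\<lambda>(t, i, a) x. (tr i a (if t then snd x else fst x),
      nu [^]\<^bsub>S\<^esub> uu t \<otimes>\<^bsub>S\<^esub> tr i (a + repeat_mset (uu t) D) (if t then fst x else snd x)))"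
  have Jmem: "(t, i, a) \<in> J \<longleftrightarrow> i < N \<and> a \<in> cell D (uu t)" for t i a by (auto simp: J_def uu_def)
  have inbox: "a + repeat_mset u D \<in> box" if "a \<in> cell D u" for a u
    using that D setD by (auto simp: cell_def box_def split: if_splits) (metis D count_eq_zero_iff mult_is_0 zero_neq_one count_repeat_mset)+
  have abox: "a \<in> box" if "a \<in> cell D u" for a u using that cell_sub_box by blast
  have mc: "pmono R (lam i) a \<in> carrier S" if "i < N" "a \<in> box" for i a
    using that lam_closed by (auto simp: box_def)
  have "frob_dual q Q (card J)"
  proof (rule frob_dual_index[OF Jfin, where y = en and \<phi> = \<phi>])
    fix j assume "j \<in> J"
    then show "en j \<in> carrier Q" using mc abox by (cases j) (auto simp: Jmem en_def Q_def)
  next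
    fix j x assume "j \<in> J" "x \<in> carrier Q"
    then show "\<phi> j x \<in> carrier Q" using tr_closed by (cases j) (auto simp: Jmem \<phi>_def Qc)
  next
    fix j x x' assume jx: "j \<in> J" "x \<in> carrier Q" "x' \<in> carrier Q"
    obtain t i a where j: "j = (t, i, a)" by (cases j) auto
    obtain g k g' k' where x: "x = (g, k)" "x' = (g', k')" "g \<in> carrier S" "k \<in> carrier S" "g' \<in> carrier S" "k' \<in> carrier S"
      using jx by (auto simp: Q_def)
    have i: "i < N" using jx(1) j by (simp add: Jmem)
    show "\<phi> j (x \<oplus>\<^bsub>Q\<^esub> x') = \<phi> j x \<oplus>\<^bsub>Q\<^esub> \<phi> j x'"
      using i x unfolding j \<phi>_def Q_def by (simp add: tr_add tr_closed S.r_distr)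
  next
    fix j r x assume jx: "j \<in> J" "r \<in> carrier Q" "x \<in> carrier Q"
    obtain t i a where j: "j = (t, i, a)" by (cases j) auto
    obtain s w where r: "r = (s, w)" "s \<in> carrier S" "w \<in> carrier S" using jx(2) by (auto simp: Q_def)
    obtain g k where x: "x = (g, k)" "g \<in> carrier S" "k \<in> carrier S" using jx(3) by (auto simp: Q_def)
    have i: "i < N" and a: "a \<in> cell D (uu t)" using jx(1) j by (auto simp: Jmem)
    define u where "u = uu t"
    \<comment> \<open>The level of the other kind of generator: z^q exchanges the two components,
      with factors c^u and c^u', and u + u' = q.\<close>
    define u' where "u' = uu (\<not> t)"
    have uq: "u + u' = q" by (auto simp: u_def u'_def uu_def h)
    have aq: "count a l < q" for l using box_count abox[OF a] by blast
    let ?b = "a + repeat_mset u D"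
    have bq: "count ?b l < q" for l using box_count[OF inbox[OF a]] by (simp add: u_def)
    have rq: "r [^]\<^bsub>Q\<^esub> q = (s [^]\<^bsub>S\<^esub> q, w [^]\<^bsub>S\<^esub> q \<otimes>\<^bsub>S\<^esub> c [^]\<^bsub>S\<^esub> h)"
      unfolding r(1) Q_def using S.quad_frobenius[OF cS prime_p S_char h r(2,3)] .
    define P where "P = (if t then k else g)"
    define P' where "P' = (if t then g else k)"
    have P: "P \<in> carrier S" "P' \<in> carrier S" using x by (auto simp: P_def P'_def)
    define y where "y = r [^]\<^bsub>Q\<^esub> q \<otimes>\<^bsub>Q\<^esub> x"
    have sq: "s [^]\<^bsub>S\<^esub> q \<in> carrier S" "w [^]\<^bsub>S\<^esub> q \<in> carrier S" "c [^]\<^bsub>S\<^esub> l \<in> carrier S" for l :: nat using r cS by auto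
    have y1: "(if t then snd y else fst y) = s [^]\<^bsub>S\<^esub> q \<otimes>\<^bsub>S\<^esub> P \<oplus>\<^bsub>S\<^esub> w [^]\<^bsub>S\<^esub> q \<otimes>\<^bsub>S\<^esub> (c [^]\<^bsub>S\<^esub> u' \<otimes>\<^bsub>S\<^esub> P')"
      and y2: "(if t then fst y else snd y) = s [^]\<^bsub>S\<^esub> q \<otimes>\<^bsub>S\<^esub> P' \<oplus>\<^bsub>S\<^esub> w [^]\<^bsub>S\<^esub> q \<otimes>\<^bsub>S\<^esub> (c [^]\<^bsub>S\<^esub> u \<otimes>\<^bsub>S\<^esub> P)"
    proof -
      have f: "fst y = s [^]\<^bsub>S\<^esub> q \<otimes>\<^bsub>S\<^esub> g \<oplus>\<^bsub>S\<^esub> w [^]\<^bsub>S\<^esub> q \<otimes>\<^bsub>S\<^esub> (c [^]\<^bsub>S\<^esub> (h + 1) \<otimes>\<^bsub>S\<^esub> k)"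
      proof -
        have "fst y = s [^]\<^bsub>S\<^esub> q \<otimes>\<^bsub>S\<^esub> g \<oplus>\<^bsub>S\<^esub> c \<otimes>\<^bsub>S\<^esub> ((w [^]\<^bsub>S\<^esub> q \<otimes>\<^bsub>S\<^esub> c [^]\<^bsub>S\<^esub> h) \<otimes>\<^bsub>S\<^esub> k)"
          unfolding y_def rq x(1) by (simp add: Q_def)
        also have "c \<otimes>\<^bsub>S\<^esub> ((w [^]\<^bsub>S\<^esub> q \<otimes>\<^bsub>S\<^esub> c [^]\<^bsub>S\<^esub> h) \<otimes>\<^bsub>S\<^esub> k) = w [^]\<^bsub>S\<^esub> q \<otimes>\<^bsub>S\<^esub> (c [^]\<^bsub>S\<^esub> (h + 1) \<otimes>\<^bsub>S\<^esub> k)"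
          using sq cS x by (simp add: S.m_ac)
        finally show ?thesis .
      qed
      have s': "snd y = s [^]\<^bsub>S\<^esub> q \<otimes>\<^bsub>S\<^esub> k \<oplus>\<^bsub>S\<^esub> w [^]\<^bsub>S\<^esub> q \<otimes>\<^bsub>S\<^esub> (c [^]\<^bsub>S\<^esub> h \<otimes>\<^bsub>S\<^esub> g)"
        unfolding y_def rq x(1) using sq x by (simp add: Q_def S.m_assoc)
      show "(if t then snd y else fst y) = s [^]\<^bsub>S\<^esub> q \<otimes>\<^bsub>S\<^esub> P \<oplus>\<^bsub>S\<^esub> w [^]\<^bsub>S\<^esub> q \<otimes>\<^bsub>S\<^esub> (c [^]\<^bsub>S\<^esub> u' \<otimes>\<^bsub>S\<^esub> P')"
        unfolding f s' by (simp add: P_def P'_def u'_def uu_def)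
      show "(if t then fst y else snd y) = s [^]\<^bsub>S\<^esub> q \<otimes>\<^bsub>S\<^esub> P' \<oplus>\<^bsub>S\<^esub> w [^]\<^bsub>S\<^esub> q \<otimes>\<^bsub>S\<^esub> (c [^]\<^bsub>S\<^esub> u \<otimes>\<^bsub>S\<^esub> P)"
        unfolding f s' by (simp add: P_def P'_def u_def uu_def)
    qed
    let ?A = "tr i a P" and ?B = "tr i ?b P'"
    have AB: "?A \<in> carrier S" "?B \<in> carrier S" using tr_closed[OF i] P by auto
    have nc: "nu [^]\<^bsub>S\<^esub> l \<in> carrier S" for l :: nat by simp
    \<comment> \<open>Here the exponents pass a multiple of q, and the factor that comes out is one
      copy of c, as in z (A + B z) = c B + A z.\<close>
    have t1: "tr i a (c [^]\<^bsub>S\<^esub> u' \<otimes>\<^bsub>S\<^esub> P') = c \<otimes>\<^bsub>S\<^esub> (nu [^]\<^bsub>S\<^esub> u \<otimes>\<^bsub>S\<^esub> ?B)"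
    proof -
      have "tr i a (c [^]\<^bsub>S\<^esub> u' \<otimes>\<^bsub>S\<^esub> P') = tr i a (nu [^]\<^bsub>S\<^esub> u' \<otimes>\<^bsub>S\<^esub> (pmono R \<one> (repeat_mset u' D) \<otimes>\<^bsub>S\<^esub> P'))"
        unfolding cpow using xkc P nc by (simp add: S.m_assoc)
      also have "\<dots> = nu [^]\<^bsub>S\<^esub> u' \<otimes>\<^bsub>S\<^esub> tr i a (pmono R \<one> (repeat_mset u' D) \<otimes>\<^bsub>S\<^esub> P')"
        using xkc P aq by (intro tr_sign[OF h i]) auto
      also have "tr i a (pmono R \<one> (repeat_mset u' D) \<otimes>\<^bsub>S\<^esub> P') = pmono R \<one> D \<otimes>\<^bsub>S\<^esub> ?B"
        using a by (intro tr_wrap[OF i P(2) D uq]) (simp add: u_def)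
      also have "nu [^]\<^bsub>S\<^esub> u' = nu \<otimes>\<^bsub>S\<^esub> nu [^]\<^bsub>S\<^esub> u"
      proof -
        have e: "nu \<otimes>\<^bsub>S\<^esub> nu [^]\<^bsub>S\<^esub> u = nu [^]\<^bsub>S\<^esub> (u + 1)" by (simp add: S.m_comm[OF nc])
        \<comment> \<open>The two levels differ by one, and powers of \<open>nu\<close> depend only
          on the parity of the exponent.\<close>
        have "u' = u + 1 \<or> u + 1 = u' + 2" by (auto simp: u_def u'_def uu_def)
        then show ?thesis unfolding e using nu_pow_add2[of u'] by (elim disjE) (simp_all only:)
      qed
      also have "nu \<otimes>\<^bsub>S\<^esub> nu [^]\<^bsub>S\<^esub> u \<otimes>\<^bsub>S\<^esub> (pmono R \<one> D \<otimes>\<^bsub>S\<^esub> ?B) = c \<otimes>\<^bsub>S\<^esub> (nu [^]\<^bsub>S\<^esub> u \<otimes>\<^bsub>S\<^esub> ?B)"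
      proof -
        have "nu \<in> carrier S" by simp
        then show ?thesis unfolding c_nu using nc[of u] xDc AB(2) by (simp only: S.m_assoc S.m_closed S.m_lcomm[of "nu [^]\<^bsub>S\<^esub> u" "pmono R \<one> D" ?B])
      qed
      finally show ?thesis .
    qed
    \<comment> \<open>Here no multiple of q is crossed: the shift in the coordinate undoes
      multiplication by the monomial, and the signs cancel.\<close>
    have t2: "nu [^]\<^bsub>S\<^esub> u \<otimes>\<^bsub>S\<^esub> tr i ?b (c [^]\<^bsub>S\<^esub> u \<otimes>\<^bsub>S\<^esub> P) = ?A"
    proof -
      have "tr i ?b (c [^]\<^bsub>S\<^esub> u \<otimes>\<^bsub>S\<^esub> P) = tr i ?b (nu [^]\<^bsub>S\<^esub> u \<otimes>\<^bsub>S\<^esub> (pmono R \<one> (repeat_mset u D) \<otimes>\<^bsub>S\<^esub> P))"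
        unfolding cpow using xkc P nc by (simp add: S.m_assoc)
      also have "\<dots> = nu [^]\<^bsub>S\<^esub> u \<otimes>\<^bsub>S\<^esub> tr i ?b (pmono R \<one> (repeat_mset u D) \<otimes>\<^bsub>S\<^esub> P)"
        using xkc P bq by (intro tr_sign[OF h i]) auto
      also have "tr i ?b (pmono R \<one> (repeat_mset u D) \<otimes>\<^bsub>S\<^esub> P) = ?A" by (rule tr_shift[OF P(1)])
      finally show ?thesis using AB nc nu_sq[of u] by (simp add: S.m_assoc[symmetric])
    qed
    have cP: "c [^]\<^bsub>S\<^esub> u' \<otimes>\<^bsub>S\<^esub> P' \<in> carrier S" "c [^]\<^bsub>S\<^esub> u \<otimes>\<^bsub>S\<^esub> P \<in> carrier S" using sq P by auto
    have "\<phi> j y = (tr i a (if t then snd y else fst y), nu [^]\<^bsub>S\<^esub> u \<otimes>\<^bsub>S\<^esub> tr i ?b (if t then fst y else snd y))"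
      by (simp add: j \<phi>_def u_def)
    also have "tr i a (if t then snd y else fst y) = s \<otimes>\<^bsub>S\<^esub> ?A \<oplus>\<^bsub>S\<^esub> w \<otimes>\<^bsub>S\<^esub> tr i a (c [^]\<^bsub>S\<^esub> u' \<otimes>\<^bsub>S\<^esub> P')"
      unfolding y1 using i sq P cP r aq by (simp add: tr_add tr_semilinear)
    also have "tr i ?b (if t then fst y else snd y) = s \<otimes>\<^bsub>S\<^esub> ?B \<oplus>\<^bsub>S\<^esub> w \<otimes>\<^bsub>S\<^esub> tr i ?b (c [^]\<^bsub>S\<^esub> u \<otimes>\<^bsub>S\<^esub> P)"
      unfolding y2 using i sq P cP r tr_add tr_semilinear[OF i _ _ bq] by simp
    also have "nu [^]\<^bsub>S\<^esub> u \<otimes>\<^bsub>S\<^esub> (s \<otimes>\<^bsub>S\<^esub> ?B \<oplus>\<^bsub>S\<^esub> w \<otimes>\<^bsub>S\<^esub> tr i ?b (c [^]\<^bsub>S\<^esub> u \<otimes>\<^bsub>S\<^esub> P))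
        = s \<otimes>\<^bsub>S\<^esub> (nu [^]\<^bsub>S\<^esub> u \<otimes>\<^bsub>S\<^esub> ?B) \<oplus>\<^bsub>S\<^esub> w \<otimes>\<^bsub>S\<^esub> ?A"
    proof -
      have tb: "tr i ?b (c [^]\<^bsub>S\<^esub> u \<otimes>\<^bsub>S\<^esub> P) \<in> carrier S" using tr_closed[OF i cP(2)] .
      have "nu [^]\<^bsub>S\<^esub> u \<otimes>\<^bsub>S\<^esub> (s \<otimes>\<^bsub>S\<^esub> ?B \<oplus>\<^bsub>S\<^esub> w \<otimes>\<^bsub>S\<^esub> tr i ?b (c [^]\<^bsub>S\<^esub> u \<otimes>\<^bsub>S\<^esub> P))
        = s \<otimes>\<^bsub>S\<^esub> (nu [^]\<^bsub>S\<^esub> u \<otimes>\<^bsub>S\<^esub> ?B) \<oplus>\<^bsub>S\<^esub> w \<otimes>\<^bsub>S\<^esub> (nu [^]\<^bsub>S\<^esub> u \<otimes>\<^bsub>S\<^esub> tr i ?b (c [^]\<^bsub>S\<^esub> u \<otimes>\<^bsub>S\<^esub> P))"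
        using r AB tb nc[of u] S.m_lcomm[OF nc[of u] r(2) AB(2)] S.m_lcomm[OF nc[of u] r(3) tb] by (simp only: S.r_distr S.m_closed)
      then show ?thesis unfolding t2 .
    qed
    also have "tr i a (c [^]\<^bsub>S\<^esub> u' \<otimes>\<^bsub>S\<^esub> P') = c \<otimes>\<^bsub>S\<^esub> (nu [^]\<^bsub>S\<^esub> u \<otimes>\<^bsub>S\<^esub> ?B)" by (rule t1)
    also have "w \<otimes>\<^bsub>S\<^esub> (c \<otimes>\<^bsub>S\<^esub> (nu [^]\<^bsub>S\<^esub> u \<otimes>\<^bsub>S\<^esub> ?B)) = c \<otimes>\<^bsub>S\<^esub> (w \<otimes>\<^bsub>S\<^esub> (nu [^]\<^bsub>S\<^esub> u \<otimes>\<^bsub>S\<^esub> ?B))"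
      using r cS AB nc[of u] by (intro S.m_lcomm) auto
    finally have "\<phi> j y = (s, w) \<otimes>\<^bsub>Q\<^esub> (?A, nu [^]\<^bsub>S\<^esub> u \<otimes>\<^bsub>S\<^esub> ?B)" by (simp add: Q_def)
    then show "\<phi> j (r [^]\<^bsub>Q\<^esub> q \<otimes>\<^bsub>Q\<^esub> x) = r \<otimes>\<^bsub>Q\<^esub> \<phi> j x"
      unfolding y_def r(1) by (simp add: j \<phi>_def u_def x(1) P_def P'_def)
  next
    fix j j' assume jj: "j \<in> J" "j' \<in> J"
    obtain t i a where j: "j = (t, i, a)" by (cases j) auto
    obtain t' i' a' where j': "j' = (t', i', a')" by (cases j') auto
    have i: "i < N" "i' < N" and a: "a \<in> cell D (uu t)" "a' \<in> cell D (uu t')"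
      using jj j j' by (auto simp: Jmem)
    have tr0: "tr i b \<zero>\<^bsub>S\<^esub> = \<zero>\<^bsub>S\<^esub>" for b using co_zero[OF i(1)] by (simp add: tr_def ps_simps fun_eq_iff)
    have o: "pmono R \<one> {#} = \<one>\<^bsub>S\<^esub>" "pmono R \<zero> {#} = \<zero>\<^bsub>S\<^esub>" by (simp_all add: ps_one_eq) (auto simp: pmono_def ps_simps)
    have trm: "tr i b (pmono R (lam i') a') = (if b = a' \<and> i = i' then \<one>\<^bsub>S\<^esub> else \<zero>\<^bsub>S\<^esub>)" if "b \<in> box" for b
      using tr_pmono[OF i(1) abox[OF a(2)] that lam_closed[OF i(2)]] co_lam[OF i] o by auto
    show "\<phi> j (en j') = (if j = j' then \<one>\<^bsub>Q\<^esub> else \<zero>\<^bsub>Q\<^esub>)"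
    proof (cases "t = t'")
      case True
      then show ?thesis using trm[OF abox[OF a(1)]] tr0 by (simp add: j j' \<phi>_def en_def Q_def) auto
    next
      case False
      \<comment> \<open>For generators of different kinds the levels add up to q, so a' is below
        \<open>uu t\<close> in the variable l while the shifted exponent is not; the two exponents
        differ.\<close>
      obtain l where l: "l \<in> I" using ne by blast
      have "count a' l + uu t' < q" using a(2) l D[of l] by (auto simp: cell_def)
      then have "count a' l < uu t" using False h by (auto simp: uu_def split: if_splits)
      then have "a + repeat_mset (uu t) D \<noteq> a'" using D[of l] l by auto
      then have "tr i (a + repeat_mset (uu t) D) (pmono R (lam i') a') = \<zero>\<^bsub>S\<^esub>" using trm[OF inbox[OF a(1)]] by simp
      then show ?thesis using False tr0 by (auto simp: j j' \<phi>_def en_def Q_def)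
    qed
  qed
  then show ?thesis unfolding cardJ Q_def c_def .
qed

end


section \<open>Krull dimension of the hypersurface\<close>

text \<open>This sets the variables outside \<open>A\<close> to zero. It is multiplicative because a
  monomial over \<open>A\<close> only splits into monomials over \<open>A\<close>.\<close>

lemma (in cring) ps_restrict_hom:
  fixes A I :: "'i set"
  assumes "A \<subseteq> I"
  shows "(\<lambda>g m. if set_mset m \<subseteq> A then g m else \<zero>) \<in> ring_hom (PS I) (PS A)"
proof (rule ring_hom_memI)
  have cl: "(\<lambda>m. if set_mset m \<subseteq> A then x m else \<zero>) \<in> carrier (PS A)" if "x \<in> carrier (PS I)" for x
    using that by (intro ps_carrierI) (simp_all add: ps_carrierD)
  fix x y assume x: "x \<in> carrier (PS I)" and y: "y \<in> carrier (PS I)"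
  show "(\<lambda>m. if set_mset m \<subseteq> A then x m else \<zero>) \<in> carrier (PS A)" by (rule cl[OF x])
  show "(\<lambda>m. if set_mset m \<subseteq> A then (x \<oplus>\<^bsub>PS I\<^esub> y) m else \<zero>) =
      (\<lambda>m. if set_mset m \<subseteq> A then x m else \<zero>) \<oplus>\<^bsub>PS A\<^esub> (\<lambda>m. if set_mset m \<subseteq> A then y m else \<zero>)"
    by (auto simp: fun_eq_iff ps_simps(4))
  show "(\<lambda>m. if set_mset m \<subseteq> A then (x \<otimes>\<^bsub>PS I\<^esub> y) m else \<zero>) =
      (\<lambda>m. if set_mset m \<subseteq> A then x m else \<zero>) \<otimes>\<^bsub>PS A\<^esub> (\<lambda>m. if set_mset m \<subseteq> A then y m else \<zero>)" (is "?l = ?r")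
  proof
    fix m
    have xc: "x a \<in> carrier R" "y a \<in> carrier R" for a using x y by (auto simp: ps_carrierD)
    show "?l m = ?r m"
    proof (cases "set_mset m \<subseteq> A")
      case True
      have "set_mset a \<subseteq> A" "set_mset (m - a) \<subseteq> A" if "a \<subseteq># m" for a
        using set_mset_mono[OF that] set_mset_mono[OF diff_subset_eq_self[of m a]] True by auto
      then show ?thesis using True xc unfolding ps_simps(1) by (simp, intro finsum_cong') auto
    next
      case False
      have "?r m = \<zero>"
        by (rule ps_carrierD(2)[OF ps_mult_closed[OF cl[OF x] cl[OF y]] False])
      then show ?thesis using False by simp
    qed
  qed
qed (auto simp: ps_simps fun_eq_iff)

section \<open>Leading terms of products and a chain of primes of full length\<close>

context kseries
begin

lemma lead_unique: "is_lead f \<mu> \<Longrightarrow> is_lead f \<nu> \<Longrightarrow> \<mu> = \<nu>"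
  unfolding is_lead_def using mless_linear by blast

text \<open>If neither part of a splitting were below the leading monomial of its factor, the
  product monomial would not be below \<open>\<mu> + \<nu>\<close>.\<close>

lemma is_lead_mult:
  assumes f: "f \<in> carrier S" "is_lead f \<mu>" and g: "g \<in> carrier S" "is_lead g \<nu>"
  shows "is_lead (f \<otimes>\<^bsub>S\<^esub> g) (\<mu> + \<nu>)"
  unfolding is_lead_def
proof safe
  assume "(f \<otimes>\<^bsub>S\<^esub> g) (\<mu> + \<nu>) = \<zero>"
  then have "f \<mu> \<otimes> g \<nu> = \<zero>" using lead_mult[OF f(1) g(1) f(2) g(2)] by simp
  then show False using f g by (auto simp: is_lead_def integral_iff ps_carrierD)
next
  fix m assume m: "mless m (\<mu> + \<nu>)"
  have "f a \<otimes> g (m - a) = \<zero>" if a: "a \<subseteq># m" for a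
  proof (cases "mless a \<mu>")
    case True
    then show ?thesis using f g by (simp add: is_lead_def ps_carrierD)
  next
    case False
    have "mless (m - a) \<nu>"
    proof (rule ccontr)
      assume "\<not> mless (m - a) \<nu>"
      then have 1: "\<nu> = m - a \<or> mless \<nu> (m - a)" using mless_linear by blast
      have 2: "\<mu> = a \<or> mless \<mu> a" using False mless_linear by blast
      have ma: "m = a + (m - a)" using a by simp
      have 3: "\<mu> + \<nu> = a + \<nu> \<or> mless (\<mu> + \<nu>) (a + \<nu>)" using 2 mless_add by blast
      have 4: "a + \<nu> = m \<or> mless (a + \<nu>) m" using 1 mless_add[of \<nu> a "m - a"] ma by (metis add.commute)
      show False using m 3 4 mless_trans mless_irrefl by metis
    qed
    then show ?thesis using f g by (simp add: is_lead_def ps_carrierD)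
  qed
  then show "(f \<otimes>\<^bsub>S\<^esub> g) m = \<zero>" unfolding ps_simps(1) by (intro finsum_all_zero) auto
qed

lemma is_lead_pmono: "x \<noteq> \<zero> \<Longrightarrow> is_lead (pmono R x M) M"
  by (auto simp: is_lead_def pmono_def)

text \<open>If the norm form \<open>a\<^sup>2 - c b\<^sup>2\<close> is anisotropic, then \<open>z\<^sup>2 = c\<close> defines a domain; otherwise comparing
  leading terms exhibits a square root of \<open>c\<close>.\<close>

lemma quad_domain_or_sqrt:
  assumes D: "set_mset D \<subseteq> I"
  shows "domain (quad_ring S (pmono R (\<ominus> \<one>) D)) \<or>
    (\<exists>i\<in>carrier R. \<exists>E. i \<otimes> i = \<ominus> \<one> \<and> D = E + E)"
proof (rule disjCI)
  assume no: "\<not> (\<exists>i\<in>carrier R. \<exists>E. i \<otimes> i = \<ominus> \<one> \<and> D = E + E)"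
  define c where "c = pmono R (\<ominus> \<one>) D"
  have cS: "c \<in> carrier S" unfolding c_def using D by (intro pmono_closed) auto
  interpret SD: domain S by (rule S_domain)
  interpret Q: cring "quad_ring S c" by (rule S.quad_cring[OF cS])
  have aniso: "a = \<zero>\<^bsub>S\<^esub> \<and> b = \<zero>\<^bsub>S\<^esub>" if ab: "a \<in> carrier S" "b \<in> carrier S" "a \<otimes>\<^bsub>S\<^esub> a = c \<otimes>\<^bsub>S\<^esub> (b \<otimes>\<^bsub>S\<^esub> b)" for a b
  proof (rule ccontr)
    assume n: "\<not> ?thesis"
    have "c \<noteq> \<zero>\<^bsub>S\<^esub>"
    proof
      assume "c = \<zero>\<^bsub>S\<^esub>"
      from fun_cong[OF this, of D] have "\<ominus> \<one> = \<zero>" by (simp add: c_def pmono_def ps_simps)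
      then show False by simp
    qed
    moreover have bb: "b \<otimes>\<^bsub>S\<^esub> b \<in> carrier S" using ab by simp
    ultimately have ab0: "a = \<zero>\<^bsub>S\<^esub> \<longleftrightarrow> b = \<zero>\<^bsub>S\<^esub>"
      using SD.integral_iff[OF ab(1,1)] SD.integral_iff[OF cS bb] SD.integral_iff[OF ab(2,2)] ab(3) by metis
    then have nz: "a \<noteq> \<zero>\<^bsub>S\<^esub>" "b \<noteq> \<zero>\<^bsub>S\<^esub>" using n by auto
    obtain \<mu> \<nu> where l: "is_lead a \<mu>" "is_lead b \<nu>" using lead_exists nz by metis
    have neg: "\<ominus> \<one> \<noteq> \<zero>" by simp
    have lc: "is_lead c D" unfolding c_def by (rule is_lead_pmono[OF neg])
    have la: "is_lead (a \<otimes>\<^bsub>S\<^esub> a) (\<mu> + \<mu>)" using is_lead_mult ab l by blast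
    have lb: "is_lead (b \<otimes>\<^bsub>S\<^esub> b) (\<nu> + \<nu>)" using is_lead_mult ab l by blast
    have lcb: "is_lead (c \<otimes>\<^bsub>S\<^esub> (b \<otimes>\<^bsub>S\<^esub> b)) (D + (\<nu> + \<nu>))" by (rule is_lead_mult[OF cS lc bb lb])
    \<comment> \<open>Comparison of leading monomials makes D even in every variable, with half E =
      \<open>\<mu> - \<nu>\<close>; comparison of leading coefficients then gives a square root of
      -1.\<close>
    have eq: "\<mu> + \<mu> = D + (\<nu> + \<nu>)" using lead_unique la lcb ab(3) by metis
    have \<nu>\<mu>: "\<nu> \<subseteq># \<mu>"
    proof (rule mset_subset_eqI)
      fix j
      have "2 * count \<mu> j = count D j + 2 * count \<nu> j" using arg_cong[OF eq, of "\<lambda>x. count x j"] by simp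
      then show "count \<nu> j \<le> count \<mu> j" by linarith
    qed
    define E where "E = \<mu> - \<nu>"
    have DE: "D = E + E"
    proof (rule multiset_eqI)
      fix j
      have "2 * count \<mu> j = count D j + 2 * count \<nu> j" using arg_cong[OF eq, of "\<lambda>x. count x j"] by simp
      then show "count D j = count (E + E) j" by (simp add: E_def)
    qed
    define x where "x = a \<mu>"
    define y where "y = b \<nu>"
    have xy: "x \<in> carrier R" "y \<in> carrier R" "y \<noteq> \<zero>" using ab l by (auto simp: x_def y_def ps_carrierD is_lead_def)
    have "x \<otimes> x = (a \<otimes>\<^bsub>S\<^esub> a) (\<mu> + \<mu>)" unfolding x_def using lead_mult[OF ab(1,1) l(1,1)] by simp
    also have "\<dots> = (c \<otimes>\<^bsub>S\<^esub> (b \<otimes>\<^bsub>S\<^esub> b)) (D + (\<nu> + \<nu>))" by (simp only: ab(3) eq)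
    also have "\<dots> = c D \<otimes> (b \<otimes>\<^bsub>S\<^esub> b) (\<nu> + \<nu>)" by (rule lead_mult[OF cS bb lc lb])
    also have "(b \<otimes>\<^bsub>S\<^esub> b) (\<nu> + \<nu>) = y \<otimes> y" unfolding y_def using lead_mult[OF ab(2,2) l(2,2)] by simp
    finally have xx: "x \<otimes> x = \<ominus> (y \<otimes> y)" using xy by (simp add: c_def pmono_def l_minus)
    define u where "u = inv y"
    have u: "u \<in> carrier R" "y \<otimes> u = \<one>" using xy field_Units by (auto simp: u_def)
    have "(x \<otimes> u) \<otimes> (x \<otimes> u) = (x \<otimes> x) \<otimes> (u \<otimes> u)" using xy u by (simp add: m_ac)
    also have "\<dots> = \<ominus> ((y \<otimes> u) \<otimes> (y \<otimes> u))" unfolding xx using xy u(1) by (simp add: l_minus r_minus m_ac)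
    finally have "(x \<otimes> u) \<otimes> (x \<otimes> u) = \<ominus> \<one>" using u by simp
    then show False using no DE xy u by blast
  qed
  have "domain (quad_ring S c)"
  proof (intro domain.intro Q.cring_axioms domain_axioms.intro)
    show "\<one>\<^bsub>quad_ring S c\<^esub> \<noteq> \<zero>\<^bsub>quad_ring S c\<^esub>" by simp
    fix x y assume xy: "x \<otimes>\<^bsub>quad_ring S c\<^esub> y = \<zero>\<^bsub>quad_ring S c\<^esub>" "x \<in> carrier (quad_ring S c)" "y \<in> carrier (quad_ring S c)"
    obtain a b a' b' where x: "x = (a, b)" "a \<in> carrier S" "b \<in> carrier S" and y: "y = (a', b')" "a' \<in> carrier S" "b' \<in> carrier S"
      using xy by auto
    have e1: "a \<otimes>\<^bsub>S\<^esub> a' \<oplus>\<^bsub>S\<^esub> c \<otimes>\<^bsub>S\<^esub> (b \<otimes>\<^bsub>S\<^esub> b') = \<zero>\<^bsub>S\<^esub>" and e2: "a \<otimes>\<^bsub>S\<^esub> b' \<oplus>\<^bsub>S\<^esub> b \<otimes>\<^bsub>S\<^esub> a' = \<zero>\<^bsub>S\<^esub>"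
      using xy(1) x y by auto
    \<comment> \<open>The norm of x. Multiplying x y = 0 by the conjugate of x yields M y = 0, read
      off in both components.\<close>
    define M where "M = a \<otimes>\<^bsub>S\<^esub> a \<ominus>\<^bsub>S\<^esub> c \<otimes>\<^bsub>S\<^esub> (b \<otimes>\<^bsub>S\<^esub> b)"
    have Mc: "M \<in> carrier S" using x cS by (simp add: M_def)
    have "M \<otimes>\<^bsub>S\<^esub> a' = a \<otimes>\<^bsub>S\<^esub> (a \<otimes>\<^bsub>S\<^esub> a' \<oplus>\<^bsub>S\<^esub> c \<otimes>\<^bsub>S\<^esub> (b \<otimes>\<^bsub>S\<^esub> b')) \<ominus>\<^bsub>S\<^esub> (c \<otimes>\<^bsub>S\<^esub> b) \<otimes>\<^bsub>S\<^esub> (a \<otimes>\<^bsub>S\<^esub> b' \<oplus>\<^bsub>S\<^esub> b \<otimes>\<^bsub>S\<^esub> a')"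
      unfolding M_def using x(2,3) y(2,3) cS by algebra
    then have M1: "M \<otimes>\<^bsub>S\<^esub> a' = \<zero>\<^bsub>S\<^esub>" unfolding e1 e2 using x cS by (simp add: a_minus_def S.r_neg)
    have "M \<otimes>\<^bsub>S\<^esub> b' = a \<otimes>\<^bsub>S\<^esub> (a \<otimes>\<^bsub>S\<^esub> b' \<oplus>\<^bsub>S\<^esub> b \<otimes>\<^bsub>S\<^esub> a') \<ominus>\<^bsub>S\<^esub> b \<otimes>\<^bsub>S\<^esub> (a \<otimes>\<^bsub>S\<^esub> a' \<oplus>\<^bsub>S\<^esub> c \<otimes>\<^bsub>S\<^esub> (b \<otimes>\<^bsub>S\<^esub> b'))"
      unfolding M_def using x(2,3) y(2,3) cS by algebra
    then have M2: "M \<otimes>\<^bsub>S\<^esub> b' = \<zero>\<^bsub>S\<^esub>" unfolding e1 e2 using x by (simp add: a_minus_def S.r_neg)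
    show "x = \<zero>\<^bsub>quad_ring S c\<^esub> \<or> y = \<zero>\<^bsub>quad_ring S c\<^esub>"
    proof (cases "M = \<zero>\<^bsub>S\<^esub>")
      case True
      then have "a \<otimes>\<^bsub>S\<^esub> a = c \<otimes>\<^bsub>S\<^esub> (b \<otimes>\<^bsub>S\<^esub> b)" unfolding M_def using x cS by simp
      then show ?thesis using aniso[OF x(2,3)] x(1) by simp
    next
      case False
      then have "a' = \<zero>\<^bsub>S\<^esub>" "b' = \<zero>\<^bsub>S\<^esub>" using M1 M2 Mc y by (auto simp: SD.integral_iff)
      then show ?thesis using y(1) by simp
    qed
  qed
  then show "domain (quad_ring S (pmono R (\<ominus> \<one>) D))" unfolding c_def .
qed

text \<open>The kernel of the map that sends z and the variables outside \<open>A\<close> to zero.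
  It is a ring homomorphism because D involves a variable outside \<open>A\<close>, so c goes to
  zero; its target is a domain.\<close>

lemma quad_restrict_kernel_prime:
  assumes "A \<subseteq> I" and D: "set_mset D \<subseteq> I" "\<not> set_mset D \<subseteq> A"
  shows "primeideal {x \<in> carrier (quad_ring S (pmono R (\<ominus> \<one>) D)). \<forall>m. set_mset m \<subseteq> A \<longrightarrow> fst x m = \<zero>} (quad_ring S (pmono R (\<ominus> \<one>) D))"
proof -
  define c where "c = pmono R (\<ominus> \<one>) D"
  have cS: "c \<in> carrier S" unfolding c_def using D by (intro pmono_closed) auto
  define \<rho> where "\<rho> = (\<lambda>(g :: 'i multiset \<Rightarrow> 'a) m. if set_mset m \<subseteq> A then g m else \<zero>)"
  have \<rho>: "\<rho> \<in> ring_hom S (PS A)" unfolding \<rho>_def by (rule ps_restrict_hom[OF assms(1)])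
  interpret A: kseries R A by unfold_locales (rule finite_subset[OF assms(1) finI])
  interpret Q: cring "quad_ring S c" by (rule S.quad_cring[OF cS])
  have \<rho>c: "\<rho> c = \<zero>\<^bsub>PS A\<^esub>" using D(2) by (auto simp: \<rho>_def c_def pmono_def fun_eq_iff ps_simps)
  note \<rho>E = ring_hom_memE[OF \<rho>]
  have "(\<lambda>x. \<rho> (fst x)) \<in> ring_hom (quad_ring S c) (PS A)"
  proof (rule ring_hom_memI)
    fix x y assume "x \<in> carrier (quad_ring S c)" "y \<in> carrier (quad_ring S c)"
    then show "\<rho> (fst (x \<otimes>\<^bsub>quad_ring S c\<^esub> y)) = \<rho> (fst x) \<otimes>\<^bsub>PS A\<^esub> \<rho> (fst y)"
      using cS \<rho>c \<rho>E(1) by (auto simp: \<rho>E(2,3))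
  qed (use \<rho>E in auto)
  then have h: "ring_hom_ring (quad_ring S c) (PS A) (\<lambda>x. \<rho> (fst x))"
    unfolding ring_hom_ring_def ring_hom_ring_axioms_def by (intro conjI Q.ring_axioms A.S.ring_axioms)
  have "primeideal {\<zero>\<^bsub>PS A\<^esub>} (PS A)" by (rule domain.zeroprimeideal[OF A.S_domain])
  from ring_hom_ring.primeideal_vimage[OF h Q.cring_axioms this]
  have "primeideal {x \<in> carrier (quad_ring S c). \<rho> (fst x) \<in> {\<zero>\<^bsub>PS A\<^esub>}} (quad_ring S c)" .
  moreover have "\<rho> g \<in> {\<zero>\<^bsub>PS A\<^esub>} \<longleftrightarrow> (\<forall>m. set_mset m \<subseteq> A \<longrightarrow> g m = \<zero>)" for g
    by (auto simp: \<rho>_def fun_eq_iff ps_simps)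
  ultimately show ?thesis unfolding c_def by simp
qed

text \<open>Supplies the bottom of the chain. In a domain it is the zero ideal; otherwise c = w^2
  and it is the kernel of z going to w. The last property places it inside the kernel obtained by
  setting z and the variable j to zero.\<close>

lemma quad_minimal_prime:
  assumes D: "set_mset D \<subseteq> I" "j \<in># D"
  obtains P where "primeideal P (quad_ring S (pmono R (\<ominus> \<one>) D))" "(pmono R \<one> {#j#}, \<zero>\<^bsub>S\<^esub>) \<notin> P"
    "\<And>x m. x \<in> P \<Longrightarrow> j \<notin># m \<Longrightarrow> fst x m = \<zero>"
proof -
  define c where "c = pmono R (\<ominus> \<one>) D"
  have cS: "c \<in> carrier S" unfolding c_def using D by (intro pmono_closed) auto
  have jI: "j \<in> I" using D by auto
  have x0: "pmono R \<one> {#j#} \<noteq> \<zero>\<^bsub>S\<^esub>"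
  proof
    assume "pmono R \<one> {#j#} = \<zero>\<^bsub>S\<^esub>"
    from fun_cong[OF this, of "{#j#}"] show False by (simp add: pmono_def ps_simps)
  qed
  interpret Q: cring "quad_ring S c" by (rule S.quad_cring[OF cS])
  from quad_domain_or_sqrt[OF D(1)] show thesis
  proof
    assume "domain (quad_ring S (pmono R (\<ominus> \<one>) D))"
    then have "primeideal {\<zero>\<^bsub>quad_ring S c\<^esub>} (quad_ring S c)"
      unfolding c_def by (rule domain.zeroprimeideal)
    then show thesis using x0 by (intro that[of "{\<zero>\<^bsub>quad_ring S c\<^esub>}"]) (auto simp: c_def ps_simps)
  next
    assume "\<exists>i\<in>carrier R. \<exists>E. i \<otimes> i = \<ominus> \<one> \<and> D = E + E"
    then obtain i E where i: "i \<in> carrier R" "i \<otimes> i = \<ominus> \<one>" and E: "D = E + E" by blast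
    define w where "w = pmono R i E"
    have setE: "set_mset E \<subseteq> I" "j \<in># E" using D E by auto
    have w: "w \<in> carrier S" unfolding w_def using i setE by (intro pmono_closed) auto
    have ww: "w \<otimes>\<^bsub>S\<^esub> w = c" unfolding w_def c_def E i(2)[symmetric] using i(1) setE by (intro pmono_mult_pmono) auto
    have "(\<lambda>x. fst x \<oplus>\<^bsub>S\<^esub> snd x \<otimes>\<^bsub>S\<^esub> w) \<in> ring_hom (quad_ring S c) S"
    proof (rule ring_hom_memI)
      fix x y assume "x \<in> carrier (quad_ring S c)" "y \<in> carrier (quad_ring S c)"
      then obtain a b a' b' where x: "x = (a, b)" "a \<in> carrier S" "b \<in> carrier S" and y: "y = (a', b')" "a' \<in> carrier S" "b' \<in> carrier S"
        by auto
      show "fst (x \<otimes>\<^bsub>quad_ring S c\<^esub> y) \<oplus>\<^bsub>S\<^esub> snd (x \<otimes>\<^bsub>quad_ring S c\<^esub> y) \<otimes>\<^bsub>S\<^esub> w =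
          (fst x \<oplus>\<^bsub>S\<^esub> snd x \<otimes>\<^bsub>S\<^esub> w) \<otimes>\<^bsub>S\<^esub> (fst y \<oplus>\<^bsub>S\<^esub> snd y \<otimes>\<^bsub>S\<^esub> w)"
        unfolding x(1) y(1) quad_simps fst_conv snd_conv ww[symmetric] using x(2,3) y(2,3) w by algebra
      show "fst (x \<oplus>\<^bsub>quad_ring S c\<^esub> y) \<oplus>\<^bsub>S\<^esub> snd (x \<oplus>\<^bsub>quad_ring S c\<^esub> y) \<otimes>\<^bsub>S\<^esub> w =
          (fst x \<oplus>\<^bsub>S\<^esub> snd x \<otimes>\<^bsub>S\<^esub> w) \<oplus>\<^bsub>S\<^esub> (fst y \<oplus>\<^bsub>S\<^esub> snd y \<otimes>\<^bsub>S\<^esub> w)"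
        unfolding x(1) y(1) quad_simps fst_conv snd_conv using x(2,3) y(2,3) w by algebra
    qed (use w in auto)
    then have h: "ring_hom_ring (quad_ring S c) S (\<lambda>x. fst x \<oplus>\<^bsub>S\<^esub> snd x \<otimes>\<^bsub>S\<^esub> w)"
      unfolding ring_hom_ring_def ring_hom_ring_axioms_def by (intro conjI Q.ring_axioms S.ring_axioms)
    define P where "P = {x \<in> carrier (quad_ring S c). fst x \<oplus>\<^bsub>S\<^esub> snd x \<otimes>\<^bsub>S\<^esub> w \<in> {\<zero>\<^bsub>S\<^esub>}}"
    have "primeideal P (quad_ring S c)" unfolding P_def
      by (rule ring_hom_ring.primeideal_vimage[OF h Q.cring_axioms domain.zeroprimeideal[OF S_domain]])
    moreover have "(pmono R \<one> {#j#}, \<zero>\<^bsub>S\<^esub>) \<notin> P" using x0 w jI by (auto simp: P_def)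
    moreover have "fst x m = \<zero>" if x: "x \<in> P" "j \<notin># m" for x m
    proof -
      obtain a b where ab: "x = (a, b)" "a \<in> carrier S" "b \<in> carrier S" "a \<oplus>\<^bsub>S\<^esub> b \<otimes>\<^bsub>S\<^esub> w = \<zero>\<^bsub>S\<^esub>"
        using x(1) by (auto simp: P_def)
      \<comment> \<open>In the kernel a = -b w, and the monomial w involves the variable j.\<close>
      have "\<not> E \<subseteq># m" using setE(2) x(2) by (meson mset_subset_eqD)
      then have "(b \<otimes>\<^bsub>S\<^esub> w) m = \<zero>" unfolding S.m_comm[OF ab(3) w] unfolding w_def pmono_mult[OF i(1) ab(3)] by simp
      moreover have "a m \<oplus> (b \<otimes>\<^bsub>S\<^esub> w) m = \<zero>" using fun_cong[OF ab(4), of m] unfolding ps_simps(3,4) .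
      ultimately show ?thesis using ps_carrierD(1)[OF ab(2), of m] ab(1) by simp
    qed
    ultimately show thesis unfolding c_def by (rule that)
  qed
qed

text \<open>The upper bound is the contraction to \<open>S\<close>. For the lower bound the
  variables are set to zero one after the other, and the variables themselves witness that the
  inclusions are strict.\<close>

lemma krull_dim_quad:
  assumes D: "set_mset D = I" and ne: "I \<noteq> {}"
  shows "krull_dim (quad_ring S (pmono R (\<ominus> \<one>) D)) = enat (card I)"
proof -
  define c where "c = pmono R (\<ominus> \<one>) D"
  define Q where "Q = quad_ring S c"
  have cS: "c \<in> carrier S" unfolding c_def using D by (intro pmono_closed) auto
  let ?L = "{enat l | l. \<exists>P :: nat \<Rightarrow> _ set. (\<forall>i\<le>l. primeideal (P i) Q) \<and> (\<forall>i<l. P i \<subset> P (Suc i))}"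
  have up: "x \<le> enat (card I)" if "x \<in> ?L" for x
    using that prime_chain_quad_le[OF cS, folded Q_def] by fastforce
  obtain xs where xs: "set xs = I" "distinct xs" using finite_distinct_list[OF finI] by blast
  have len: "length xs = card I" using xs distinct_card by force
  have len0: "length xs > 0" using ne xs by auto
  define j0 where "j0 = xs ! 0"
  have j0: "j0 \<in> I" using len0 xs by (auto simp: j0_def)
  obtain P0 where P0: "primeideal P0 Q" "(pmono R \<one> {#j0#}, \<zero>\<^bsub>S\<^esub>) \<notin> P0" "\<And>x m. x \<in> P0 \<Longrightarrow> j0 \<notin># m \<Longrightarrow> fst x m = \<zero>"
    using quad_minimal_prime[of D j0] D j0 unfolding Q_def c_def by auto
  define Pr where "Pr = (\<lambda>i. {x \<in> carrier Q. \<forall>m. set_mset m \<subseteq> set (drop i xs) \<longrightarrow> fst x m = \<zero>})"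
  \<comment> \<open>For i > 0 this is the kernel of setting z and the first i variables to zero. For
    i = 0 that map is not multiplicative, as c does not vanish under it, so \<open>P0\<close> takes
    its place.\<close>
  define P where "P = (\<lambda>i. if i = 0 then P0 else Pr i)"
  have not_in: "xs ! i \<notin> set (drop (Suc i) xs)" if "i < length xs" for i
  proof -
    have "drop i xs = xs ! i # drop (Suc i) xs" using Cons_nth_drop_Suc[OF that] by simp
    then show ?thesis using distinct_drop[OF xs(2), of i] by simp
  qed
  have prime: "primeideal (P i) Q" if "i \<le> length xs" for i
  proof (cases "i = 0")
    case False
    have "j0 \<notin> set (drop i xs)"
    proof -
      have "set (drop i xs) \<subseteq> set (drop (Suc 0) xs)" using False by (intro set_drop_subset_set_drop) simp
      then show ?thesis using not_in[of 0] len0 by (auto simp: j0_def)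
    qed
    then have "\<not> set_mset D \<subseteq> set (drop i xs)" using D j0 by blast
    moreover have "set (drop i xs) \<subseteq> I" using xs set_drop_subset by metis
    ultimately show ?thesis using quad_restrict_kernel_prime[of "set (drop i xs)" D] D False
      by (simp add: P_def Pr_def Q_def c_def)
  qed (simp add: P_def P0)
  have var_in: "(pmono R \<one> {#xs ! i#}, \<zero>\<^bsub>S\<^esub>) \<in> Pr (Suc i)" if "i < length xs" for i
    using not_in[OF that] nth_mem[OF that] xs(1) by (auto simp: Pr_def Q_def pmono_def intro!: pmono_closed[unfolded pmono_def])
  have strict: "P i \<subset> P (Suc i)" if i: "i < length xs" for i
  proof (cases "i = 0")
    case True
    have "P0 \<subseteq> carrier Q" using P0(1) additive_subgroup.a_subset ideal.axioms(1) primeideal.axioms(1) by blast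
    moreover have "j0 \<notin># m" if "set_mset m \<subseteq> set (drop (Suc 0) xs)" for m
      using that not_in[of 0] len0 by (auto simp: j0_def)
    ultimately have "P0 \<subseteq> Pr (Suc 0)" unfolding Pr_def using P0(3) by blast
    moreover have "(pmono R \<one> {#j0#}, \<zero>\<^bsub>S\<^esub>) \<in> Pr (Suc 0)" using var_in[of 0] len0 by (simp add: j0_def)
    ultimately show ?thesis using True P0(2) by (auto simp: P_def)
  next
    case False
    have "set (drop (Suc i) xs) \<subseteq> set (drop i xs)" by (intro set_drop_subset_set_drop) simp
    then have "Pr i \<subseteq> Pr (Suc i)" unfolding Pr_def by blast
    moreover have "(pmono R \<one> {#xs ! i#}, \<zero>\<^bsub>S\<^esub>) \<notin> Pr i"
    proof
      assume "(pmono R \<one> {#xs ! i#}, \<zero>\<^bsub>S\<^esub>) \<in> Pr i"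
      moreover have "xs ! i \<in> set (drop i xs)" using Cons_nth_drop_Suc[OF i] by (metis list.set_intros(1))
      ultimately have "pmono R \<one> {#xs ! i#} {#xs ! i#} = \<zero>" by (auto simp: Pr_def)
      then show False by (simp add: pmono_def)
    qed
    ultimately show ?thesis using False var_in[OF i] by (auto simp: P_def)
  qed
  have "enat (card I) \<in> ?L" using prime strict unfolding len by blast
  then have "Sup ?L = enat (card I)" using up by (intro antisym Sup_least Sup_upper)
  then show ?thesis unfolding krull_dim_def Q_def c_def .
qed

lemma finprod_vars:
  assumes "A \<subseteq> I"
  shows "finprod S (\<lambda>j. indexed_var j [^]\<^bsub>S\<^esub> (d j :: nat)) A = pmono R \<one> (\<Sum>j\<in>A. replicate_mset (d j) j)"
proof -
  have "finite A" using assms finI finite_subset by blast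
  then show ?thesis using assms
  proof (induction A rule: finite_induct)
    case (insert x F)
    have v: "indexed_var j [^]\<^bsub>S\<^esub> (d j :: nat) = pmono R \<one> (replicate_mset (d j) j)" if "j \<in> I" for j
      unfolding indexed_var_pmono using that by (subst pmono_pow) auto
    have vc: "pmono R \<one> (replicate_mset (d j) j) \<in> carrier S" if "j \<in> I" for j
      using that by (intro pmono_closed) (auto split: if_splits)
    have set: "set_mset (\<Sum>j\<in>F. replicate_mset (d j) j) \<subseteq> I"
      using insert by (auto simp: set_mset_sum split: if_splits)
    have "finprod S (\<lambda>j. indexed_var j [^]\<^bsub>S\<^esub> (d j :: nat)) (insert x F) =
        indexed_var x [^]\<^bsub>S\<^esub> (d x :: nat) \<otimes>\<^bsub>S\<^esub> finprod S (\<lambda>j. indexed_var j [^]\<^bsub>S\<^esub> (d j :: nat)) F"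
      using insert v vc by (intro S.finprod_insert) auto
    also have "\<dots> = pmono R (\<one> \<otimes> \<one>) (replicate_mset (d x) x + (\<Sum>j\<in>F. replicate_mset (d j) j))"
      using insert v set by (simp add: pmono_mult_pmono del: r_one l_one)
    finally show ?case using insert by simp
  qed (simp add: ps_one_eq)
qed

end


section \<open>The F-signature\<close>

text \<open>Rank zero always occurs, so the set whose maximum defines the free rank is
  nonempty.\<close>

lemma frob_dual_0: "frob_dual q A 0"
  by (rule frob_dualI[where y = undefined and \<phi> = undefined]) simp_all

lemma ring_iso_units:
  assumes "\<psi> \<in> ring_iso A B" "x \<in> Units A" "\<psi> ` carrier A = carrier B"
  shows "\<psi> x \<in> Units B"
proof -
  obtain y where y: "y \<in> carrier A" "y \<otimes>\<^bsub>A\<^esub> x = \<one>\<^bsub>A\<^esub>" "x \<otimes>\<^bsub>A\<^esub> y = \<one>\<^bsub>A\<^esub>" "x \<in> carrier A"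
    using assms(2) unfolding Units_def by blast
  note E = ring_iso_memE[OF assms(1)]
  have "\<psi> y \<otimes>\<^bsub>B\<^esub> \<psi> x = \<one>\<^bsub>B\<^esub>" "\<psi> x \<otimes>\<^bsub>B\<^esub> \<psi> y = \<one>\<^bsub>B\<^esub>" "\<psi> x \<in> carrier B" "\<psi> y \<in> carrier B"
    using E(1)[OF y(1)] E(1)[OF y(4)] E(2)[OF y(1,4)] E(2)[OF y(4,1)] E(4) y(2,3) by simp_all
  then show ?thesis unfolding Units_def by blast
qed

theorem proposition8p1:
  fixes K :: "('k, 'm) ring_scheme" and p n :: nat and d :: "nat \<Rightarrow> nat"
  assumes "field K"
    and "Factorial_Ring.prime p" and "ring_char K = p" and "p > 2"
    and "ring.finite_dimension K (pth_powers p K) (carrier K)"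
    and "n \<ge> 1"
    and "\<And>j. j \<in> {1..n} \<Longrightarrow> d j \<ge> 1"
  defines "S \<equiv> power_series_ring K {1..n}"
  defines "f \<equiv> (\<Otimes>\<^bsub>S\<^esub>j\<in>{1..n}. ring.indexed_var K j [^]\<^bsub>S\<^esub> d j)"
  defines "T \<equiv> power_series_ring S {()}"
  defines "z \<equiv> ring.indexed_var S ()"
  defines "R \<equiv> T Quot (PIdl\<^bsub>T\<^esub> (ring.indexed_const S f \<oplus>\<^bsub>T\<^esub> z [^]\<^bsub>T\<^esub> (2::nat)))"
  shows "convergent (F_signature_seq R) \<and>
         ((\<forall>j\<in>{1..n}. d j = 1) \<longrightarrow> F_signature R = 1 / 2 ^ (n - 1)) \<and>
         (Max (d ` {1..n}) \<ge> 2 \<longrightarrow> F_signature R = 0)"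
proof -
  interpret K: field K by fact
  interpret KS: kseries K "{1..n}" by unfold_locales simp
  have char_K: "[p] \<cdot>\<^bsub>K\<^esub> \<one>\<^bsub>K\<^esub> = \<zero>\<^bsub>K\<^esub>" using K.ring_char_kills assms(3) by simp
  note p = assms(2) char_K
  have S_eq: "KS.S = S" by (simp add: S_def)
  interpret S: cring S using KS.S.cring_axioms unfolding S_eq .
  interpret T: cring T unfolding T_def by (rule S.ps_cring)

  define D where "D = (\<Sum>j\<in>{1..n}. replicate_mset (d j) j)"
  have cD: "count D j = (if j \<in> {1..n} then d j else 0)" for j
    unfolding D_def by (rule count_sum_replicate) simp
  have setD: "set_mset D = {1..n}"
  proof (rule Set.set_eqI)
    fix j
    have "j \<in># D \<longleftrightarrow> count D j > 0" by simp
    also have "\<dots> \<longleftrightarrow> j \<in> {1..n}" unfolding cD using assms(7)[of j] by auto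
    finally show "j \<in># D \<longleftrightarrow> j \<in> {1..n}" .
  qed
  have D0: "D \<noteq> {#}" using setD assms(6) by auto
  have f: "f = pmono K \<one>\<^bsub>K\<^esub> D"
    unfolding f_def D_def by (rule KS.finprod_vars[of "{1..n}" d, unfolded S_eq, OF subset_refl])
  have fS: "f \<in> carrier S" unfolding f S_def using setD by (intro K.pmono_closed) auto
  have fo: "f \<in> K.ord_ge 1" using D0 unfolding K.ord_ge_def f pmono_def by auto
  define c where "c = pmono K (\<ominus>\<^bsub>K\<^esub> \<one>\<^bsub>K\<^esub>) D"
  have z0: "\<ominus>\<^bsub>K\<^esub> \<zero>\<^bsub>K\<^esub> = \<zero>\<^bsub>K\<^esub>" by (rule K.minus_equality) auto
  have c: "\<ominus>\<^bsub>S\<^esub> f = c"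
  proof
    fix m show "(\<ominus>\<^bsub>S\<^esub> f) m = c m"
      using K.ps_minus[of f "{1..n}" m] fS z0 unfolding S_def by (simp add: f c_def pmono_def)
  qed
  have cS: "c \<in> carrier S" using fS c by auto
  have c0: "c {#} = \<zero>\<^bsub>K\<^esub>" using D0 by (simp add: c_def pmono_def)
  define Q where "Q = quad_ring S c"
  interpret Q: cring Q unfolding Q_def by (rule S.quad_cring[OF cS])
  obtain \<psi> where \<psi>: "\<psi> \<in> ring_iso Q R"
    using K.quad_ring_iso_quotient[of f "{1..n}"] fS fo c unfolding R_def T_def z_def Q_def S_def by auto
  have fT: "ring.indexed_const S f \<oplus>\<^bsub>T\<^esub> z [^]\<^bsub>T\<^esub> (2::nat) \<in> carrier T"
  proof -
    have "ring.indexed_const S f \<in> carrier T" "z \<in> carrier T"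
      unfolding T_def z_def S.indexed_const_pmono S.indexed_var_pmono using fS by (auto intro!: S.pmono_closed)
    then show ?thesis by simp
  qed
  interpret R: cring R unfolding R_def
    by (rule ideal.quotient_is_cring[OF T.cgenideal_ideal[OF fT] T.cring_axioms])
  have bij: "bij_betw \<psi> (carrier Q) (carrier R)" using \<psi> by (simp add: ring_iso_def)
  define \<psi>' where "\<psi>' = inv_into (carrier Q) \<psi>"
  have \<psi>': "\<psi>' \<in> ring_iso R Q" unfolding \<psi>'_def by (rule ring_iso_set_sym[OF Q.ring_axioms \<psi>])

  \<comment> \<open>The characteristic passes along injective homomorphisms from \<open>K\<close> to
    \<open>S\<close>, to pairs, and to the quotient.\<close>
  have charR: "ring_char R = p"
  proof -
    have h1: "(\<lambda>k. pmono K k {#}) \<in> ring_hom K S"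
    proof (rule ring_hom_memI)
      fix x y assume xy: "x \<in> carrier K" "y \<in> carrier K"
      show "pmono K x {#} \<in> carrier S" unfolding S_def using xy by (intro K.pmono_closed) auto
      show "pmono K (x \<otimes>\<^bsub>K\<^esub> y) {#} = pmono K x {#} \<otimes>\<^bsub>S\<^esub> pmono K y {#}"
        unfolding S_def using xy by (subst K.pmono_mult_pmono) auto
      show "pmono K (x \<oplus>\<^bsub>K\<^esub> y) {#} = pmono K x {#} \<oplus>\<^bsub>S\<^esub> pmono K y {#}"
        unfolding S_def by (auto simp: fun_eq_iff ps_simps(4) pmono_def)
    qed (simp add: S_def K.ps_one_eq)
    have i1: "inj_on (\<lambda>k. pmono K k {#}) (carrier K)"
      by (rule inj_onI) (auto dest!: fun_cong[of _ _ "{#}"] simp: pmono_def)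
    have "ring_char K = ring_char S" by (rule ring_char_inj_hom[OF K.ring_axioms S.ring_axioms h1 i1])
    also have "\<dots> = ring_char Q"
      unfolding Q_def by (rule ring_char_inj_hom[OF S.ring_axioms Q.ring_axioms[unfolded Q_def] S.quad_embed_hom[OF cS]])
        (auto simp: inj_on_def)
    also have "\<dots> = ring_char R"
      using \<psi> by (intro ring_char_inj_hom[OF Q.ring_axioms R.ring_axioms, of \<psi>]) (auto simp: ring_iso_def bij_betw_def)
    finally show ?thesis using assms(3) by simp
  qed
  have charR': "[p] \<cdot>\<^bsub>R\<^esub> \<one>\<^bsub>R\<^esub> = \<zero>\<^bsub>R\<^esub>" using R.ring_char_kills charR by simp

  obtain s where s: "ring.dimension K s (pth_powers p K) (carrier K)"
    using assms(5) unfolding K.finite_dimension_def by blast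
  have s0: "s > 0" by (rule K.frob_basis_exists(1)[OF p s])

  have krull: "krull_dim R = enat n"
    using krull_dim_iso[OF \<psi> Q.cring_axioms R.cring_axioms] KS.krull_dim_quad[OF setD] assms(6)
    unfolding Q_def c_def S_def by simp

  have alpha: "alpha p R = log (real p) (real s)"
  proof (rule alpha_local)
    \<comment> \<open>The residue map of the quotient: the constant coefficient of the part without
      z.\<close>
    let ?h = "\<lambda>Y. fst (\<psi>' Y) {#}"
    have e: "(\<lambda>x. fst x {#}) \<in> ring_hom Q K"
      unfolding Q_def using KS.quad_eps_hom[of c] cS c0 unfolding S_def by simp
    have "(\<lambda>x. fst x {#}) \<circ> \<psi>' \<in> ring_hom R K"
      using ring_hom_trans[OF _ e, of \<psi>' R] \<psi>' by (simp add: ring_iso_def)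
    then show "?h \<in> ring_hom R K" by (simp add: comp_def)
    have \<psi>'im: "\<psi>' ` carrier R = carrier Q" using \<psi>' by (simp add: ring_iso_def bij_betw_def)
    have "(\<lambda>x. fst x {#}) ` carrier Q = carrier K"
    proof
      show "(\<lambda>x. fst x {#}) ` carrier Q \<subseteq> carrier K" using ring_hom_memE(1)[OF e] by auto
      show "carrier K \<subseteq> (\<lambda>x. fst x {#}) ` carrier Q"
      proof
        fix k assume "k \<in> carrier K"
        then have "pmono K k {#} \<in> carrier S" unfolding S_def by (intro K.pmono_closed) auto
        then show "k \<in> (\<lambda>x. fst x {#}) ` carrier Q"
          by (intro image_eqI[of _ _ "(pmono K k {#}, \<zero>\<^bsub>S\<^esub>)"]) (auto simp: Q_def pmono_def)
      qed
    qed
    then show "?h ` carrier R = carrier K" unfolding \<psi>'im[symmetric] by (simp add: image_image)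
    fix a assume a: "a \<in> carrier R" "?h a \<noteq> \<zero>\<^bsub>K\<^esub>"
    have a': "\<psi>' a \<in> carrier Q" using \<psi>'im a by blast
    then have "\<psi>' a \<in> Units Q" unfolding Q_def using KS.quad_unit[of c "\<psi>' a"] cS c0 a(2) unfolding S_def by simp
    then have "\<psi> (\<psi>' a) \<in> Units R" using ring_iso_units[OF \<psi>] bij by (auto simp: bij_betw_def)
    moreover have "\<psi> (\<psi>' a) = a" unfolding \<psi>'_def using bij a(1) by (rule bij_betw_inv_into_right)
    ultimately show "a \<in> Units R" by simp
  qed (use R.cring_axioms K.field_axioms s K.pth_powers_subfield[OF p] in auto)

  define rk where "rk = (\<lambda>e. max_free_rank R (frobenius_pushforward p e R))"
  have p0: "p > 0" using assms(4) by simp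
  have summand_iff: "has_free_summand R (frobenius_pushforward p e R) r \<longleftrightarrow> frob_dual (p ^ e) Q r" for e r
  proof -
    have "has_free_summand R (frobenius_pushforward p e R) r \<longleftrightarrow> frob_dual (p ^ e) R r"
      by (rule has_free_summand_pushforward[OF R.cring_axioms R.frobenius_add[OF assms(2) charR'] p0])
    also have "\<dots> \<longleftrightarrow> frob_dual (p ^ e) Q r"
      using frob_dual_iso[OF \<psi> Q.ring_axioms R.ring_axioms] frob_dual_iso[OF \<psi>' R.ring_axioms Q.ring_axioms] by blast
    finally show ?thesis .
  qed
  \<comment> \<open>The exponent n + log_p s splits the denominator into q^n and s^e; the latter is
    the degree of \<open>K\<close> over its q-th powers and cancels against the same factor in the
    rank.\<close>
  have seq: "F_signature_seq R e = real (rk e) / ((real p ^ e) ^ n * real s ^ e)" for e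
  proof -
    have "real p powr (real e * (real n + log (real p) (real s))) = (real p powr real n * real p powr log (real p) (real s)) powr real e"
      by (simp add: powr_add[symmetric] powr_powr mult.commute)
    also have "\<dots> = (real p ^ n * real s) ^ e"
      using assms(4) s0 by (simp add: powr_realpow)
    also have "\<dots> = (real p ^ e) ^ n * real s ^ e"
      by (simp add: power_mult_distrib power_mult[symmetric] mult.commute)
    finally show ?thesis unfolding F_signature_seq_def charR Let_def krull alpha the_enat.simps rk_def by simp
  qed

  have podd: "odd p" using assms(2,4) primes_dvd_imp_eq two_is_prime_nat by (metis less_irrefl)
  define hh where "hh = (\<lambda>e. (p ^ e - 1) div 2)"
  have hh: "p ^ e = 2 * hh e + 1" for e
  proof -
    have "odd (p ^ e)" using podd by simp
    then show ?thesis unfolding hh_def by (elim oddE) simp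
  qed
  \<comment> \<open>The size of the cell of level u, written without reference to a basis of
    \<open>K\<close>.\<close>
  define U where "U = (\<lambda>e u. \<Prod>j\<in>{1..n}. p ^ e - u * count D j)"
  have ub: "frob_dual (p ^ e) Q r \<Longrightarrow> r \<le> s ^ e * (U e (hh e) + U e (hh e + 1))" for e r
  proof -
    obtain lam co where "frob_basis K (p ^ e) (s ^ e) lam co" using K.frob_basis_exists(2)[OF p s] by blast
    then interpret kf: kfrob K "{1..n}" p e "s ^ e" lam co
      using p KS.kseries_axioms by (simp add: kfrob_def kfrob_axioms_def)
    show "frob_dual (p ^ e) Q r \<Longrightarrow> r \<le> s ^ e * (U e (hh e) + U e (hh e + 1))"
      using kf.frob_dual_le[of D "hh e" r] setD D0 hh unfolding kf.card_cell U_def Q_def c_def S_def by simp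
  qed
  have rk_le: "rk e \<le> s ^ e * (U e (hh e) + U e (hh e + 1))" for e
  proof -
    have "{r. has_free_summand R (frobenius_pushforward p e R) r} \<subseteq> {..s ^ e * (U e (hh e) + U e (hh e + 1))}"
      using ub unfolding summand_iff by auto
    moreover have "0 \<in> {r. has_free_summand R (frobenius_pushforward p e R) r}"
      unfolding summand_iff by (simp add: frob_dual_0)
    ultimately show ?thesis unfolding rk_def max_free_rank_def by (subst Max_le_iff) (auto intro: finite_subset)
  qed
  have rk_eq: "rk e = s ^ e * ((hh e + 1) ^ n + hh e ^ n)" if d1: "\<forall>j\<in>{1..n}. d j = 1" for e
  proof -
    \<comment> \<open>With all exponents 1, the levels h and h + 1 leave q - h = h + 1 and q - (h +
      1) = h exponents per variable.\<close>
    have U: "U e (hh e) = (hh e + 1) ^ n" "U e (hh e + 1) = hh e ^ n"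
    proof -
      have "U e u = (p ^ e - u) ^ n" for u unfolding U_def using d1 by (simp add: cD)
      then show "U e (hh e) = (hh e + 1) ^ n" "U e (hh e + 1) = hh e ^ n" using hh[of e] by simp_all
    qed
    obtain lam co where "frob_basis K (p ^ e) (s ^ e) lam co" using K.frob_basis_exists(2)[OF p s] by blast
    then interpret kf: kfrob K "{1..n}" p e "s ^ e" lam co
      using p KS.kseries_axioms by (simp add: kfrob_def kfrob_axioms_def)
    have "frob_dual (p ^ e) Q (s ^ e * (U e (hh e) + U e (hh e + 1)))"
      using kf.frob_dual_ge[of D "hh e"] hh assms(6) d1 unfolding kf.card_cell U_def Q_def c_def S_def by (simp add: cD)
    then have "Max {r. frob_dual (p ^ e) Q r} = s ^ e * (U e (hh e) + U e (hh e + 1))"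
      using ub by (intro Max_eqI finite_subset[of "{r. frob_dual (p ^ e) Q r}" "{..s ^ e * (U e (hh e) + U e (hh e + 1))}"]) auto
    then show ?thesis unfolding rk_def max_free_rank_def summand_iff U .
  qed

  have lim1: "F_signature_seq R \<longlonglongrightarrow> 1 / 2 ^ (n - 1)" if d1: "\<forall>j\<in>{1..n}. d j = 1"
  proof -
    \<comment> \<open>Substituting h = (q - 1) / 2 gives an exact formula in 1 / q, from which the
      limit is immediate.\<close>
    have feq: "F_signature_seq R e = ((1 + inverse (real p ^ e)) / 2) ^ n + ((1 - inverse (real p ^ e)) / 2) ^ n" for e
    proof -
      define q where "q = real p ^ e"
      have q: "q > 0" using p0 by (simp add: q_def)
      have "real (p ^ e) = 2 * real (hh e) + 1" by (subst hh) simp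
      then have h: "real (hh e) = (q - 1) / 2" by (simp add: q_def)
      have "F_signature_seq R e = (real s ^ e * (((q + 1) / 2) ^ n + ((q - 1) / 2) ^ n)) / (q ^ n * real s ^ e)"
        unfolding seq rk_eq[OF d1] q_def[symmetric] by (simp add: h add_divide_distrib) (simp add: field_simps)
      also have "\<dots> = (((q + 1) / 2) ^ n + ((q - 1) / 2) ^ n) / q ^ n" using s0 by simp
      also have "\<dots> = ((q + 1) / 2 / q) ^ n + ((q - 1) / 2 / q) ^ n"
        by (subst add_divide_distrib) (simp only: power_divide)
      also have "(q + 1) / 2 / q = (1 + inverse q) / 2" using q by (simp add: field_simps)
      also have "(q - 1) / 2 / q = (1 - inverse q) / 2" using q by (simp add: field_simps)
      finally show ?thesis unfolding q_def .
    qed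
    have "(\<lambda>e. ((1 + inverse (real p ^ e)) / 2) ^ n + ((1 - inverse (real p ^ e)) / 2) ^ n)
        \<longlonglongrightarrow> ((1 + 0) / 2) ^ n + ((1 - 0) / 2) ^ n"
      using assms(4) by (intro tendsto_intros LIMSEQ_inverse_realpow_zero) auto
    also have "((1 + 0) / 2) ^ n + ((1 - 0) / 2) ^ n = (1 / 2 ^ (n - 1) :: real)"
      using assms(6) by (cases n) (auto simp: power_divide)
    finally show ?thesis unfolding feq[symmetric] .
  qed
  have lim2: "F_signature_seq R \<longlonglongrightarrow> 0" if d2: "j0 \<in> {1..n}" "d j0 \<ge> 2" for j0
  proof -
    have bound: "F_signature_seq R e \<le> inverse (real p ^ e)" for e
    proof -
      let ?q = "p ^ e"
      have split: "U e u = (?q - u * d j0) * (\<Prod>j\<in>{1..n} - {j0}. ?q - u * count D j)" for u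
        unfolding U_def using prod.remove[of "{1..n}" j0 "\<lambda>j. ?q - u * count D j"] d2(1) by (simp add: cD)
      have m: "2 * u \<le> u * d j0" for u using mult_le_mono2[OF d2(2), of u] by (simp only: mult.commute)
      \<comment> \<open>Since 2 h = q - 1, a multiplicity of at least 2 leaves at most one exponent
        of \<open>j0\<close> at level h and none at level h + 1; the other variables contribute at
        most q each.\<close>
      have "?q \<le> hh e * d j0 + 1" using m[of "hh e"] hh[of e] by simp
      moreover have "?q \<le> 2 * (hh e + 1)" using hh[of e] by simp
      from this m have "?q \<le> (hh e + 1) * d j0" by (rule order_trans)
      ultimately have f1: "?q - hh e * d j0 \<le> 1" and f2: "?q - (hh e + 1) * d j0 = 0" by simp_all
      have "(\<Prod>j\<in>{1..n} - {j0}. ?q - hh e * count D j) \<le> (\<Prod>j\<in>{1..n} - {j0}. ?q)" by (intro prod_mono) auto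
      also have "\<dots> = ?q ^ (n - 1)" using d2(1) by simp
      finally have "U e (hh e) \<le> 1 * ?q ^ (n - 1)" unfolding split using f1 by (intro mult_le_mono)
      moreover have "U e (hh e + 1) = 0" unfolding split f2 by simp
      ultimately have "rk e \<le> s ^ e * ?q ^ (n - 1)" using rk_le[of e] by (metis add.right_neutral le_trans mult_1 mult_le_mono2)
      then have "real (rk e) \<le> real s ^ e * (real p ^ e) ^ (n - 1)" by (metis of_nat_le_iff of_nat_mult of_nat_power)
      moreover have pos: "(real p ^ e) ^ n * real s ^ e > 0" using p0 s0 by simp
      ultimately have "F_signature_seq R e \<le> (real s ^ e * (real p ^ e) ^ (n - 1)) / ((real p ^ e) ^ n * real s ^ e)"
        unfolding seq by (intro divide_right_mono) auto
      also have "(real p ^ e) ^ n = real p ^ e * (real p ^ e) ^ (n - 1)" using assms(6) by (cases n) auto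
      also have "(real s ^ e * (real p ^ e) ^ (n - 1)) / (real p ^ e * (real p ^ e) ^ (n - 1) * real s ^ e) = inverse (real p ^ e)"
        using p0 s0 by (simp add: field_simps)
      finally show ?thesis .
    qed
    show ?thesis
    proof (rule tendsto_sandwich[where f = "\<lambda>_. 0" and h = "\<lambda>e. inverse (real p ^ e)"])
      show "(\<lambda>e. inverse (real p ^ e)) \<longlonglongrightarrow> 0" using assms(4) by (intro LIMSEQ_inverse_realpow_zero) simp
    qed (use bound in \<open>auto simp: seq\<close>)
  qed
  show ?thesis
  proof (intro conjI impI)
    show "F_signature R = 1 / 2 ^ (n - 1)" if "\<forall>j\<in>{1..n}. d j = 1"
      unfolding F_signature_def by (rule limI[OF lim1[OF that]])
    have ex: "\<exists>j0\<in>{1..n}. d j0 \<ge> 2" if "Max (d ` {1..n}) \<ge> 2"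
    proof -
      have "Max (d ` {1..n}) \<in> d ` {1..n}" using assms(6) by (intro Max_in) auto
      then show ?thesis using that by auto
    qed
    show "F_signature R = 0" if "Max (d ` {1..n}) \<ge> 2"
      using ex[OF that] lim2 unfolding F_signature_def by (auto intro: limI)
    show "convergent (F_signature_seq R)"
    proof (cases "\<forall>j\<in>{1..n}. d j = 1")
      case True
      then show ?thesis using lim1 by (auto simp: convergent_def)
    next
      case False
      then obtain j0 where "j0 \<in> {1..n}" "d j0 \<noteq> 1" by blast
      then have "d j0 \<ge> 2" using assms(7)[of j0] by linarith
      then show ?thesis using lim2[OF \<open>j0 \<in> {1..n}\<close>] by (auto simp: convergent_def)
    qed
  qed
qed

end
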